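(* Let $\vec n(d)=(n_1(d),\ldots,n_p(d))$, $d=1,2,\ldots$, be a sequence of multi-indices of positive integers such that, with $n(d)=|\vec n(d)|$, $\lim_{d\to\infty}\vec n(d)/n(d)=(r_1,\ldots,r_p)$. For $i=1,\ldots,p$ let $\tau_i$ be a finite positive Borel measure on $\Gamma_i$ satisfying the Bernstein–Markov (BM) inequality on $\Gamma_i$. Then almost surely in the Angelesco ensemble the normalized counting measure of a random point converges to the equilibrium measure; that is, for almost every sequence $(X_{\vec n(d)})_{d\ge1}$ in the product probability space $\prod_{d=1}^\infty(\mathbb R^{n(d)},Prob_{\vec n(d)})$, $$\lim_{d\to\infty}\frac1{n(d)}\delta(X_{\vec n(d)})=\mu_\Gamma\quad\text{weak*}.$$
   Context: Fix $p\ge1$ and pairwise disjoint non-degenerate compact intervals $\Gamma_1,\ldots,\Gamma_p\subset\mathbb R$, with $\Gamma_{j+1}$ to the right of $\Gamma_j$; let $\Gamma=\Gamma_1\cup\cdots\cup\Gamma_p$. Fix reals $r_1,\ldots,r_p>0$ with $\sum_i r_i=1$. For a multi-index $\vec n=(n_1,\ldots,n_p)$ of positive integers put $n=|\vec n|=n_1+\cdots+n_p$. Let $L_n=\{x\in\mathbb R^n: x_1\le\cdots\le x_n\}$ and let $\rho:\mathbb R^n\to L_n$ be the map that sorts coordinates into nondecreasing order. A vector $X\in\Gamma_1^{n_1}\times\cdots\times\Gamma_p^{n_p}\subset\mathbb R^n$ is written $X=(X^{(1)},\ldots,X^{(p)})$ with $X^{(i)}=(x^{(i)}_1,\ldots,x^{(i)}_{n_i})\in\Gamma_i^{n_i}$.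 For vectors $Y=(y_1,\ldots,y_m)$, $Y'=(y'_1,\ldots,y'_l)$ let $\Delta(Y)=\prod_{j<k}(y_k-y_j)$ and $\Delta(Y,Y')=\prod_{k=1}^m\prod_{j=1}^l(y_k-y'_j)$. Define $$A_{\vec n}(X)=\prod_{i=1}^p\Delta(X^{(i)})^2\prod_{1\le i<j\le p}\Delta(X^{(j)},X^{(i)})\ \ (\ge0).$$ With $d\tau(X)=\prod_{i=1}^p\prod_{k=1}^{n_i}d\tau_i(x^{(i)}_k)$ (a measure on $\Gamma_1^{n_1}\times\cdots\times\Gamma_p^{n_p}$) and $Z_{\vec n}=\int_{L_n}A_{\vec n}(X)\,d\tau(X)$ (integral over $L_n\cap(\Gamma_1^{n_1}\times\cdots\times\Gamma_p^{n_p})$), $Prob_{\vec n}$ is the probability measure on $\mathbb R^n$ that is invariant under permutation of coordinates and whose push-forward under $\rho$ is $\frac{A_{\vec n}(X)}{Z_{\vec n}}d\tau(X)$ restricted to $L_n$ (the Angelesco ensemble). A measure $\tau$ on a compact set $K\subset\mathbb C$ satisfies the BM inequality if for every $\epsilon>0$ there is $C>0$ with $\sup_K|q|\le C(1+\epsilon)^{\deg q}\int_K|q|\,d\tau$ for all (complex) polynomials $q$. For $X=(x_1,\ldots,x_n)\in\mathbb R^n$, $\frac1n\delta(X)=\frac1n\sum_{i=1}^n\delta(x_i)$ is its normalized counting measure, where $\delta(x)$ is the Dirac mass at $x$. $\mathcal M_r(\Gamma)$ is the set of $p$-tuples $\nu=(\nu_1,\ldots,\nu_p)$ of positive Borel measures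 with $\mathrm{supp}\,\nu_i\subset\Gamma_i$ and $\nu_i(\Gamma_i)=r_i$; it is identified with a subset of the set $\mathcal M(\Gamma)$ of probability measures on $\Gamma$ via $\nu\mapsto\sum_i\nu_i$, with the weak* topology. For $\nu\in\mathcal M_r(\Gamma)$, $$E(\nu)=\sum_{i=1}^p\int_{\Gamma_i}\int_{\Gamma_i}\log\frac1{|x-y|}d\nu_i(x)d\nu_i(y)+\sum_{1\le i<j\le p}\int_{\Gamma_i}\int_{\Gamma_j}\log\frac1{|x-y|}d\nu_i(x)d\nu_j(y)\in(-\infty,+\infty].$$ By a known theorem of Gonchar–Rakhmanov, $E$ has a unique minimizer over $\mathcal M_r(\Gamma)$, denoted $\mu_\Gamma$ (the equilibrium measure).
   Formalization: Added hypothesis: n(d) grows so that the sum over d of exp(-c n(d)^2) is finite for every c>0 (true e.g. if n(d) is strictly increasing); without growth the claim fails, e.g. p=1 and n(d)=1 for all d gives i.i.d. Dirac masses, which do not converge. *)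

theory Defs
  imports "HOL-Probability.Probability" "HOL-Computational_Algebra.Polynomial"
begin

text \<open>
  Conventions.  The indices 1, ..., p are represented by 0, ..., p - 1, and a p-tuple by a
  function on nat whose values at arguments \<open>\<ge> p\<close> are never used.  Vectors in R^N are
  the elements of the space of \<open>Pi\<^sub>M {..<N} (\<lambda>_. borel)\<close>, i.e. functions on nat
  that are undefined outside \<open>{..<N}\<close>.  A Borel measure on a compact set K of reals is
  represented by its extension by zero to the real line.
\<close>

definition finite_borel_measure_on :: "real set \<Rightarrow> real measure \<Rightarrow> bool" where
  "finite_borel_measure_on K M \<longleftrightarrow>
     sets M = sets borel \<and> finite_measure M \<and> emeasure M (- K) = 0"

definition sum_measure :: "nat \<Rightarrow> (nat \<Rightarrow> real measure) \<Rightarrow> real measure" where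
  "sum_measure m M = measure_of UNIV (sets borel) (\<lambda>B. \<Sum>i<m. emeasure (M i) B)"

lemma sets_sum_measure [simp]: "sets (sum_measure m M) = sets borel"
  unfolding sum_measure_def by (metis sets.sets_measure_of_eq space_borel)

lemma emeasure_sum_measure:
  assumes "\<And>i. i < m \<Longrightarrow> sets (M i) = sets borel" and B: "B \<in> sets borel"
  shows "emeasure (sum_measure m M) B = (\<Sum>i<m. emeasure (M i) B)"
proof (rule emeasure_measure_of[OF sum_measure_def])
  show "sets borel \<subseteq> Pow (UNIV :: real set)" by simp
  show "B \<in> sets (sum_measure m M)" using B by simp
  show "positive (sets (sum_measure m M)) (\<lambda>B. \<Sum>i<m. emeasure (M i) B)"
    by (simp add: positive_def)
  show "countably_additive (sets (sum_measure m M)) (\<lambda>B. \<Sum>i<m. emeasure (M i) B)"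
  proof (rule countably_additiveI)
    fix A :: "nat \<Rightarrow> real set"
    assume A: "range A \<subseteq> sets (sum_measure m M)" "disjoint_family A"
    have "(\<Sum>k. \<Sum>i<m. emeasure (M i) (A k)) = (\<Sum>i<m. \<Sum>k. emeasure (M i) (A k))"
      by (rule suminf_sum) simp
    also have "\<dots> = (\<Sum>i<m. emeasure (M i) (\<Union>k. A k))"
      using A assms(1) by (intro sum.cong refl suminf_emeasure) auto
    finally show "(\<Sum>k. \<Sum>i<m. emeasure (M i) (A k)) = (\<Sum>i<m. emeasure (M i) (\<Union>k. A k))" .
  qed
qed

definition normalized_counting_measure :: "nat \<Rightarrow> (nat \<Rightarrow> real) \<Rightarrow> real measure" where
  "normalized_counting_measure N X =
     scale_measure (ennreal (1 / real N)) (sum_measure N (\<lambda>k. return borel (X k)))"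

definition weak_star_conv ::
    "real set \<Rightarrow> (nat \<Rightarrow> real measure) \<Rightarrow> real measure \<Rightarrow> bool" where
  "weak_star_conv K M \<mu> \<longleftrightarrow>
     (\<forall>f :: real \<Rightarrow> real. continuous_on K f \<longrightarrow>
        (\<lambda>d. LINT x:K|M d. f x) \<longlonglongrightarrow> (LINT x:K|\<mu>. f x))"


definition BM_inequality :: "real set \<Rightarrow> real measure \<Rightarrow> bool" where
  "BM_inequality K \<tau> \<longleftrightarrow>
     (\<forall>\<epsilon>>0. \<exists>C>0. \<forall>q :: complex poly.
        (SUP x\<in>K. cmod (poly q (of_real x)))
          \<le> C * (1 + \<epsilon>) ^ degree q * (LINT x:K|\<tau>. cmod (poly q (of_real x))))"


definition multi_size :: "nat \<Rightarrow> (nat \<Rightarrow> nat) \<Rightarrow> nat" where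
  "multi_size p n = (\<Sum>i<p. n i)"

definition block_vec :: "(nat \<Rightarrow> nat) \<Rightarrow> (nat \<Rightarrow> real) \<Rightarrow> nat \<Rightarrow> nat \<Rightarrow> real" where
  "block_vec n X i k = X ((\<Sum>j<i. n j) + k)"

text \<open>The index \<open>i\<close> of the block to which the \<open>k\<close>-th coordinate belongs.\<close>

definition block_of :: "(nat \<Rightarrow> nat) \<Rightarrow> nat \<Rightarrow> nat" where
  "block_of n k = (LEAST i. k < (\<Sum>j\<le>i. n j))"

definition vandermonde :: "nat \<Rightarrow> (nat \<Rightarrow> real) \<Rightarrow> real" where
  "vandermonde m Y = (\<Prod>k<m. \<Prod>j<k. (Y k - Y j))"

definition mixed_vandermonde ::
    "nat \<Rightarrow> (nat \<Rightarrow> real) \<Rightarrow> nat \<Rightarrow> (nat \<Rightarrow> real) \<Rightarrow> real" where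
  "mixed_vandermonde m Y l Y' = (\<Prod>k<m. \<Prod>j<l. (Y k - Y' j))"

definition angelesco_weight :: "nat \<Rightarrow> (nat \<Rightarrow> nat) \<Rightarrow> (nat \<Rightarrow> real) \<Rightarrow> real" where
  "angelesco_weight p n X =
     (\<Prod>i<p. (vandermonde (n i) (block_vec n X i))\<^sup>2) *
     (\<Prod>j<p. \<Prod>i<j. mixed_vandermonde (n j) (block_vec n X j) (n i) (block_vec n X i))"

definition real_vectors :: "nat \<Rightarrow> (nat \<Rightarrow> real) measure" where
  "real_vectors N = Pi\<^sub>M {..<N} (\<lambda>_. borel)"

definition sorted_vectors :: "nat \<Rightarrow> (nat \<Rightarrow> real) set" where
  "sorted_vectors N = {x \<in> space (real_vectors N). mono_on {..<N} x}"

definition sort_coordinates :: "nat \<Rightarrow> (nat \<Rightarrow> real) \<Rightarrow> nat \<Rightarrow> real" where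
  "sort_coordinates N x = (\<lambda>k\<in>{..<N}. sort (map x [0..<N]) ! k)"

definition tau_product ::
    "nat \<Rightarrow> (nat \<Rightarrow> real measure) \<Rightarrow> (nat \<Rightarrow> nat) \<Rightarrow> (nat \<Rightarrow> real) measure" where
  "tau_product p \<tau> n = Pi\<^sub>M {..<multi_size p n} (\<lambda>k. \<tau> (block_of n k))"

definition partition_function :: "nat \<Rightarrow> (nat \<Rightarrow> real measure) \<Rightarrow> (nat \<Rightarrow> nat) \<Rightarrow> real" where
  "partition_function p \<tau> n =
     (LINT X:sorted_vectors (multi_size p n)|tau_product p \<tau> n. angelesco_weight p n X)"

definition is_angelesco_ensemble ::
    "nat \<Rightarrow> (nat \<Rightarrow> real measure) \<Rightarrow> (nat \<Rightarrow> nat) \<Rightarrow> (nat \<Rightarrow> real) measure \<Rightarrow> bool" where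
  "is_angelesco_ensemble p \<tau> n P \<longleftrightarrow>
     (let N = multi_size p n in
        prob_space P \<and> sets P = sets (real_vectors N) \<and>
        (\<forall>\<pi>. \<pi> permutes {..<N} \<longrightarrow> distr P (real_vectors N) (\<lambda>X. X \<circ> \<pi>) = P) \<and>
        distr P (real_vectors N) (sort_coordinates N) =
          density (tau_product p \<tau> n)
            (\<lambda>X. ennreal (angelesco_weight p n X / partition_function p \<tau> n)
                   * indicator (sorted_vectors N) X))"


text \<open>
  The integral of an extended real function, as the difference of the integrals of its positive
  and negative parts (\<open>e2ennreal\<close> maps negative values to 0).  It is only applied to
  the logarithmic kernel on compactly supported finite measures, where the second term is finite.
\<close>

definition ereal_integral :: "'a measure \<Rightarrow> ('a \<Rightarrow> ereal) \<Rightarrow> ereal" where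
  "ereal_integral M f =
     enn2ereal (\<integral>\<^sup>+ x. e2ennreal (f x) \<partial>M) - enn2ereal (\<integral>\<^sup>+ x. e2ennreal (- f x) \<partial>M)"

definition log_kernel :: "real \<Rightarrow> real \<Rightarrow> ereal" where
  "log_kernel x y = (if x = y then \<infinity> else ereal (ln (1 / \<bar>x - y\<bar>)))"

definition log_energy :: "real measure \<Rightarrow> real measure \<Rightarrow> ereal" where
  "log_energy M M' = ereal_integral (M \<Otimes>\<^sub>M M') (\<lambda>(x, y). log_kernel x y)"

definition angelesco_energy :: "nat \<Rightarrow> (nat \<Rightarrow> real measure) \<Rightarrow> ereal" where
  "angelesco_energy p \<nu> =
     (\<Sum>i<p. log_energy (\<nu> i) (\<nu> i)) + (\<Sum>j<p. \<Sum>i<j. log_energy (\<nu> i) (\<nu> j))"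

definition admissible_tuples ::
    "nat \<Rightarrow> (nat \<Rightarrow> real set) \<Rightarrow> (nat \<Rightarrow> real) \<Rightarrow> (nat \<Rightarrow> real measure) set" where
  "admissible_tuples p \<Gamma> r =
     {\<nu>. \<forall>i<p. finite_borel_measure_on (\<Gamma> i) (\<nu> i) \<and> emeasure (\<nu> i) (\<Gamma> i) = ennreal (r i)}"

text \<open>
  By Gonchar and Rakhmanov the minimizer exists and its components with index \<open>< p\<close> are unique.
\<close>

definition is_equilibrium ::
    "nat \<Rightarrow> (nat \<Rightarrow> real set) \<Rightarrow> (nat \<Rightarrow> real) \<Rightarrow> (nat \<Rightarrow> real measure) \<Rightarrow> bool" where
  "is_equilibrium p \<Gamma> r \<nu> \<longleftrightarrow>
     is_arg_min (angelesco_energy p) (\<lambda>\<nu>. \<nu> \<in> admissible_tuples p \<Gamma> r) \<nu>"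


text \<open>
  A growth condition on the sizes \<open>N d\<close> of the multi-indices.  Convergence in probability needs
  \<open>N d\<close> to tend to infinity.  Almost sure convergence for independent samples needs more,
  since deviations at stage \<open>d\<close> have probability of order \<open>exp (- c (N d)\<^sup>2)\<close> with arbitrarily
  small \<open>c > 0\<close>: by the Borel-Cantelli lemmas these must be summable over \<open>d\<close>.  The
  condition holds whenever the sizes strictly increase.
\<close>

definition borel_cantelli_growth :: "(nat \<Rightarrow> nat) \<Rightarrow> bool" where
  "borel_cantelli_growth N \<longleftrightarrow> (\<forall>c>0. summable (\<lambda>d. exp (- c * (real (N d))\<^sup>2)))"

lemma strict_mono_borel_cantelli_growth:
  assumes "strict_mono N"
  shows "borel_cantelli_growth N"
  unfolding borel_cantelli_growth_def
proof (intro allI impI)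
  fix c :: real
  assume c: "c > 0"
  show "summable (\<lambda>d. exp (- c * (real (N d))\<^sup>2))"
  proof (rule summable_comparison_test')
    show "summable (\<lambda>d. exp (- c) ^ d)"
      using c by (intro summable_geometric) simp
    fix d :: nat
    have "d \<le> N d" using assms by (rule strict_mono_imp_increasing)
    also have "\<dots> \<le> (N d)\<^sup>2" by (simp add: power2_eq_square)
    finally have "real d \<le> (real (N d))\<^sup>2"
      by (metis of_nat_le_iff of_nat_power)
    hence "c * real d \<le> c * (real (N d))\<^sup>2" using c by simp
    thus "norm (exp (- c * (real (N d))\<^sup>2)) \<le> exp (- c) ^ d"
      by (simp add: mult.commute flip: exp_of_nat_mult)
  qed
qed

end

theory Submission
  imports Defs "HOL-Real_Asymp.Real_Asymp"
begin

text \<open>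
  The weight \<open>A\<close> is the exponential of minus a discrete logarithmic energy, so configurations
  of \<open>N\<close> points whose counting measure is far from the minimizer \<open>\<mu>\<close> of the
  continuous energy have probability at most \<open>exp (- c N\<^sup>2)\<close>, and the Borel--Cantelli lemma
  finishes the proof.  Two estimates on the scale \<open>exp (N\<^sup>2)\<close> are needed.

  The first is a lower bound for the partition function.  Averaging the discrete energy over
  independent points distributed according to the normalized components of \<open>\<mu>\<close> yields some
  configuration with energy at most about \<open>N\<^sup>2 E(\<mu>)\<close> (lemma \<open>low_energy_configuration\<close>).  In each
  coordinate \<open>A\<close> is a polynomial of degree less than \<open>2 N\<close>, so the Bernstein--Markov
  inequality, applied to one coordinate after the other, bounds its supremum by its integral up to a
  factor \<open>(C (1 + \<epsilon>)^(2 N))^N\<close> (lemma \<open>angelesco_weight_sup_bound\<close>).  The restriction to sorted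
  vectors costs another factor \<open>N!\<close> at most.

  The second is an upper bound for \<open>A\<close> on bad configurations (lemma \<open>energy_gap\<close>): there the
  energy exceeds \<open>N\<^sup>2 (E(\<mu>) + c)\<close>.  Otherwise Helly's theorem would give a weak limit of counting
  measures with energy at most \<open>E(\<mu>)\<close>, that is, a second minimizer.

  Everything about energies rests on one representation of the kernel.  For points at distance at most
  \<open>T\<close>, \<open>ln (T / |x - y|) + 1\<close> is the measure of the set of intervals (``windows'') containing
  both \<open>x\<close> and \<open>y\<close>, with respect to a translation invariant measure on the set of all intervals
  (lemma \<open>window_kernel_eq\<close>).  By Tonelli the energy of \<open>\<nu>\<close> becomes, up to a constant, the integral over
  all windows \<open>I\<close> of the positive definite quadratic form
  \<open>\<Sum>\<^sub>i \<nu>\<^sub>i(I)\<^sup>2 + \<Sum>\<^sub>i\<^sub><\<^sub>j \<nu>\<^sub>i(I) \<nu>\<^sub>j(I)\<close>.  Strict convexity, hence uniqueness of the minimizer,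
  is then the parallelogram identity for this form, lower semicontinuity is Fatou's lemma, and the
  infinite self-energy of point masses is removed by leaving out short windows.
\<close>

section \<open>The logarithmic kernel as a superposition of windows\<close>

text \<open>
  The rate at which windows of length \<open>t\<close> occur.  A rate \<open>t\<^sup>-\<^sup>2\<close> for all \<open>t > 0\<close>
  would let any two points lie in windows of infinite total measure; the faster decay beyond \<open>T\<close>
  makes this measure finite and is normalized so that for distances up to \<open>T\<close> it is
  logarithmic in the distance.
\<close>

definition interval_rate :: "real \<Rightarrow> real \<Rightarrow> real" where
  "interval_rate T t = (if t \<le> 0 then 0 else if t \<le> T then 1 / t\<^sup>2 else 2 * T / t ^ 3)"

text \<open>
  A window is encoded by its left end point and its length.
\<close>

definition window_measure :: "real \<Rightarrow> (real \<times> real) measure" where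
  "window_measure T = density (lborel \<Otimes>\<^sub>M lborel) (\<lambda>w. ennreal (interval_rate T (snd w)))"

definition window :: "real \<times> real \<Rightarrow> real set" where
  "window w = {fst w..fst w + snd w}"

definition window_kernel :: "real \<Rightarrow> real \<Rightarrow> real \<Rightarrow> ennreal" where
  "window_kernel T x y =
     (\<integral>\<^sup>+w. indicator (window w) x * indicator (window w) y \<partial>window_measure T)"

lemma window_borel [measurable, simp]: "window w \<in> sets borel"
  by (simp add: window_def)

lemma interval_rate_measurable [measurable]: "interval_rate T \<in> borel_measurable borel"
  unfolding interval_rate_def by measurable

lemma sets_window_measure [measurable_cong, simp]:
  "sets (window_measure T) = sets (borel \<Otimes>\<^sub>M borel)"
  unfolding window_measure_def sets_density by (rule sets_pair_measure_cong) simp_all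

lemma space_window_measure [simp]: "space (window_measure T) = UNIV"
  unfolding window_measure_def by (simp add: space_pair_measure)

lemma sigma_finite_window_measure: "sigma_finite_measure (window_measure T)"
proof -
  have "sigma_finite_measure ((lborel :: real measure) \<Otimes>\<^sub>M (lborel :: real measure))"
    by (rule lborel_pair.sigma_finite_measure_axioms)
  then show ?thesis
    unfolding window_measure_def
    by (subst sigma_finite_measure.sigma_finite_iff_density_finite) auto
qed

lemma indicator_window_measurable [measurable (raw)]:
  assumes [measurable]: "f \<in> M \<rightarrow>\<^sub>M borel \<Otimes>\<^sub>M borel" "g \<in> borel_measurable M"
  shows "(\<lambda>z. indicator (window (f z)) (g z) :: ennreal) \<in> borel_measurable M"
  unfolding indicator_def of_bool_def window_def atLeastAtMost_iff by measurable

lemma nn_integral_window_measure: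
  assumes [measurable]: "f \<in> borel_measurable (borel \<Otimes>\<^sub>M borel)"
  shows "(\<integral>\<^sup>+w. f w \<partial>window_measure T) =
    (\<integral>\<^sup>+t. ennreal (interval_rate T t) * (\<integral>\<^sup>+u. f (u, t) \<partial>lborel) \<partial>lborel)"
proof -
  have [measurable]: "f \<in> borel_measurable (lborel \<Otimes>\<^sub>M lborel)"
    using assms by (simp cong: measurable_cong_sets sets_pair_measure_cong)
  have "(\<integral>\<^sup>+w. f w \<partial>window_measure T) =
     (\<integral>\<^sup>+w. ennreal (interval_rate T (snd w)) * f w \<partial>(lborel \<Otimes>\<^sub>M lborel))"
    unfolding window_measure_def by (subst nn_integral_density) auto
  also have "\<dots> = (\<integral>\<^sup>+t. \<integral>\<^sup>+u. ennreal (interval_rate T t) * f (u, t) \<partial>lborel \<partial>lborel)"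
    by (subst lborel_pair.nn_integral_snd[symmetric]) auto
  also have "\<dots> = (\<integral>\<^sup>+t. ennreal (interval_rate T t) * (\<integral>\<^sup>+u. f (u, t) \<partial>lborel) \<partial>lborel)"
    by (intro nn_integral_cong nn_integral_cmult) measurable
  finally show ?thesis .
qed

text \<open>
  The windows of length \<open>t\<close> that contain \<open>x\<close> and \<open>y\<close> are those whose left end point lies in an
  interval of length \<open>t - |x - y|\<close>.
\<close>

lemma window_kernel_tent:
  "window_kernel T x y =
     (\<integral>\<^sup>+t. ennreal (interval_rate T t) * ennreal (t - \<bar>x - y\<bar>) \<partial>lborel)"
proof -
  have "(\<integral>\<^sup>+u. indicator (window (u, t)) x * indicator (window (u, t)) y \<partial>lborel)
      = ennreal (t - \<bar>x - y\<bar>)" for t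
  proof -
    have "(\<integral>\<^sup>+u. indicator (window (u, t)) x * indicator (window (u, t)) y \<partial>lborel)
       = (\<integral>\<^sup>+u. indicator {max x y - t..min x y} u \<partial>lborel)"
      by (intro nn_integral_cong) (auto simp: window_def indicator_def max_def min_def)
    also have "\<dots> = ennreal (t - \<bar>x - y\<bar>)"
      by (auto simp: emeasure_lborel_Icc_eq max_def min_def abs_if ennreal_neg intro!: arg_cong[where f=ennreal])
    finally show ?thesis .
  qed
  thus ?thesis
    unfolding window_kernel_def by (subst nn_integral_window_measure) auto
qed

text \<open>
  With \<open>d = |x - y|\<close>, windows of length at most \<open>T\<close> contribute the integral of
  \<open>(t - d) / t\<^sup>2\<close> over \<open>{d..T}\<close>, which is \<open>ln (T / d) + d / T - 1\<close>, and longer windows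
  contribute \<open>2 - d / T\<close>, which removes the term that is linear in \<open>d\<close>.
\<close>

lemma window_kernel_eq:
  assumes "x \<noteq> y" "\<bar>x - y\<bar> \<le> T"
  shows "window_kernel T x y = ennreal (ln (T / \<bar>x - y\<bar>) + 1)"
proof -
  define d where "d = \<bar>x - y\<bar>"
  have d: "0 < d" "d \<le> T" using assms by (auto simp: d_def)
  have "window_kernel T x y =
    (\<integral>\<^sup>+t. ennreal ((t - d) / t\<^sup>2) * indicator {d..T} t
        + ennreal (2 * T * (t - d) / t ^ 3) * indicator {T..} t \<partial>lborel)"
    unfolding window_kernel_tent d_def[symmetric]
  proof (rule nn_integral_cong_AE, use AE_lborel_singleton[of T] in eventually_elim)
    case (elim t)
    consider "t < d" | "d \<le> t" "t < T" | "t > T" using elim by linarith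
    thus ?case
    proof cases
      case 1 thus ?thesis using d by (simp add: ennreal_neg)
    next
      case 2 thus ?thesis using d
        by (simp add: interval_rate_def flip: ennreal_mult)
    next
      case 3 thus ?thesis using d
        by (simp add: interval_rate_def flip: ennreal_mult)
    qed
  qed
  also have "\<dots> = (\<integral>\<^sup>+t. ennreal ((t - d) / t\<^sup>2) * indicator {d..T} t \<partial>lborel)
        + (\<integral>\<^sup>+t. ennreal (2 * T * (t - d) / t ^ 3) * indicator {T..} t \<partial>lborel)"
    by (rule nn_integral_add) auto
  also have "(\<integral>\<^sup>+t. ennreal ((t - d) / t\<^sup>2) * indicator {d..T} t \<partial>lborel)
     = (ln T + d / T) - (ln d + d / d)"
  proof (rule nn_integral_FTC_Icc[where F = "\<lambda>t. ln t + d / t"])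
    fix t assume "t \<in> {d..T}"
    hence t: "d \<le> t" "t > 0" using d by auto
    show "((\<lambda>t. ln t + d / t) has_real_derivative (t - d) / t\<^sup>2) (at t)"
      using t d by (auto intro!: derivative_eq_intros simp: field_simps power2_eq_square)
    show "0 \<le> (t - d) / t\<^sup>2" using t by simp
  qed (use d in auto)
  also have "(\<integral>\<^sup>+t. ennreal (2 * T * (t - d) / t ^ 3) * indicator {T..} t \<partial>lborel)
     = 0 - (- 2 * T / T + T * d / T\<^sup>2)"
  proof (rule nn_integral_FTC_atLeast[where F = "\<lambda>t. - 2 * T / t + T * d / t\<^sup>2"])
    fix t assume t: "T \<le> t"
    hence t0: "t > 0" using d by auto
    show "((\<lambda>t. - 2 * T / t + T * d / t\<^sup>2) has_real_derivative 2 * T * (t - d) / t ^ 3) (at t)"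
      using t0 by (auto intro!: derivative_eq_intros simp: field_simps power2_eq_square power3_eq_cube)
    show "0 \<le> 2 * T * (t - d) / t ^ 3" using t t0 d by simp
  next
    show "((\<lambda>t. - 2 * T / t + T * d / t\<^sup>2) \<longlongrightarrow> 0) at_top"
      by real_asymp
  qed auto
  also have "ennreal (ln T + d / T - (ln d + d / d)) + ennreal (0 - (- 2 * T / T + T * d / T\<^sup>2))
     = ennreal (ln (T / d) + 1)"
  proof -
    have "ln T + d / T - (ln d + d / d) \<ge> 0"
    proof -
      have "ln (d / T) \<le> d / T - 1" using d by (intro ln_le_minus_one) simp
      thus ?thesis using d by (simp add: ln_div)
    qed
    moreover have "0 - (- 2 * T / T + T * d / T\<^sup>2) = 2 - d / T"
      using d by (simp add: power2_eq_square)
    moreover have "2 - d / T \<ge> 0" using d by (simp add: field_simps)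
    ultimately show ?thesis using d by (simp add: ln_div flip: ennreal_plus)
  qed
  finally show ?thesis by (simp add: d_def)
qed

lemma window_kernel_measurable [measurable]:
  "(\<lambda>z. window_kernel T (fst z) (snd z)) \<in> borel_measurable (borel \<Otimes>\<^sub>M borel)"
proof -
  interpret sigma_finite_measure "window_measure T" by (rule sigma_finite_window_measure)
  show ?thesis unfolding window_kernel_def by measurable
qed

text \<open>
  The kernel at \<open>(x, x)\<close> dominates the kernel at all points \<open>(x, x + d)\<close>.
\<close>

lemma window_kernel_diag:
  assumes "T > 0"
  shows "window_kernel T x x = \<infinity>"
proof (rule ccontr)
  assume "window_kernel T x x \<noteq> \<infinity>"
  then obtain K where K: "K \<ge> 0" "window_kernel T x x = ennreal K"
    by (cases "window_kernel T x x") auto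
  \<comment> \<open>At this distance the kernel is \<open>K + 1\<close>.\<close>
  define d where "d = T * exp (- K)"
  have d: "0 < d" "d \<le> T" using assms K by (auto simp: d_def)
  have "window_kernel T x (x + d) \<le> window_kernel T x x"
    unfolding window_kernel_tent using d
    by (intro nn_integral_mono mult_left_mono ennreal_leI) auto
  moreover have "window_kernel T x (x + d) = ennreal (K + 1)"
    using d assms by (subst window_kernel_eq) (auto simp: d_def exp_minus inverse_eq_divide)
  ultimately show False using K by simp
qed

text \<open>
  A point interacts with itself through all windows around it, and only the short ones make this
  infinite: a window of length at least \<open>s\<close> that contains \<open>x\<close> also contains \<open>x + s / 2\<close> or
  \<open>x - s / 2\<close>.
\<close>

lemma window_kernel_truncated_diag:
  assumes "0 < s" "s \<le> T"
  shows "(\<integral>\<^sup>+w. indicator (window w) x * indicator {s..} (snd w) \<partial>window_measure T)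
     \<le> ennreal (2 * (ln (2 * T / s) + 1))"
proof -
  have *: "window_kernel T x (x + e) = ennreal (ln (2 * T / s) + 1)" if "\<bar>e\<bar> = s / 2" for e
    using that assms by (subst window_kernel_eq) (auto simp: mult.commute)
  have "(\<integral>\<^sup>+w. indicator (window w) x * indicator {s..} (snd w) \<partial>window_measure T) \<le>
    (\<integral>\<^sup>+w. indicator (window w) x * indicator (window w) (x + s/2)
      + indicator (window w) x * indicator (window w) (x + (- s/2)) \<partial>window_measure T)"
    using assms by (intro nn_integral_mono) (auto simp: indicator_def window_def)
  also have "\<dots> = window_kernel T x (x + s/2) + window_kernel T x (x + (- s/2))"
    unfolding window_kernel_def by (subst nn_integral_add) (auto simp: measurable_cong_sets[OF sets_window_measure])
  also have "\<dots> = ennreal (2 * (ln (2 * T / s) + 1))"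
  proof -
    have "ln (2 * T / s) \<ge> 0" using assms by (intro ln_ge_zero) (simp add: field_simps)
    moreover have "\<bar>s/2\<bar> = s / 2" "\<bar>- s/2\<bar> = s / 2" using assms by auto
    ultimately show ?thesis
      using *[of "s/2"] *[of "- s/2"] by (simp flip: ennreal_plus)
  qed
  finally show ?thesis .
qed

section \<open>Window energies of measures\<close>

text \<open>
  The quadratic form of the Angelesco interaction matrix, which has \<open>1\<close> on the diagonal and
  \<open>1 / 2\<close> elsewhere.
\<close>

definition interaction_form :: "nat \<Rightarrow> (nat \<Rightarrow> real) \<Rightarrow> real" where
  "interaction_form p x = (\<Sum>i<p. (x i)\<^sup>2) + (\<Sum>j<p. \<Sum>i<j. x i * x j)"

text \<open>
  As a sum of squares the form is visibly positive definite.
\<close>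

lemma interaction_form_eq:
  "interaction_form p x = ((\<Sum>i<p. (x i)\<^sup>2) + (\<Sum>i<p. x i)\<^sup>2) / 2"
proof (induction p)
  case (Suc p)
  have "interaction_form (Suc p) x = interaction_form p x + (x p)\<^sup>2 + (\<Sum>i<p. x i) * x p"
    by (simp add: interaction_form_def sum_distrib_right)
  thus ?case by (simp add: Suc.IH power2_eq_square algebra_simps add_divide_distrib)
qed (simp add: interaction_form_def)

lemma interaction_form_nonneg: "interaction_form p x \<ge> 0"
  by (simp add: interaction_form_eq sum_nonneg)

lemma interaction_form_eq_0_iff: "interaction_form p x = 0 \<longleftrightarrow> (\<forall>i<p. x i = 0)"
proof
  assume "interaction_form p x = 0"
  moreover have "(\<Sum>i<p. (x i)\<^sup>2) \<ge> 0" by (simp add: sum_nonneg)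
  ultimately have "(\<Sum>i<p. (x i)\<^sup>2) = 0"
    by (simp add: interaction_form_eq add_nonneg_eq_0_iff)
  thus "\<forall>i<p. x i = 0" by (subst (asm) sum_nonneg_eq_0_iff) auto
qed (simp add: interaction_form_eq)

lemma interaction_form_cong:
  "(\<And>i. i < p \<Longrightarrow> x i = y i) \<Longrightarrow> interaction_form p x = interaction_form p y"
  by (simp add: interaction_form_eq)

lemma interaction_form_scale: "interaction_form p (\<lambda>i. c * x i) = c\<^sup>2 * interaction_form p x"
  by (simp add: interaction_form_eq power_mult_distrib distrib_left flip: sum_distrib_left)

lemma interaction_form_mono:
  assumes "\<And>i. i < p \<Longrightarrow> 0 \<le> x i" "\<And>i. i < p \<Longrightarrow> x i \<le> y i"
  shows "interaction_form p x \<le> interaction_form p y"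
proof -
  have "(\<Sum>i<p. (x i)\<^sup>2) \<le> (\<Sum>i<p. (y i)\<^sup>2)"
    using assms by (intro sum_mono power_mono) auto
  moreover have "(\<Sum>i<p. x i)\<^sup>2 \<le> (\<Sum>i<p. y i)\<^sup>2"
    using assms by (intro power_mono sum_mono sum_nonneg) auto
  ultimately show ?thesis unfolding interaction_form_eq by (intro divide_right_mono add_mono) auto
qed

lemma interaction_form_parallelogram:
  "interaction_form p (\<lambda>i. (x i + y i) / 2) + interaction_form p (\<lambda>i. (x i - y i) / 2)
     = (interaction_form p x + interaction_form p y) / 2"
proof -
  have 1: "(\<Sum>i<p. ((x i + y i) / 2)\<^sup>2) + (\<Sum>i<p. ((x i - y i) / 2)\<^sup>2)
     = ((\<Sum>i<p. (x i)\<^sup>2) + (\<Sum>i<p. (y i)\<^sup>2)) / 2"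
    unfolding sum.distrib[symmetric] sum_divide_distrib
    by (intro sum.cong refl) (simp add: power2_eq_square field_simps)
  have 2: "(\<Sum>i<p. (x i + y i) / 2) = ((\<Sum>i<p. x i) + (\<Sum>i<p. y i)) / 2"
    "(\<Sum>i<p. (x i - y i) / 2) = ((\<Sum>i<p. x i) - (\<Sum>i<p. y i)) / 2"
    by (simp_all add: sum.distrib sum_subtractf flip: sum_divide_distrib)
  show ?thesis using 1 unfolding interaction_form_eq 2
    by (simp add: power2_eq_square field_simps)
qed

lemma interaction_form_measurable [measurable]:
  assumes [measurable]: "\<And>i. i < p \<Longrightarrow> f i \<in> borel_measurable M"
  shows "(\<lambda>w. interaction_form p (\<lambda>i. f i w)) \<in> borel_measurable M"
  unfolding interaction_form_eq
  by (intro borel_measurable_divide borel_measurable_add borel_measurable_sum borel_measurable_power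
        borel_measurable_const) (auto intro: assms)

lemma measure_window_measurable [measurable (raw)]:
  assumes "finite_measure M" "sets M = sets borel"
  shows "(\<lambda>w. measure M (window w)) \<in> borel_measurable (borel \<Otimes>\<^sub>M borel)"
proof -
  interpret finite_measure M by fact
  note [measurable_cong] = assms(2)
  have "(\<lambda>w. \<integral>\<^sup>+x. indicator (window w) x \<partial>M) \<in> borel_measurable (borel \<Otimes>\<^sub>M borel)"
    by measurable
  moreover have "(\<integral>\<^sup>+x. indicator (window w) x \<partial>M) = emeasure M (window w)" for w
    by (rule nn_integral_indicator) (simp add: assms(2))
  ultimately have "(\<lambda>w. emeasure M (window w)) \<in> borel_measurable (borel \<Otimes>\<^sub>M borel)" by simp
  thus ?thesis unfolding measure_def by measurable
qed

text \<open>
  The energy of a tuple of measures, shifted by a constant that depends only on the masses; see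
  \<open>angelesco_energy_window\<close>.
\<close>

definition window_energy :: "nat \<Rightarrow> real \<Rightarrow> (nat \<Rightarrow> real measure) \<Rightarrow> ennreal" where
  "window_energy p T \<nu> =
     (\<integral>\<^sup>+w. ennreal (interaction_form p (\<lambda>i. measure (\<nu> i) (window w))) \<partial>window_measure T)"

text \<open>
  Tonelli's theorem turns the mutual energy into an integral over windows.
\<close>

lemma nn_integral_window_kernel:
  assumes "finite_measure M" "sets M = sets borel" "finite_measure M'" "sets M' = sets borel"
  shows "(\<integral>\<^sup>+z. window_kernel T (fst z) (snd z) \<partial>(M \<Otimes>\<^sub>M M')) =
    (\<integral>\<^sup>+w. ennreal (measure M (window w) * measure M' (window w)) \<partial>window_measure T)"
proof -
  interpret M: finite_measure M by fact
  interpret M': finite_measure M' by fact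
  note [measurable_cong] = assms(2,4)
  interpret W: sigma_finite_measure "window_measure T" by (rule sigma_finite_window_measure)
  interpret P: pair_sigma_finite M M' ..
  interpret Q: pair_sigma_finite "M \<Otimes>\<^sub>M M'" "window_measure T" ..
  have "(\<integral>\<^sup>+z. window_kernel T (fst z) (snd z) \<partial>(M \<Otimes>\<^sub>M M')) =
    (\<integral>\<^sup>+w. \<integral>\<^sup>+z. indicator (window w) (fst z) * indicator (window w) (snd z)
       \<partial>(M \<Otimes>\<^sub>M M') \<partial>window_measure T)"
    unfolding window_kernel_def by (rule Q.Fubini'[symmetric]) measurable
  also have "\<dots> = (\<integral>\<^sup>+w. ennreal (measure M (window w) * measure M' (window w)) \<partial>window_measure T)"
  proof (rule nn_integral_cong)
    fix w :: "real \<times> real"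
    have "(\<integral>\<^sup>+z. indicator (window w) (fst z) * indicator (window w) (snd z) \<partial>(M \<Otimes>\<^sub>M M'))
      = (\<integral>\<^sup>+z. indicator (window w \<times> window w) z \<partial>(M \<Otimes>\<^sub>M M'))"
      by (intro nn_integral_cong) (auto simp: indicator_def)
    also have "\<dots> = emeasure M (window w) * emeasure M' (window w)"
      using assms(2,4) by (simp add: M'.emeasure_pair_measure_Times)
    also have "\<dots> = ennreal (measure M (window w) * measure M' (window w))"
      by (simp add: M.emeasure_eq_measure M'.emeasure_eq_measure ennreal_mult)
    finally show "(\<integral>\<^sup>+z. indicator (window w) (fst z) * indicator (window w) (snd z) \<partial>(M \<Otimes>\<^sub>M M'))
      = ennreal (measure M (window w) * measure M' (window w))" .
  qed
  finally show ?thesis .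
qed

text \<open>
  On a set of diameter at most \<open>T\<close> the logarithmic kernel and the window kernel differ by the
  constant \<open>ln T + 1\<close>.  The negative part of the logarithmic kernel is at most \<open>ln T\<close> there, so its
  integral is finite and may be moved across the equation.
\<close>

lemma log_energy_window:
  assumes M: "finite_measure M" "sets M = sets borel" "AE x in M. x \<in> S"
    and M': "finite_measure M'" "sets M' = sets borel" "AE x in M'. x \<in> S"
    and S: "S \<in> sets borel" "\<And>x y. x \<in> S \<Longrightarrow> y \<in> S \<Longrightarrow> \<bar>x - y\<bar> \<le> T" and T: "T \<ge> 1"
  shows "log_energy M M' + ereal ((ln T + 1) * (measure M UNIV * measure M' UNIV)) =
    enn2ereal (\<integral>\<^sup>+w. ennreal (measure M (window w) * measure M' (window w)) \<partial>window_measure T)"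
proof -
  interpret M: finite_measure M by fact
  interpret M': finite_measure M' by fact
  note [measurable_cong] = M(2) M'(2)
  interpret P: pair_sigma_finite M M' ..
  define L where "L = (\<lambda>z. log_kernel (fst z) (snd z))"
  have L [measurable]: "L \<in> borel_measurable (M \<Otimes>\<^sub>M M')"
    unfolding L_def log_kernel_def by measurable
  define c where "c = ln T + 1"
  have c: "c \<ge> 0" "ln T \<ge> 0" using T by (auto simp: c_def)
  have spaces: "space M = UNIV" "space M' = UNIV"
    using sets_eq_imp_space_eq[OF M(2)] sets_eq_imp_space_eq[OF M'(2)] by auto
  have [measurable]: "S \<in> sets borel" by fact
  have AE: "AE z in M \<Otimes>\<^sub>M M'. fst z \<in> S \<and> snd z \<in> S"
  proof (rule P.AE_pair_measure)
    show "{z \<in> space (M \<Otimes>\<^sub>M M'). fst z \<in> S \<and> snd z \<in> S} \<in> sets (M \<Otimes>\<^sub>M M')" by measurable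
    show "AE x in M. AE y in M'. fst (x, y) \<in> S \<and> snd (x, y) \<in> S"
      using M(3) M'(3) by auto
  qed
  have pos: "e2ennreal (L z) + ennreal c = window_kernel T (fst z) (snd z) + e2ennreal (- L z)"
    "e2ennreal (- L z) \<le> ennreal (ln T)"
    if z: "fst z \<in> S" "snd z \<in> S" for z
  proof -
    define d where "d = \<bar>fst z - snd z\<bar>"
    have d: "d \<le> T" using S(2) z by (auto simp: d_def)
    have "e2ennreal (L z) + ennreal c = window_kernel T (fst z) (snd z) + e2ennreal (- L z)
       \<and> e2ennreal (- L z) \<le> ennreal (ln T)"
    proof (cases "fst z = snd z")
      case True
      thus ?thesis using T
        by (simp add: L_def log_kernel_def window_kernel_diag e2ennreal_infty e2ennreal_neg top_add)
    next
      case False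
      hence d0: "d > 0" by (simp add: d_def)
      have L: "L z = ereal (ln (1 / d))" using False by (simp add: L_def log_kernel_def d_def)
      have K: "window_kernel T (fst z) (snd z) = ennreal (ln (1 / d) + c)"
      proof -
        have "window_kernel T (fst z) (snd z) = ennreal (ln (T / d) + 1)"
          using window_kernel_eq[OF False] d by (simp only: d_def)
        also have "ln (T / d) + 1 = ln (1 / d) + c" using d0 T by (simp add: c_def ln_div)
        finally show ?thesis .
      qed
      have ge: "ln (1 / d) + ln T \<ge> 0"
        using d d0 T by (simp add: ln_div)
      hence ge': "ln (1 / d) + c \<ge> 0" by (simp add: c_def)
      have "ennreal (ln (1 / d)) + ennreal c = ennreal (ln (1 / d) + c) + ennreal (- ln (1 / d))"
      proof (cases "ln (1 / d) \<ge> 0")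
        case True thus ?thesis using c by (simp add: ennreal_neg)
      next
        case False
        hence "ennreal (ln (1 / d) + c) + ennreal (- ln (1 / d)) = ennreal c"
          using ge' by (subst ennreal_plus[symmetric]) auto
        thus ?thesis using False by (simp add: ennreal_neg)
      qed
      thus ?thesis using ge by (auto simp: L K intro!: ennreal_leI)
    qed
    thus "e2ennreal (L z) + ennreal c = window_kernel T (fst z) (snd z) + e2ennreal (- L z)"
      "e2ennreal (- L z) \<le> ennreal (ln T)" by auto
  qed
  define A where "A = (\<integral>\<^sup>+z. e2ennreal (L z) \<partial>(M \<Otimes>\<^sub>M M'))"
  define B where "B = (\<integral>\<^sup>+z. e2ennreal (- L z) \<partial>(M \<Otimes>\<^sub>M M'))"
  define K where "K = (\<integral>\<^sup>+z. window_kernel T (fst z) (snd z) \<partial>(M \<Otimes>\<^sub>M M'))"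
  have mass: "emeasure (M \<Otimes>\<^sub>M M') (space (M \<Otimes>\<^sub>M M')) = ennreal (measure M UNIV * measure M' UNIV)"
    unfolding space_pair_measure using M(2) M'(2)
    by (subst M'.emeasure_pair_measure_Times)
       (auto simp: spaces M.emeasure_eq_measure M'.emeasure_eq_measure ennreal_mult)
  have "A + ennreal (c * (measure M UNIV * measure M' UNIV)) =
     (\<integral>\<^sup>+z. e2ennreal (L z) + ennreal c \<partial>(M \<Otimes>\<^sub>M M'))"
    unfolding A_def by (subst nn_integral_add) (use c in \<open>auto simp: mass ennreal_mult\<close>)
  also have "\<dots> = (\<integral>\<^sup>+z. window_kernel T (fst z) (snd z) + e2ennreal (- L z) \<partial>(M \<Otimes>\<^sub>M M'))"
    by (intro nn_integral_cong_AE eventually_mono[OF AE] pos(1)) auto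
  also have "\<dots> = K + B"
    unfolding K_def B_def by (subst nn_integral_add) auto
  finally have eq: "A + ennreal (c * (measure M UNIV * measure M' UNIV)) = K + B" .
  have "B \<le> (\<integral>\<^sup>+z. ennreal (ln T) \<partial>(M \<Otimes>\<^sub>M M'))"
    unfolding B_def by (intro nn_integral_mono_AE eventually_mono[OF AE] pos(2)) auto
  also have "\<dots> < \<infinity>" by (simp add: mass ennreal_mult_less_top)
  finally obtain b where b: "B = ennreal b" "b \<ge> 0" by (cases B) auto
  have "log_energy M M' = enn2ereal A - enn2ereal B"
    unfolding log_energy_def ereal_integral_def A_def B_def L_def
    by (simp add: case_prod_unfold)
  moreover have "enn2ereal A + ereal (c * (measure M UNIV * measure M' UNIV)) = enn2ereal K + ereal b"
    using arg_cong[OF eq, of enn2ereal] b c by (simp add: plus_ennreal.rep_eq)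
  hence "enn2ereal A - enn2ereal B + ereal (c * (measure M UNIV * measure M' UNIV)) = enn2ereal K"
    using b by (cases "enn2ereal A"; cases "enn2ereal K") auto
  ultimately have "log_energy M M' + ereal (c * (measure M UNIV * measure M' UNIV)) = enn2ereal K"
    by simp
  thus ?thesis unfolding K_def c_def
    by (subst (asm) nn_integral_window_kernel) (use assms in auto)
qed

lemma AE_finite_borel_measure_on:
  assumes "finite_borel_measure_on K M" "K \<in> sets borel"
  shows "AE x in M. x \<in> K"
proof (rule AE_I')
  show "- K \<in> null_sets M" using assms by (auto simp: finite_borel_measure_on_def null_sets_def)
  show "{x \<in> space M. x \<notin> K} \<subseteq> - K" by auto
qed

lemma measure_UNIV_finite_borel_measure_on:
  assumes "finite_borel_measure_on K M" "K \<in> sets borel" "emeasure M K = ennreal m" "m \<ge> 0"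
  shows "measure M UNIV = m"
proof -
  have "emeasure M UNIV = emeasure M K"
    using AE_finite_borel_measure_on[OF assms(1,2)] assms(1,2)
    by (intro emeasure_eq_AE) (auto simp: finite_borel_measure_on_def)
  thus ?thesis using assms by (simp add: measure_def)
qed

theorem angelesco_energy_window:
  assumes \<nu>: "\<nu> \<in> admissible_tuples p \<Gamma> r" and \<Gamma>: "\<And>i. i < p \<Longrightarrow> \<Gamma> i \<in> sets borel"
    and r: "\<And>i. i < p \<Longrightarrow> r i > 0"
    and diam: "\<And>i j x y. i < p \<Longrightarrow> j < p \<Longrightarrow> x \<in> \<Gamma> i \<Longrightarrow> y \<in> \<Gamma> j \<Longrightarrow> \<bar>x - y\<bar> \<le> T"
    and T: "T \<ge> 1"
  shows "angelesco_energy p \<nu> + ereal ((ln T + 1) * interaction_form p r) =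
    enn2ereal (window_energy p T \<nu>)"
proof -
  define S where "S = (\<Union>i<p. \<Gamma> i)"
  have S: "S \<in> sets borel" unfolding S_def using \<Gamma> by auto
  have \<nu>': "finite_borel_measure_on (\<Gamma> i) (\<nu> i)" "emeasure (\<nu> i) (\<Gamma> i) = ennreal (r i)" if "i < p" for i
    using \<nu> that by (auto simp: admissible_tuples_def)
  have fin: "finite_measure (\<nu> i)" "sets (\<nu> i) = sets borel" if "i < p" for i
    using \<nu>'[OF that] by (auto simp: finite_borel_measure_on_def)
  have AE: "AE x in \<nu> i. x \<in> S" if "i < p" for i
    using AE_finite_borel_measure_on[OF \<nu>'(1)[OF that] \<Gamma>[OF that]]
    by (rule eventually_mono) (use that in \<open>auto simp: S_def\<close>)
  have mass: "measure (\<nu> i) UNIV = r i" if "i < p" for i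
    using measure_UNIV_finite_borel_measure_on[OF \<nu>'(1) \<Gamma> \<nu>'(2)] r[OF that] that by simp
  have diamS: "\<bar>x - y\<bar> \<le> T" if "x \<in> S" "y \<in> S" for x y
    using that diam unfolding S_def by blast
  define m where "m = (\<lambda>i j. \<integral>\<^sup>+w. ennreal (measure (\<nu> i) (window w) * measure (\<nu> j) (window w)) \<partial>window_measure T)"
  have E: "log_energy (\<nu> i) (\<nu> j) + ereal ((ln T + 1) * (r i * r j)) = enn2ereal (m i j)"
    if "i < p" "j < p" for i j
    using log_energy_window[OF fin[OF that(1)] AE[OF that(1)] fin[OF that(2)] AE[OF that(2)] S diamS T]
      that by (simp add: mass m_def)
  have "angelesco_energy p \<nu> + ereal ((ln T + 1) * interaction_form p r) =
    (\<Sum>i<p. log_energy (\<nu> i) (\<nu> i) + ereal ((ln T + 1) * (r i * r i))) +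
    (\<Sum>j<p. \<Sum>i<j. log_energy (\<nu> i) (\<nu> j) + ereal ((ln T + 1) * (r i * r j)))"
    by (simp add: angelesco_energy_def interaction_form_def sum.distrib power2_eq_square
         distrib_left add_ac flip: sum_distrib_left)
  also have "\<dots> = (\<Sum>i<p. enn2ereal (m i i)) + (\<Sum>j<p. \<Sum>i<j. enn2ereal (m i j))"
    by (intro arg_cong2[where f="(+)"] sum.cong refl E) auto
  also have "\<dots> = enn2ereal ((\<Sum>i<p. m i i) + (\<Sum>j<p. \<Sum>i<j. m i j))"
    by (simp add: plus_ennreal.rep_eq flip: sum_enn2ereal)
  also have "(\<Sum>i<p. m i i) + (\<Sum>j<p. \<Sum>i<j. m i j) = window_energy p T \<nu>"
  proof -
    have [measurable]: "(\<lambda>w. measure (\<nu> i) (window w)) \<in> borel_measurable (window_measure T)" if "i < p" for i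
      using measure_window_measurable[OF fin[OF that]]
      by (simp add: measurable_cong_sets[OF sets_window_measure])
    define f where "f = (\<lambda>i j w. ennreal (measure (\<nu> i) (window w) * measure (\<nu> j) (window w)))"
    have f [measurable]: "i < p \<Longrightarrow> j < p \<Longrightarrow> f i j \<in> borel_measurable (window_measure T)" for i j
      unfolding f_def by measurable
    have m: "m i j = (\<integral>\<^sup>+w. f i j w \<partial>window_measure T)" for i j
      by (simp add: m_def f_def)
    have "window_energy p T \<nu> =
        (\<integral>\<^sup>+w. (\<Sum>i<p. f i i w) + (\<Sum>j<p. \<Sum>i<j. f i j w) \<partial>window_measure T)"
      unfolding window_energy_def interaction_form_def f_def
      by (intro nn_integral_cong) (simp add: ennreal_plus sum_nonneg power2_eq_square flip: sum_ennreal)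
    also have "\<dots> = (\<integral>\<^sup>+w. (\<Sum>i<p. f i i w) \<partial>window_measure T)
        + (\<integral>\<^sup>+w. (\<Sum>j<p. \<Sum>i<j. f i j w) \<partial>window_measure T)"
      by (rule nn_integral_add) (auto intro!: borel_measurable_sum)
    also have "(\<integral>\<^sup>+w. (\<Sum>i<p. f i i w) \<partial>window_measure T) = (\<Sum>i<p. m i i)"
      unfolding m by (rule nn_integral_sum) auto
    also have "(\<integral>\<^sup>+w. (\<Sum>j<p. \<Sum>i<j. f i j w) \<partial>window_measure T)
        = (\<Sum>j<p. \<integral>\<^sup>+w. (\<Sum>i<j. f i j w) \<partial>window_measure T)"
      by (rule nn_integral_sum) (auto intro!: borel_measurable_sum)
    also have "\<dots> = (\<Sum>j<p. \<Sum>i<j. m i j)"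
      unfolding m by (intro sum.cong refl nn_integral_sum) auto
    finally show ?thesis by simp
  qed
  finally show ?thesis .
qed

section \<open>Systems of intervals: uniqueness of the minimizer and finite energy\<close>

lemma AE_lborel_obtain:
  assumes "AE x in lborel. P (x :: real)" "a < b"
  obtains x where "a < x" "x < b" "P x"
proof -
  have "\<exists>x\<in>{a<..<b}. P x"
  proof (rule ccontr)
    assume "\<not> (\<exists>x\<in>{a<..<b}. P x)"
    with assms(1) have "AE x in lborel. x \<notin> {a<..<b}" by (auto elim!: eventually_mono)
    hence "emeasure lborel {a<..<b} = 0"
      using AE_iff_null_sets[of "{a<..<b}" lborel] by (auto simp: null_sets_def)
    thus False using assms(2) by simp
  qed
  thus ?thesis using that by auto
qed

lemma AE_window_measure:
  assumes "AE w in window_measure T. P w" "T > 0"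
  shows "AE u in lborel. AE t in lborel. t > 0 \<longrightarrow> P (u, t)"
proof -
  have "AE w in lborel \<Otimes>\<^sub>M lborel. ennreal (interval_rate T (snd w)) > 0 \<longrightarrow> P w"
    using assms(1) unfolding window_measure_def by (subst (asm) AE_density) auto
  hence "AE u in lborel. AE t in lborel. ennreal (interval_rate T (snd (u, t))) > 0 \<longrightarrow> P (u, t)"
    by (rule lborel_pair.AE_pair)
  moreover have "interval_rate T t > 0" if "t > 0" for t
    using that assms by (simp add: interval_rate_def)
  ultimately show ?thesis by (auto elim!: eventually_mono)
qed

text \<open>
  A window whose left end point lies below the supports has the mass that the distribution function
  takes at its right end point.  Almost every left end point and almost every length are good, so the two
  distribution functions agree on a dense set of points, hence everywhere by right continuity.
\<close>

lemma measure_eqI_windows: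
  assumes M: "finite_measure M" "sets M = sets borel" "AE x in M. a \<le> x"
    and M': "finite_measure M'" "sets M' = sets borel" "AE x in M'. a \<le> x"
    and eq: "AE w in window_measure T. measure M (window w) = measure M' (window w)" and T: "T > 0"
    and mass: "measure M UNIV = measure M' UNIV"
  shows "M = M'"
proof -
  interpret M: finite_borel_measure M
    using M by (simp add: finite_borel_measure_def finite_borel_measure_axioms_def)
  interpret M': finite_borel_measure M'
    using M' by (simp add: finite_borel_measure_def finite_borel_measure_axioms_def)
  \<comment> \<open>A left end point below both supports for which almost all lengths are good.\<close>
  obtain u where u: "u < a" and u_AE: "AE t in lborel. t > 0 \<longrightarrow> measure M {u..u + t} = measure M' {u..u + t}"
    by (rule AE_lborel_obtain[OF AE_window_measure[OF eq T], of "a - 1" a])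
       (auto simp: window_def)
  have win: "measure M {u..v} = cdf M v" "measure M' {u..v} = cdf M' v" for v
  proof -
    show "measure M {u..v} = cdf M v" unfolding cdf_def using M u
      by (intro measure_eq_AE) (auto elim!: eventually_mono)
    show "measure M' {u..v} = cdf M' v" unfolding cdf_def using M' u
      by (intro measure_eq_AE) (auto elim!: eventually_mono)
  qed
  have cdf: "cdf M x = cdf M' x" for x
  proof (cases "x < a")
    case True
    have "cdf M x = measure M {}" unfolding cdf_def using M True
      by (intro measure_eq_AE) (auto elim!: eventually_mono)
    moreover have "cdf M' x = measure M' {}" unfolding cdf_def using M' True
      by (intro measure_eq_AE) (auto elim!: eventually_mono)
    ultimately show ?thesis by simp
  next
    case False
    have "\<exists>v. x < v \<and> v < x + 1 / real (Suc k) \<and> cdf M v = cdf M' v" for k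
    proof (rule AE_lborel_obtain[OF u_AE, of "x - u" "x - u + 1 / real (Suc k)"])
      fix t assume t: "x - u < t" "t < x - u + 1 / real (Suc k)"
        and "0 < t \<longrightarrow> measure M {u..u + t} = measure M' {u..u + t}"
      hence "cdf M (u + t) = cdf M' (u + t)" using u False by (simp add: win)
      thus ?thesis using t by (intro exI[of _ "u + t"]) auto
    qed simp
    then obtain v where v: "\<And>k. x < v k" "\<And>k. v k < x + 1 / real (Suc k)" "\<And>k. cdf M (v k) = cdf M' (v k)"
      by metis
    have "v \<longlonglongrightarrow> x"
    proof (rule tendsto_sandwich[where f = "\<lambda>_. x"])
      show "(\<lambda>k. x + 1 / real (Suc k)) \<longlonglongrightarrow> x"
        using tendsto_add[OF tendsto_const[of x] LIMSEQ_inverse_real_of_nat]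
        by (simp add: inverse_eq_divide)
    qed (use v in \<open>auto intro!: always_eventually less_imp_le\<close>)
    hence lim: "filterlim v (at_right x) sequentially"
      using v(1) by (auto simp: filterlim_at intro!: always_eventually)
    have "(\<lambda>k. cdf M (v k)) \<longlonglongrightarrow> cdf M x"
      using M.cdf_is_right_cont[of x] lim unfolding continuous_within by (rule filterlim_compose)
    moreover have "(\<lambda>k. cdf M' (v k)) \<longlonglongrightarrow> cdf M' x"
      using M'.cdf_is_right_cont[of x] lim unfolding continuous_within by (rule filterlim_compose)
    ultimately show ?thesis using v(3) LIMSEQ_unique by simp
  qed
  show ?thesis
    by (rule cdf_unique') (use M M' cdf M.finite_borel_measure_axioms M'.finite_borel_measure_axioms in auto)
qed

lemma scale_half_sum_measure:
  assumes "finite_borel_measure_on K M" "finite_borel_measure_on K M'" "K \<in> sets borel"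
  obtains H where "finite_borel_measure_on K H"
    "\<And>B. B \<in> sets borel \<Longrightarrow> measure H B = (measure M B + measure M' B) / 2"
proof
  define H where "H = scale_measure (1/2) (sum_measure 2 (\<lambda>i. if i = 0 then M else M'))"
  have em: "emeasure H B = (1/2) * (emeasure M B + emeasure M' B)" if "B \<in> sets borel" for B
    using assms that unfolding H_def
    by (subst emeasure_scale_measure, subst emeasure_sum_measure)
       (auto simp: finite_borel_measure_on_def numeral_2_eq_2)
  have sets: "sets H = sets borel" by (simp add: H_def)
  interpret M: finite_measure M using assms by (simp add: finite_borel_measure_on_def)
  interpret M': finite_measure M' using assms by (simp add: finite_borel_measure_on_def)
  have half: "(1/2 :: ennreal) = ennreal (1/2)" using divide_ennreal[of 1 2] by simp
  have em': "emeasure H B = ennreal ((measure M B + measure M' B) / 2)" if "B \<in> sets borel" for B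
  proof -
    have "emeasure H B = ennreal (1/2) * (ennreal (measure M B) + ennreal (measure M' B))"
      using em[OF that] by (simp only: half M.emeasure_eq_measure M'.emeasure_eq_measure)
    also have "ennreal (measure M B) + ennreal (measure M' B) = ennreal (measure M B + measure M' B)"
      by simp
    also have "ennreal (1/2) * \<dots> = ennreal (1/2 * (measure M B + measure M' B))"
      by (rule ennreal_mult[symmetric]) auto
    finally show ?thesis by simp
  qed
  show "finite_borel_measure_on K H"
    unfolding finite_borel_measure_on_def
  proof (intro conjI)
    show "finite_measure H"
      by (rule finite_measureI) (simp add: sets_eq_imp_space_eq[OF sets] em')
    show "emeasure H (- K) = 0"
      using assms by (subst em) (auto simp: finite_borel_measure_on_def)
  qed (rule sets)
  show "measure H B = (measure M B + measure M' B) / 2" if "B \<in> sets borel" for B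
    using em'[OF that] by (simp add: measure_def)
qed

text \<open>
  The common setting: the blocks \<open>{a i..b i}\<close> in increasing order, the masses \<open>r i\<close>, and a number
  \<open>T\<close> that bounds the diameter of their union.
\<close>

locale angelesco_system =
  fixes p :: nat and a b r :: "nat \<Rightarrow> real" and T :: real
  assumes p_pos: "p \<ge> 1"
    and ab: "\<And>i. i < p \<Longrightarrow> a i < b i"
    and gap: "\<And>i. Suc i < p \<Longrightarrow> b i < a (Suc i)"
    and r_pos: "\<And>i. i < p \<Longrightarrow> r i > 0"
    and r_sum: "(\<Sum>i<p. r i) = 1"
    and T_ge: "T \<ge> 1" "b (p - 1) - a 0 \<le> T"
begin

abbreviation \<Gamma> :: "nat \<Rightarrow> real set" where "\<Gamma> i \<equiv> {a i..b i}"

abbreviation form :: "(nat \<Rightarrow> real) \<Rightarrow> real" where "form \<equiv> interaction_form p"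

abbreviation energy :: "(nat \<Rightarrow> real measure) \<Rightarrow> ennreal" where "energy \<equiv> window_energy p T"

lemma T_pos: "T > 0" using T_ge by simp

lemma blocks_ordered:
  assumes "i < j" "j < p"
  shows "b i < a j"
  using assms
proof (induction j)
  case (Suc j)
  show ?case
  proof (cases "i = j")
    case False
    hence "b i < a j" using Suc by auto
    also have "a j < b j" using ab Suc by auto
    also have "b j < a (Suc j)" using gap Suc by auto
    finally show ?thesis .
  qed (use gap Suc in auto)
qed auto

lemma hull: "i < p \<Longrightarrow> x \<in> \<Gamma> i \<Longrightarrow> a 0 \<le> x \<and> x \<le> b (p - 1)"
proof -
  assume i: "i < p" and x: "x \<in> \<Gamma> i"
  have "a 0 \<le> a i"
    using blocks_ordered[of 0 i] ab[of 0] i by (cases "i = 0") auto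
  moreover have "b i \<le> b (p - 1)"
  proof (cases "i = p - 1")
    case False
    hence "b i < a (p - 1)" using blocks_ordered[of i "p - 1"] i by linarith
    thus ?thesis using ab[of "p - 1"] i by simp
  qed simp
  ultimately show ?thesis using x by auto
qed

lemma diameter: "i < p \<Longrightarrow> j < p \<Longrightarrow> x \<in> \<Gamma> i \<Longrightarrow> y \<in> \<Gamma> j \<Longrightarrow> \<bar>x - y\<bar> \<le> T"
  using hull[of i x] hull[of j y] T_ge(2) by auto

definition admissible :: "(nat \<Rightarrow> real measure) \<Rightarrow> bool" where
  "admissible \<nu> \<longleftrightarrow> (\<forall>i<p. finite_borel_measure_on (\<Gamma> i) (\<nu> i) \<and> measure (\<nu> i) UNIV = r i)"

lemma admissibleD:
  assumes "admissible \<nu>" "i < p"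
  shows "finite_borel_measure_on (\<Gamma> i) (\<nu> i)" "finite_measure (\<nu> i)" "sets (\<nu> i) = sets borel"
    "AE x in \<nu> i. x \<in> \<Gamma> i" "measure (\<nu> i) UNIV = r i"
  using assms AE_finite_borel_measure_on[of "\<Gamma> i" "\<nu> i"]
  by (auto simp: admissible_def finite_borel_measure_on_def)

lemma admissible_iff:
  assumes "\<And>i. i < p \<Longrightarrow> G i = \<Gamma> i"
  shows "\<nu> \<in> admissible_tuples p G r \<longleftrightarrow> admissible \<nu>"
proof -
  have "(finite_borel_measure_on (G i) (\<nu> i) \<and> emeasure (\<nu> i) (G i) = ennreal (r i)) \<longleftrightarrow>
    (finite_borel_measure_on (\<Gamma> i) (\<nu> i) \<and> measure (\<nu> i) UNIV = r i)" if i: "i < p" for i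
  proof (cases "finite_borel_measure_on (\<Gamma> i) (\<nu> i)")
    case True
    interpret finite_measure "\<nu> i" using True by (simp add: finite_borel_measure_on_def)
    have "emeasure (\<nu> i) UNIV = emeasure (\<nu> i) (\<Gamma> i)"
      using AE_finite_borel_measure_on[OF True] True
      by (intro emeasure_eq_AE) (auto simp: finite_borel_measure_on_def)
    thus ?thesis using True r_pos[OF i] assms[OF i] by (auto simp: emeasure_eq_measure)
  qed (use assms[OF i] in simp)
  thus ?thesis unfolding admissible_tuples_def admissible_def by blast
qed

lemma window_measure_measurable:
  "f \<in> borel_measurable (borel \<Otimes>\<^sub>M borel) \<Longrightarrow> f \<in> borel_measurable (window_measure T)"
  by (simp add: measurable_cong_sets[OF sets_window_measure])

lemma energy_integrand_measurable:
  assumes "\<And>i. i < p \<Longrightarrow> finite_measure (\<nu> i) \<and> sets (\<nu> i) = sets borel"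
  shows "(\<lambda>w. form (\<lambda>i. measure (\<nu> i) (window w))) \<in> borel_measurable (borel \<Otimes>\<^sub>M borel)"
  using assms by (intro interaction_form_measurable measure_window_measurable) auto

text \<open>
  Let \<open>H\<close> be the midpoint of \<open>\<mu>\<close> and \<open>\<nu>\<close>.  By the parallelogram identity the energy of
  \<open>H\<close> falls below the minimum by the energy of \<open>(\<mu> - \<nu>) / 2\<close>, so the latter vanishes and
  \<open>\<mu>\<close> and \<open>\<nu>\<close> give the same mass to almost every window.
\<close>

lemma minimizer_unique:
  assumes \<mu>: "admissible \<mu>" and \<nu>: "admissible \<nu>"
    and min: "\<And>\<eta>. admissible \<eta> \<Longrightarrow> energy \<mu> \<le> energy \<eta>"
    and le: "energy \<nu> \<le> energy \<mu>" and fin: "energy \<mu> < \<infinity>" and i: "i < p"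
  shows "\<nu> i = \<mu> i"
proof -
  have "\<forall>i. \<exists>H. i < p \<longrightarrow> finite_borel_measure_on (\<Gamma> i) H \<and>
    (\<forall>B\<in>sets borel. measure H B = (measure (\<mu> i) B + measure (\<nu> i) B) / 2)"
    using scale_half_sum_measure[OF admissibleD(1)[OF \<mu>] admissibleD(1)[OF \<nu>]]
    by (metis borel_closed closed_atLeastAtMost)
  then obtain H where H: "\<And>i. i < p \<Longrightarrow> finite_borel_measure_on (\<Gamma> i) (H i)"
    "\<And>i B. i < p \<Longrightarrow> B \<in> sets borel \<Longrightarrow> measure (H i) B = (measure (\<mu> i) B + measure (\<nu> i) B) / 2"
    by metis
  have "admissible H"
    using H(1) H(2)[of _ UNIV] admissibleD(5)[OF \<mu>] admissibleD(5)[OF \<nu>] by (auto simp: admissible_def)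
  define f where "f = (\<lambda>i w. measure (\<mu> i) (window w))"
  define g where "g = (\<lambda>i w. measure (\<nu> i) (window w))"
  have [measurable]: "i < p \<Longrightarrow> f i \<in> borel_measurable (window_measure T)"
    "i < p \<Longrightarrow> g i \<in> borel_measurable (window_measure T)" for i
    unfolding f_def g_def using admissibleD[OF \<mu>, of i] admissibleD[OF \<nu>, of i]
    by (auto intro!: window_measure_measurable measure_window_measurable)
  define D where "D = (\<integral>\<^sup>+w. ennreal (form (\<lambda>i. (f i w - g i w) / 2)) \<partial>window_measure T)"
  have "2 * energy H + 2 * D =
    (\<integral>\<^sup>+w. 2 * ennreal (form (\<lambda>i. (f i w + g i w) / 2)) + 2 * ennreal (form (\<lambda>i. (f i w - g i w) / 2))
      \<partial>window_measure T)"
  proof -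
    have "energy H = (\<integral>\<^sup>+w. ennreal (form (\<lambda>i. (f i w + g i w) / 2)) \<partial>window_measure T)"
      unfolding window_energy_def f_def g_def
      by (intro nn_integral_cong arg_cong[where f=ennreal] interaction_form_cong) (auto simp: H)
    thus ?thesis unfolding D_def
      by (subst nn_integral_add) (auto simp: nn_integral_cmult)
  qed
  also have "\<dots> = (\<integral>\<^sup>+w. ennreal (form (\<lambda>i. f i w)) + ennreal (form (\<lambda>i. g i w)) \<partial>window_measure T)"
  proof (intro nn_integral_cong)
    fix w
    have "2 * ennreal (form (\<lambda>i. (f i w + g i w) / 2)) + 2 * ennreal (form (\<lambda>i. (f i w - g i w) / 2))
       = ennreal (2 * (form (\<lambda>i. (f i w + g i w) / 2) + form (\<lambda>i. (f i w - g i w) / 2)))"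
      by (simp add: interaction_form_nonneg ennreal_mult' distrib_left)
    also have "\<dots> = ennreal (form (\<lambda>i. f i w)) + ennreal (form (\<lambda>i. g i w))"
    proof -
      have "2 * (form (\<lambda>i. (f i w + g i w) / 2) + form (\<lambda>i. (f i w - g i w) / 2))
          = form (\<lambda>i. f i w) + form (\<lambda>i. g i w)"
        by (subst interaction_form_parallelogram) simp
      thus ?thesis by (simp only: ennreal_plus interaction_form_nonneg)
    qed
    finally show "2 * ennreal (form (\<lambda>i. (f i w + g i w) / 2)) + 2 * ennreal (form (\<lambda>i. (f i w - g i w) / 2))
       = ennreal (form (\<lambda>i. f i w)) + ennreal (form (\<lambda>i. g i w))" .
  qed
  also have "\<dots> = energy \<mu> + energy \<nu>"
  proof -
    have "energy \<mu> = (\<integral>\<^sup>+w. ennreal (form (\<lambda>i. f i w)) \<partial>window_measure T)"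
      "energy \<nu> = (\<integral>\<^sup>+w. ennreal (form (\<lambda>i. g i w)) \<partial>window_measure T)"
      by (simp_all add: window_energy_def f_def g_def)
    thus ?thesis by (simp only:) (rule nn_integral_add, auto)
  qed
  finally have eq: "2 * energy H + 2 * D = energy \<mu> + energy \<nu>" .
  have "2 * energy \<mu> + 2 * D \<le> 2 * energy \<mu>"
  proof -
    have "2 * energy \<mu> + 2 * D \<le> 2 * energy H + 2 * D"
      using min[OF \<open>admissible H\<close>] by (intro add_right_mono mult_left_mono) auto
    also have "\<dots> \<le> energy \<mu> + energy \<mu>" unfolding eq using le by (intro add_left_mono)
    finally show ?thesis by (simp add: mult_2)
  qed
  hence "2 * energy \<mu> + 2 * D \<le> 2 * energy \<mu> + 0" by simp
  hence "D = 0"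
    using fin unfolding ennreal_add_left_cancel_le by (auto simp: ennreal_mult_eq_top_iff)
  hence "AE w in window_measure T. form (\<lambda>i. (f i w - g i w) / 2) = 0"
    unfolding D_def by (subst (asm) nn_integral_0_iff_AE)
      (auto simp: interaction_form_nonneg order.antisym elim!: eventually_mono)
  hence "AE w in window_measure T. measure (\<nu> i) (window w) = measure (\<mu> i) (window w)"
    using i by (auto simp: interaction_form_eq_0_iff f_def g_def elim!: eventually_mono)
  thus ?thesis
    using admissibleD[OF \<mu> i] admissibleD[OF \<nu> i] T_pos
    by (intro measure_eqI_windows[where a = "a i"]) (auto elim!: eventually_mono)
qed

text \<open>
  Uniform distributions have finite energy.  A window of length \<open>t\<close> has mass at most a constant times
  \<open>min t (B - A)\<close>, and it meets \<open>{A..B}\<close> only if its left end point lies in an interval of length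
  \<open>B - A + t\<close>.  Hence short windows are integrable because the square of the mass cancels the rate
  \<open>t\<^sup>-\<^sup>2\<close>, and long ones because the rate \<open>t\<^sup>-\<^sup>3\<close> outweighs the number of positions.
\<close>

lemma finite_energy_exists: "\<exists>\<nu>. admissible \<nu> \<and> energy \<nu> < \<infinity>"
proof -
  define \<nu> where "\<nu> = (\<lambda>i. scale_measure (ennreal (r i)) (uniform_measure lborel (\<Gamma> i)))"
  have len: "b i - a i > 0" if "i < p" for i using ab[OF that] by simp
  have em: "emeasure (\<nu> i) B = ennreal (r i / (b i - a i)) * emeasure lborel (\<Gamma> i \<inter> B)"
    if "i < p" "B \<in> sets borel" for i B
    unfolding \<nu>_def using that ab[of i] r_pos[of i]
    by (simp add: emeasure_uniform_measure ennreal_times_divide divide_ennreal_def mult_ac ennreal_mult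
       inverse_ennreal[symmetric] divide_inverse)
  have fin_int: "emeasure lborel (\<Gamma> i \<inter> B) \<le> ennreal (b i - a i)" if "i < p" "B \<in> sets borel" for i B
    using emeasure_mono[of "\<Gamma> i \<inter> B" "\<Gamma> i" lborel] that ab[of i] by auto
  have adm: "admissible \<nu>"
    unfolding admissible_def finite_borel_measure_on_def
  proof (intro allI impI conjI)
    fix i assume i: "i < p"
    have U: "emeasure (\<nu> i) UNIV = ennreal (r i)"
      using em[OF i, of UNIV] ab[OF i] r_pos[OF i] by (simp flip: ennreal_mult)
    show "sets (\<nu> i) = sets borel" by (simp add: \<nu>_def)
    show "finite_measure (\<nu> i)"
      by (rule finite_measureI) (use U in \<open>simp add: \<nu>_def space_scale_measure\<close>)
    show "emeasure (\<nu> i) (- \<Gamma> i) = 0" using em[OF i, of "- \<Gamma> i"] by (simp add: Compl_eq_Diff_UNIV)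
    show "measure (\<nu> i) UNIV = r i" using U r_pos[OF i] by (simp add: measure_def)
  qed
  define c where "c = (\<Sum>i<p. r i / (b i - a i))"
  have ri: "r i / (b i - a i) \<ge> 0" if "i < p" for i
    using len[OF that] r_pos[OF that] by (simp add: less_imp_le)
  have c0: "c \<ge> 0" unfolding c_def by (rule sum_nonneg) (rule ri, simp)
  have c1: "r i / (b i - a i) \<le> c" if "i < p" for i
    unfolding c_def by (rule member_le_sum[of i "{..<p}" "\<lambda>i. r i / (b i - a i)"]) (use that ri in auto)
  define A where "A = a 0" define B where "B = b (p - 1)"
  have AB: "A < B"
  proof -
    have p: "0 < p" using p_pos by linarith
    have "b 0 \<le> b (p - 1)" using hull[OF p, of "b 0"] ab[OF p] by simp
    thus ?thesis unfolding A_def B_def using ab[OF p] by linarith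
  qed
  define s where "s = (\<lambda>w :: real \<times> real. if A - snd w \<le> fst w \<and> fst w \<le> B then c * min (snd w) (B - A) else 0)"
  have ms: "0 \<le> measure (\<nu> i) (window w)" "measure (\<nu> i) (window w) \<le> s w" if i: "i < p" and w: "snd w > 0" for i w
  proof -
    show "measure (\<nu> i) (window w) \<le> s w"
    proof (cases "A - snd w \<le> fst w \<and> fst w \<le> B")
      case True
      have "emeasure lborel (\<Gamma> i \<inter> window w) \<le> ennreal (min (snd w) (B - A))"
      proof -
        have "emeasure lborel (\<Gamma> i \<inter> window w) \<le> emeasure lborel (window w)"
          by (intro emeasure_mono) auto
        moreover have "emeasure lborel (\<Gamma> i \<inter> window w) \<le> emeasure lborel {A..B}"
          using hull[OF i] by (intro emeasure_mono) (auto simp: A_def B_def)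
        ultimately show ?thesis using w AB by (auto simp: window_def min_def)
      qed
      hence "emeasure (\<nu> i) (window w) \<le> ennreal (r i / (b i - a i)) * ennreal (min (snd w) (B - A))"
        by (subst em[OF i]) (auto intro: mult_left_mono)
      also have "\<dots> \<le> ennreal c * ennreal (min (snd w) (B - A))"
        using c1[OF i] by (intro mult_right_mono ennreal_leI) auto
      finally have "emeasure (\<nu> i) (window w) \<le> ennreal (s w)"
        using True c0 w AB by (simp add: s_def ennreal_mult)
      thus ?thesis using c0 w AB True
        by (simp add: measure_def enn2real_leI s_def)
    next
      case False
      have "\<Gamma> i \<inter> window w = {}" using hull[OF i] False w by (force simp: A_def B_def window_def)
      moreover have "s w = 0" unfolding s_def using False by (rule if_not_P)
      ultimately show ?thesis using em[OF i, of "window w"] by (simp add: measure_def)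
    qed
  qed simp
  define K where "K = form (\<lambda>_. c)"
  have K: "K \<ge> 0" unfolding K_def by (rule interaction_form_nonneg)
  have "energy \<nu> \<le> (\<integral>\<^sup>+w. ennreal (K * (min (snd w) (B - A))\<^sup>2) * indicator {A - snd w..B} (fst w)
      * indicator {0<..} (snd w) \<partial>window_measure T)"
  proof -
    have pos: "AE w in window_measure T. snd w > 0"
      unfolding window_measure_def
      by (subst AE_density) (auto simp: interval_rate_def not_le)
    show ?thesis unfolding window_energy_def
    proof (rule nn_integral_mono_AE, use pos in eventually_elim)
      case (elim w)
      have "form (\<lambda>i. measure (\<nu> i) (window w)) \<le> form (\<lambda>_. s w)"
        using ms elim by (intro interaction_form_mono) auto
      also have "\<dots> \<le> K * (min (snd w) (B - A))\<^sup>2 * indicator {A - snd w..B} (fst w)"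
        using interaction_form_scale[of p "min (snd w) (B - A)" "\<lambda>_. c"]
          interaction_form_scale[of p 0 "\<lambda>_. c"]
        by (auto simp: s_def K_def indicator_def mult.commute)
      finally show ?case using elim K
        by (auto simp: indicator_def ennreal_neg intro!: ennreal_leI split: if_splits)
    qed
  qed
  also have "\<dots> = (\<integral>\<^sup>+t. ennreal (interval_rate T t) *
     (\<integral>\<^sup>+u. ennreal (K * (min t (B - A))\<^sup>2) * indicator {A - t..B} u * indicator {0<..} t \<partial>lborel) \<partial>lborel)"
  proof (subst nn_integral_window_measure)
    show "(\<lambda>w. ennreal (K * (min (snd w) (B - A))\<^sup>2) * indicator {A - snd w..B} (fst w)
      * indicator {0<..} (snd w)) \<in> borel_measurable (borel \<Otimes>\<^sub>M borel)"
      unfolding indicator_def of_bool_def atLeastAtMost_iff by measurable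
  qed simp
  also have "\<dots> = (\<integral>\<^sup>+t. ennreal (interval_rate T t) * (ennreal (K * (min t (B - A))\<^sup>2 * (B - A + t))) * indicator {0<..} t \<partial>lborel)"
  proof (intro nn_integral_cong)
    fix t :: real
    have "(\<integral>\<^sup>+u. ennreal (K * (min t (B - A))\<^sup>2) * indicator {A - t..B} u * indicator {0<..} t \<partial>lborel)
     = (\<integral>\<^sup>+u. (ennreal (K * (min t (B - A))\<^sup>2) * indicator {0<..} t) * indicator {A - t..B} u \<partial>lborel)"
      by (intro nn_integral_cong) (simp add: mult_ac)
    also have "\<dots> = (ennreal (K * (min t (B - A))\<^sup>2) * indicator {0<..} t) * emeasure lborel {A - t..B}"
      by (rule nn_integral_cmult_indicator) simp
    also have "\<dots> = ennreal (K * (min t (B - A))\<^sup>2 * (B - A + t)) * indicator {0<..} t"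
    proof (cases "t > 0")
      case True
      hence "emeasure lborel {A - t..B} = ennreal (B - A + t)"
        using AB by (simp add: algebra_simps)
      moreover have "ennreal (K * (min t (B - A))\<^sup>2) * ennreal (B - A + t) =
          ennreal (K * (min t (B - A))\<^sup>2 * (B - A + t))"
        using K AB True by (intro ennreal_mult[symmetric]) auto
      ultimately show ?thesis using True by simp
    qed simp
    finally show "ennreal (interval_rate T t) *
     (\<integral>\<^sup>+u. ennreal (K * (min t (B - A))\<^sup>2) * indicator {A - t..B} u * indicator {0<..} t \<partial>lborel) =
     ennreal (interval_rate T t) * (ennreal (K * (min t (B - A))\<^sup>2 * (B - A + t))) * indicator {0<..} t"
      by (simp add: mult.assoc)
  qed
  also have "\<dots> \<le> (\<integral>\<^sup>+t. ennreal (K * (B - A + T)) * indicator {0..T} t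
     + ennreal (2 * T * K * (B - A)\<^sup>2 * (B - A + T) / T * (1 / t\<^sup>2)) * indicator {T..} t \<partial>lborel)"
  proof (intro nn_integral_mono)
    fix t :: real
    consider "t \<le> 0" | "0 < t" "t \<le> T" | "t > T" using T_pos by linarith
    thus "ennreal (interval_rate T t) * (ennreal (K * (min t (B - A))\<^sup>2 * (B - A + t))) * indicator {0<..} t
     \<le> ennreal (K * (B - A + T)) * indicator {0..T} t
     + ennreal (2 * T * K * (B - A)\<^sup>2 * (B - A + T) / T * (1 / t\<^sup>2)) * indicator {T..} t"
    proof cases
      case 2
      have "1 / t\<^sup>2 * (K * (min t (B - A))\<^sup>2 * (B - A + t)) \<le> 1 / t\<^sup>2 * (K * t\<^sup>2 * (B - A + T))"
        using 2 AB K by (intro mult_left_mono mult_mono power_mono) auto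
      also have "\<dots> = K * (B - A + T)" using 2 by simp
      finally have "ennreal (interval_rate T t) * (ennreal (K * (min t (B - A))\<^sup>2 * (B - A + t))) \<le> ennreal (K * (B - A + T))"
        using 2 by (simp add: interval_rate_def ennreal_leI flip: ennreal_mult')
      thus ?thesis using 2 by (auto simp: indicator_def intro: add_increasing2)
    next
      case 3
      have t: "t > 0" using 3 T_pos by simp
      have "2 * T / t ^ 3 * (K * (min t (B - A))\<^sup>2 * (B - A + t)) \<le> 2 * T / t ^ 3 * (K * (B - A)\<^sup>2 * (B - A + t))"
        using 3 t T_pos AB K by (intro mult_left_mono mult_right_mono power_mono) auto
      also have "\<dots> = 2 * T * K * (B - A)\<^sup>2 * ((B - A + t) / t) * (1 / t\<^sup>2)"
        using t by (simp add: field_simps power2_eq_square power3_eq_cube)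
      also have "\<dots> \<le> 2 * T * K * (B - A)\<^sup>2 * ((B - A + T) / T) * (1 / t\<^sup>2)"
      proof (intro mult_right_mono mult_left_mono)
        show "(B - A + t) / t \<le> (B - A + T) / T" using 3 t T_pos AB
          by (simp add: add_divide_distrib frac_le)
      qed (use T_pos K in auto)
      finally have "ennreal (interval_rate T t) * (ennreal (K * (min t (B - A))\<^sup>2 * (B - A + t))) \<le>
         ennreal (2 * T * K * (B - A)\<^sup>2 * (B - A + T) / T * (1 / t\<^sup>2))"
        using 3 t T_pos by (simp add: interval_rate_def ennreal_leI flip: ennreal_mult')
      thus ?thesis using 3 by (auto simp: indicator_def)
    qed (simp add: interval_rate_def)
  qed
  also have "\<dots> = (\<integral>\<^sup>+t. ennreal (K * (B - A + T)) * indicator {0..T} t \<partial>lborel) +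
     (\<integral>\<^sup>+t. ennreal (2 * T * K * (B - A)\<^sup>2 * (B - A + T) / T * (1 / t\<^sup>2)) * indicator {T..} t \<partial>lborel)"
    by (rule nn_integral_add) auto
  also have "\<dots> < \<infinity>"
  proof -
    define q where "q = 2 * T * K * (B - A)\<^sup>2 * (B - A + T) / T"
    have q: "q \<ge> 0" using K T_pos AB by (simp add: q_def)
    have "(\<integral>\<^sup>+t. ennreal (q * (1 / t\<^sup>2)) * indicator {T..} t \<partial>lborel) = 0 - (- q / T)"
    proof (rule nn_integral_FTC_atLeast[where F = "\<lambda>t. - q / t"])
      show "((\<lambda>t. - q / t) \<longlongrightarrow> 0) at_top" by real_asymp
      fix t assume "T \<le> t"
      hence "t > 0" using T_pos by simp
      thus "((\<lambda>t. - q / t) has_real_derivative q * (1 / t\<^sup>2)) (at t)"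
        by (auto intro!: derivative_eq_intros simp: field_simps power2_eq_square)
    qed (use q in auto)
    thus ?thesis unfolding q_def[symmetric] using T_pos
      by (simp add: nn_integral_cmult_indicator ennreal_mult_less_top)
  qed
  finally show ?thesis using adm by auto
qed

end

section \<open>The Angelesco weight as a product over pairs of coordinates\<close>

context comm_monoid_set
begin

lemma lessThan_add:
  fixes m k :: nat
  shows "F g {..<m + k} = F g {..<m} \<^bold>* F (\<lambda>l. g (m + l)) {..<k}"
proof -
  have "F g {..<m + k} = F g {0..<m} \<^bold>* F g {m..<m + k}"
    by (simp add: atLeastLessThan_concat lessThan_atLeast0)
  also have "F g {m..<m + k} = F (\<lambda>l. g (m + l)) {..<k}"
    using atLeastLessThan_shift_bounds[of g 0 m k] by (simp add: add.commute lessThan_atLeast0 comp_def)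
  finally show ?thesis by (simp add: lessThan_atLeast0)
qed

lemma blocks:
  "F g {..<multi_size p n} = F (\<lambda>i. F (\<lambda>k. g ((\<Sum>j<i. n j) + k)) {..<n i}) {..<p}"
  by (induction p) (simp_all add: multi_size_def lessThan_add lessThan_Suc commute)

end

lemma block_of_offset:
  assumes "k < n i"
  shows "block_of n ((\<Sum>j<i. n j) + k) = i"
  unfolding block_of_def
proof (rule Least_equality)
  show "(\<Sum>j<i. n j) + k < (\<Sum>j\<le>i. n j)" using assms by (simp add: lessThan_Suc_atMost[symmetric])
next
  fix y assume y: "(\<Sum>j<i. n j) + k < (\<Sum>j\<le>y. n j)"
  show "i \<le> y"
  proof (rule ccontr)
    assume "\<not> i \<le> y"
    hence "(\<Sum>j\<le>y. n j) \<le> (\<Sum>j<i. n j)" by (intro sum_mono2) auto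
    with y show False by simp
  qed
qed

lemma less_sum_block_of:
  assumes "k < multi_size p n"
  shows "k < (\<Sum>j\<le>block_of n k. n j)" "block_of n k < p"
proof -
  have "p \<noteq> 0" using assms by (cases p) (auto simp: multi_size_def)
  hence p: "{..<p} = {..p - 1}" by auto
  have *: "k < (\<Sum>j\<le>p - 1. n j)"
    using assms unfolding multi_size_def p .
  show "k < (\<Sum>j\<le>block_of n k. n j)"
    unfolding block_of_def by (rule LeastI[where P = "\<lambda>i. k < (\<Sum>j\<le>i. n j)", OF *])
  have "block_of n k \<le> p - 1"
    unfolding block_of_def by (rule Least_le[where P = "\<lambda>i. k < (\<Sum>j\<le>i. n j)", OF *])
  thus "block_of n k < p" using \<open>p \<noteq> 0\<close> by simp
qed

lemma block_of_mono:
  assumes "l \<le> k" "k < multi_size p n"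
  shows "block_of n l \<le> block_of n k"
proof -
  have "l < (\<Sum>j\<le>block_of n k. n j)" using less_sum_block_of(1)[OF assms(2)] assms(1) by simp
  thus ?thesis unfolding block_of_def[of n l] by (rule Least_le)
qed

lemma sum_block_of:
  fixes c :: "'a :: semiring_1"
  assumes "i < p"
  shows "(\<Sum>k<multi_size p n. if block_of n k = i then c else 0) = of_nat (n i) * c"
proof -
  have "(\<Sum>k<multi_size p n. if block_of n k = i then c else 0) =
    (\<Sum>j<p. \<Sum>k<n j. if j = i then c else 0)"
    unfolding sum.blocks by (intro sum.cong refl) (simp add: block_of_offset)
  also have "\<dots> = (\<Sum>j<p. if j = i then of_nat (n i) * c else 0)"
    by (intro sum.cong) auto
  finally show ?thesis using assms by simp
qed

text \<open>
  Every pair of coordinates contributes its difference to the weight, squared if both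
  coordinates belong to the same block.
\<close>

definition pair_exponent :: "(nat \<Rightarrow> nat) \<Rightarrow> nat \<Rightarrow> nat \<Rightarrow> nat" where
  "pair_exponent n k l = (if block_of n k = block_of n l then 2 else 1)"

text \<open>
  For a coordinate \<open>S i + k\<close> of block \<open>i\<close>, the smaller coordinates are those of the
  preceding blocks, which give the mixed Vandermonde products, and the first \<open>k\<close> of its own block.
\<close>

lemma angelesco_weight_pairs:
  "angelesco_weight p n X = (\<Prod>k<multi_size p n. \<Prod>l<k. (X k - X l) ^ pair_exponent n k l)"
proof -
  define S where "S = (\<lambda>i. \<Sum>j<i. n j)"
  have "(\<Prod>k<multi_size p n. \<Prod>l<k. (X k - X l) ^ pair_exponent n k l) =
    (\<Prod>i<p. \<Prod>k<n i. \<Prod>l<S i + k. (X (S i + k) - X l) ^ pair_exponent n (S i + k) l)"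
    unfolding prod.blocks S_def ..
  also have "\<dots> = (\<Prod>i<p. \<Prod>k<n i. (\<Prod>j<i. \<Prod>l<n j. X (S i + k) - X (S j + l)) *
      (\<Prod>l<k. (X (S i + k) - X (S i + l))\<^sup>2))"
  proof (intro prod.cong refl)
    fix i k assume "i \<in> {..<p}" "k \<in> {..<n i}"
    hence k: "block_of n (S i + k) = i" unfolding S_def by (intro block_of_offset) auto
    let ?g = "\<lambda>l. (X (S i + k) - X l) ^ pair_exponent n (S i + k) l"
    have "(\<Prod>l<S i + k. ?g l) = (\<Prod>l<multi_size i n. ?g l) * (\<Prod>l<k. ?g (S i + l))"
      unfolding prod.lessThan_add by (simp add: S_def multi_size_def)
    also have "(\<Prod>l<multi_size i n. ?g l) = (\<Prod>j<i. \<Prod>l<n j. ?g (S j + l))"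
      unfolding prod.blocks S_def ..
    also have "\<dots> = (\<Prod>j<i. \<Prod>l<n j. X (S i + k) - X (S j + l))"
    proof (intro prod.cong refl)
      fix j l assume "j \<in> {..<i}" "l \<in> {..<n j}"
      hence "block_of n (S j + l) = j" "j \<noteq> i" unfolding S_def by (auto intro!: block_of_offset)
      thus "?g (S j + l) = X (S i + k) - X (S j + l)" by (simp add: pair_exponent_def k)
    qed
    also have "(\<Prod>l<k. ?g (S i + l)) = (\<Prod>l<k. (X (S i + k) - X (S i + l))\<^sup>2)"
    proof (intro prod.cong refl)
      fix l assume "l \<in> {..<k}"
      hence "block_of n (S i + l) = i"
        unfolding S_def using \<open>k \<in> {..<n i}\<close> by (auto intro!: block_of_offset)
      thus "?g (S i + l) = (X (S i + k) - X (S i + l))\<^sup>2" by (simp add: pair_exponent_def k)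
    qed
    finally show "(\<Prod>l<S i + k. ?g l) = (\<Prod>j<i. \<Prod>l<n j. X (S i + k) - X (S j + l)) *
      (\<Prod>l<k. (X (S i + k) - X (S i + l))\<^sup>2)" .
  qed
  also have "\<dots> = (\<Prod>i<p. \<Prod>k<n i. \<Prod>l<k. (X (S i + k) - X (S i + l))\<^sup>2) *
     (\<Prod>i<p. \<Prod>k<n i. \<Prod>j<i. \<Prod>l<n j. X (S i + k) - X (S j + l))"
    by (simp add: prod.distrib mult.commute)
  also have "(\<Prod>i<p. \<Prod>k<n i. \<Prod>j<i. \<Prod>l<n j. X (S i + k) - X (S j + l)) =
     (\<Prod>i<p. \<Prod>j<i. \<Prod>k<n i. \<Prod>l<n j. X (S i + k) - X (S j + l))"
    by (intro prod.cong refl prod.swap)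
  finally show ?thesis
    by (simp add: angelesco_weight_def vandermonde_def mixed_vandermonde_def block_vec_def S_def
        prod_power_distrib)
qed

text \<open>
  Sums over unordered pairs of coordinates, weighted like the logarithm of the Angelesco weight.
\<close>

definition pair_sum :: "(nat \<Rightarrow> nat) \<Rightarrow> nat \<Rightarrow> (nat \<Rightarrow> nat \<Rightarrow> 'a) \<Rightarrow> 'a :: semiring_1" where
  "pair_sum n N g = (\<Sum>k<N. \<Sum>l<k. of_nat (pair_exponent n k l) * g k l)"

lemma pair_sum_cong:
  assumes "\<And>k l. l < k \<Longrightarrow> k < N \<Longrightarrow> g k l = h k l"
  shows "pair_sum n N g = pair_sum n N h"
  unfolding pair_sum_def using assms by (intro sum.cong refl arg_cong2[where f = "(*)"]) auto

lemma pair_sum_nonneg: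
  fixes g :: "nat \<Rightarrow> nat \<Rightarrow> real"
  assumes "\<And>k l. l < k \<Longrightarrow> k < N \<Longrightarrow> 0 \<le> g k l"
  shows "0 \<le> pair_sum n N g"
  unfolding pair_sum_def using assms by (intro sum_nonneg mult_nonneg_nonneg) auto

lemma ennreal_pair_sum:
  assumes "\<And>k l. l < k \<Longrightarrow> k < N \<Longrightarrow> 0 \<le> g k l"
  shows "pair_sum n N (\<lambda>k l. ennreal (g k l)) = ennreal (pair_sum n N g)"
proof -
  have "pair_sum n N (\<lambda>k l. ennreal (g k l)) =
      (\<Sum>k<N. \<Sum>l<k. ennreal (of_nat (pair_exponent n k l) * g k l))"
    by (simp add: pair_sum_def ennreal_mult' ennreal_of_nat_eq_real_of_nat)
  also have "\<dots> = (\<Sum>k<N. ennreal (\<Sum>l<k. of_nat (pair_exponent n k l) * g k l))"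
    using assms by (intro sum.cong refl sum_ennreal) auto
  also have "\<dots> = ennreal (pair_sum n N g)"
    unfolding pair_sum_def using assms by (intro sum_ennreal sum_nonneg) auto
  finally show ?thesis .
qed

lemma borel_measurable_pair_sum:
  fixes g :: "nat \<Rightarrow> nat \<Rightarrow> 'b \<Rightarrow> ennreal"
  assumes "\<And>k l. l < k \<Longrightarrow> k < N \<Longrightarrow> g k l \<in> borel_measurable M"
  shows "(\<lambda>w. pair_sum n N (\<lambda>k l. g k l w)) \<in> borel_measurable M"
  unfolding pair_sum_def using assms
  by (intro borel_measurable_sum borel_measurable_times_ennreal) auto

lemma nn_integral_pair_sum:
  assumes "\<And>k l. l < k \<Longrightarrow> k < N \<Longrightarrow> g k l \<in> borel_measurable M"
  shows "(\<integral>\<^sup>+w. pair_sum n N (\<lambda>k l. g k l w) \<partial>M) = pair_sum n N (\<lambda>k l. \<integral>\<^sup>+w. g k l w \<partial>M)"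
proof -
  have "(\<integral>\<^sup>+w. pair_sum n N (\<lambda>k l. g k l w) \<partial>M) =
      (\<Sum>k<N. \<integral>\<^sup>+w. (\<Sum>l<k. of_nat (pair_exponent n k l) * g k l w) \<partial>M)"
    unfolding pair_sum_def using assms
    by (intro nn_integral_sum borel_measurable_sum borel_measurable_times_ennreal) auto
  also have "\<dots> = (\<Sum>k<N. \<Sum>l<k. \<integral>\<^sup>+w. of_nat (pair_exponent n k l) * g k l w \<partial>M)"
    using assms by (intro sum.cong refl nn_integral_sum borel_measurable_times_ennreal) auto
  also have "\<dots> = pair_sum n N (\<lambda>k l. \<integral>\<^sup>+w. g k l w \<partial>M)"
    unfolding pair_sum_def using assms by (intro sum.cong refl nn_integral_cmult) auto
  finally show ?thesis .
qed

text \<open>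
  This identity links the discrete energy, a sum over pairs of different coordinates, to the window
  energy of the counting measures: expanding the form produces all pairs, and the diagonal ones are split
  off.  The induction is over the number \<open>M\<close> of coordinates taken into account.
\<close>

lemma interaction_form_block_sums:
  "interaction_form p (\<lambda>i. \<Sum>k<multi_size p n. if block_of n k = i then y k else 0) =
     pair_sum n (multi_size p n) (\<lambda>k l. y k * y l) + (\<Sum>k<multi_size p n. (y k)\<^sup>2)"
proof -
  have "M \<le> multi_size p n \<Longrightarrow>
    (\<Sum>i<p. (\<Sum>k<M. if block_of n k = i then y k else 0)\<^sup>2) + (\<Sum>k<M. y k)\<^sup>2
      = 2 * (pair_sum n M (\<lambda>k l. y k * y l) + (\<Sum>k<M. (y k)\<^sup>2))" for M
  proof (induction M)
    case (Suc M)
    define i where "i = block_of n M"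
    have i: "i < p" using less_sum_block_of(2)[of M p n] Suc.prems by (simp add: i_def)
    define s where "s = (\<lambda>i. \<Sum>k<M. if block_of n k = i then y k else 0)"
    have "(\<Sum>j<p. (\<Sum>k<Suc M. if block_of n k = j then y k else 0)\<^sup>2) =
      (\<Sum>j<p. (s j)\<^sup>2 + (if j = i then 2 * s j * y M + (y M)\<^sup>2 else 0))"
      by (intro sum.cong) (auto simp: s_def i_def power2_sum)
    also have "\<dots> = (\<Sum>j<p. (s j)\<^sup>2) + (2 * s i * y M + (y M)\<^sup>2)"
      using i by (simp add: sum.distrib)
    finally have 1: "(\<Sum>j<p. (\<Sum>k<Suc M. if block_of n k = j then y k else 0)\<^sup>2) =
      (\<Sum>j<p. (s j)\<^sup>2) + (2 * s i * y M + (y M)\<^sup>2)" .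
    have "(\<Sum>l<M. real (pair_exponent n M l) * (y M * y l)) =
      (\<Sum>l<M. y M * y l + y M * (if block_of n l = i then y l else 0))"
      by (intro sum.cong) (auto simp: pair_exponent_def i_def)
    also have "\<dots> = y M * (\<Sum>l<M. y l) + y M * s i"
      by (simp add: sum.distrib s_def flip: sum_distrib_left)
    finally have 2: "(\<Sum>l<M. real (pair_exponent n M l) * (y M * y l)) = y M * (\<Sum>l<M. y l) + y M * s i" .
    define Y where "Y = (\<Sum>l<M. y l)"
    define Q where "Q = pair_sum n M (\<lambda>k l. y k * y l)"
    define R where "R = (\<Sum>k<M. (y k)\<^sup>2)"
    have "(\<Sum>j<p. (s j)\<^sup>2) + Y\<^sup>2 = 2 * (Q + R)"
      using Suc unfolding s_def Y_def Q_def R_def by simp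
    moreover have "pair_sum n (Suc M) (\<lambda>k l. y k * y l) = Q + (y M * Y + y M * s i)"
      unfolding pair_sum_def sum.lessThan_Suc 2 Q_def Y_def ..
    ultimately show ?case unfolding 1
      by (simp add: Y_def[symmetric] R_def[symmetric] power2_sum algebra_simps)
  qed (simp add: pair_sum_def)
  from this[of "multi_size p n"] sum.swap show ?thesis
  proof -
    have "(\<Sum>i<p. \<Sum>k<multi_size p n. if block_of n k = i then y k else 0) =
      (\<Sum>k<multi_size p n. \<Sum>i<p. if block_of n k = i then y k else 0)" by (rule sum.swap)
    also have "\<dots> = (\<Sum>k<multi_size p n. y k)"
      using less_sum_block_of(2) by (intro sum.cong) auto
    finally show ?thesis
      using \<open>multi_size p n \<le> multi_size p n \<Longrightarrow> _\<close> by (simp add: interaction_form_eq)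
  qed
qed

context angelesco_system
begin

text \<open>
  The vectors that have each coordinate in the interval of its block.
\<close>

definition configurations :: "(nat \<Rightarrow> nat) \<Rightarrow> (nat \<Rightarrow> real) set" where
  "configurations n = (\<Pi>\<^sub>E k\<in>{..<multi_size p n}. \<Gamma> (block_of n k))"

definition discrete_energy :: "(nat \<Rightarrow> nat) \<Rightarrow> (nat \<Rightarrow> real) \<Rightarrow> ennreal" where
  "discrete_energy n X =
     pair_sum n (multi_size p n) (\<lambda>k l. window_kernel T (X k) (X l))"

text \<open>
  The logarithm of the weight of a hypothetical configuration of discrete energy zero: each factor
  \<open>ln |x - y|\<close> is \<open>ln T + 1\<close> minus the window kernel.  This quantity cancels in the quotient of
  weight and partition function.
\<close>

definition weight_bound :: "(nat \<Rightarrow> nat) \<Rightarrow> real" where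
  "weight_bound n = pair_sum n (multi_size p n) (\<lambda>_ _. ln T + 1)"

lemma multi_size_pos:
  assumes "\<And>i. i < p \<Longrightarrow> n i > 0"
  shows "multi_size p n > 0"
proof -
  have "n 0 \<le> multi_size p n" unfolding multi_size_def using p_pos by (intro member_le_sum) auto
  thus ?thesis using assms[of 0] p_pos by simp
qed

lemma configurationsD:
  assumes "X \<in> configurations n" "k < multi_size p n"
  shows "block_of n k < p" "X k \<in> \<Gamma> (block_of n k)"
  using assms less_sum_block_of(2) by (auto simp: configurations_def PiE_iff)

lemma configurations_distance:
  assumes "X \<in> configurations n" "k < multi_size p n" "l < multi_size p n"
  shows "\<bar>X k - X l\<bar> \<le> T"
  using diameter configurationsD[OF assms(1,2)] configurationsD[OF assms(1,3)] by blast

text \<open>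
  Differences inside a block are squared, and across blocks the later coordinate is the larger one.
\<close>

lemma pair_power_eq:
  assumes "X \<in> configurations n" "k < multi_size p n" "l < k"
  shows "(X k - X l) ^ pair_exponent n k l = \<bar>X k - X l\<bar> ^ pair_exponent n k l"
proof (cases "block_of n k = block_of n l")
  case False
  hence "block_of n l < block_of n k" using block_of_mono[of l k p n] assms by simp
  hence "X l < X k"
    using blocks_ordered[of "block_of n l" "block_of n k"]
      configurationsD[OF assms(1), of l] configurationsD[OF assms(1), of k] assms by fastforce
  thus ?thesis by simp
qed (simp add: pair_exponent_def)

lemma angelesco_weight_abs_pairs:
  assumes "X \<in> configurations n"
  shows "angelesco_weight p n X =
    (\<Prod>k<multi_size p n. \<Prod>l<k. \<bar>X k - X l\<bar> ^ pair_exponent n k l)"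
  unfolding angelesco_weight_pairs using assms
  by (intro prod.cong refl pair_power_eq) auto

lemma angelesco_weight_nonneg: "X \<in> configurations n \<Longrightarrow> angelesco_weight p n X \<ge> 0"
  unfolding angelesco_weight_abs_pairs by (intro prod_nonneg) auto

text \<open>
  Either two coordinates coincide, or the weight is the exponential of \<open>weight_bound\<close> minus the
  discrete energy.
\<close>

lemma discrete_energy_cases:
  assumes X: "X \<in> configurations n"
  obtains "discrete_energy n X = \<infinity>" "angelesco_weight p n X = 0"
  | h where "h \<ge> 0" "discrete_energy n X = ennreal h" "angelesco_weight p n X = exp (weight_bound n - h)"
proof (cases "\<exists>k<multi_size p n. \<exists>l<k. X k = X l")
  case True
  then obtain k l where kl: "k < multi_size p n" "l < k" "X k = X l" by auto
  have "angelesco_weight p n X = 0"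
    unfolding angelesco_weight_pairs using kl
    by (intro prod_zero bexI[of _ k] bexI[of _ l]) (auto simp: pair_exponent_def)
  moreover have "discrete_energy n X = \<infinity>"
  proof -
    let ?t = "\<lambda>k l. of_nat (pair_exponent n k l) * window_kernel T (X k) (X l)"
    have "\<infinity> = ?t k l"
      using kl T_pos by (simp add: window_kernel_diag pair_exponent_def ennreal_mult_top)
    also have "\<dots> \<le> (\<Sum>l<k. ?t k l)"
      by (rule member_le_sum) (use kl in auto)
    also have "\<dots> \<le> discrete_energy n X" unfolding discrete_energy_def pair_sum_def
      by (rule member_le_sum[of k _ "\<lambda>k. \<Sum>l<k. ?t k l"]) (use kl in auto)
    finally show ?thesis by (simp add: top_unique)
  qed
  ultimately show ?thesis using that by blast
next
  case False
  define c where "c = ln T + 1"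
  define h where "h = pair_sum n (multi_size p n) (\<lambda>k l. c - ln \<bar>X k - X l\<bar>)"
  have d: "\<bar>X k - X l\<bar> > 0" "\<bar>X k - X l\<bar> \<le> T" "c - ln \<bar>X k - X l\<bar> \<ge> 0"
    if "l < k" "k < multi_size p n" for k l
  proof -
    show 1: "\<bar>X k - X l\<bar> > 0" using False that by fastforce
    show 2: "\<bar>X k - X l\<bar> \<le> T" using configurations_distance[OF X] that by simp
    have "ln \<bar>X k - X l\<bar> \<le> ln T" using 1 2 T_pos by (subst ln_le_cancel_iff)
    thus "c - ln \<bar>X k - X l\<bar> \<ge> 0" by (simp add: c_def)
  qed
  have "h \<ge> 0" unfolding h_def by (rule pair_sum_nonneg) (rule d)
  moreover have "discrete_energy n X = ennreal h"
  proof -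
    have "discrete_energy n X = pair_sum n (multi_size p n) (\<lambda>k l. ennreal (c - ln \<bar>X k - X l\<bar>))"
      unfolding discrete_energy_def
    proof (rule pair_sum_cong)
      fix k l assume kl: "l < k" "k < multi_size p n"
      have "window_kernel T (X k) (X l) = ennreal (ln (T / \<bar>X k - X l\<bar>) + 1)"
        using d[OF kl] by (intro window_kernel_eq) auto
      also have "ln (T / \<bar>X k - X l\<bar>) + 1 = c - ln \<bar>X k - X l\<bar>"
        using d[OF kl] T_pos by (simp add: ln_div c_def)
      finally show "window_kernel T (X k) (X l) = ennreal (c - ln \<bar>X k - X l\<bar>)" .
    qed
    also have "\<dots> = ennreal h" unfolding h_def by (rule ennreal_pair_sum) (rule d)
    finally show ?thesis .
  qed
  moreover have "angelesco_weight p n X = exp (weight_bound n - h)"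
  proof -
    have "weight_bound n - h = (\<Sum>k<multi_size p n. \<Sum>l<k. real (pair_exponent n k l) * ln \<bar>X k - X l\<bar>)"
      unfolding weight_bound_def h_def c_def[symmetric] pair_sum_def
      by (simp add: right_diff_distrib sum_subtractf)
    also have "exp \<dots> = (\<Prod>k<multi_size p n. \<Prod>l<k. \<bar>X k - X l\<bar> ^ pair_exponent n k l)"
      using d by (simp add: exp_sum exp_of_nat_mult)
    finally show ?thesis using angelesco_weight_abs_pairs[OF X] by simp
  qed
  ultimately show ?thesis using that by blast
qed

lemma angelesco_weight_le:
  assumes "X \<in> configurations n" "discrete_energy n X \<ge> ennreal h"
  shows "angelesco_weight p n X \<le> exp (weight_bound n - h)"
  using assms(1)
proof (cases rule: discrete_energy_cases)
  case (2 h')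
  thus ?thesis using assms(2) by (simp add: ennreal_le_iff)
qed simp

lemma angelesco_weight_ge:
  assumes "X \<in> configurations n" "discrete_energy n X \<le> ennreal h" "h \<ge> 0"
  shows "angelesco_weight p n X \<ge> exp (weight_bound n - h)"
  using assms(1)
proof (cases rule: discrete_energy_cases)
  case 1 thus ?thesis using assms(2) by (simp add: top_unique)
next
  case (2 h')
  thus ?thesis using assms(2,3) by (simp add: ennreal_le_iff)
qed

end

section \<open>Configurations of low energy\<close>

context angelesco_system
begin

lemma discrete_energy_measurable:
  assumes "\<And>k. k < multi_size p n \<Longrightarrow> sets (M k) = sets borel"
  shows "discrete_energy n \<in> borel_measurable (Pi\<^sub>M {..<multi_size p n} M)"
proof -
  have [measurable]: "(\<lambda>X. X k) \<in> borel_measurable (Pi\<^sub>M {..<multi_size p n} M)" if "k < multi_size p n" for k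
  proof -
    have "(\<lambda>X. X k) \<in> Pi\<^sub>M {..<multi_size p n} M \<rightarrow>\<^sub>M M k"
      by (rule measurable_component_singleton) (use that in simp)
    thus ?thesis by (simp only: measurable_cong_sets[OF refl assms[OF that]])
  qed
  have "(\<lambda>X. window_kernel T (X k) (X l)) \<in> borel_measurable (Pi\<^sub>M {..<multi_size p n} M)"
    if "k < multi_size p n" "l < multi_size p n" for k l
  proof -
    have "(\<lambda>X. (X k, X l)) \<in> Pi\<^sub>M {..<multi_size p n} M \<rightarrow>\<^sub>M borel \<Otimes>\<^sub>M borel"
      using that by measurable
    from measurable_compose[OF this window_kernel_measurable[of T]] show ?thesis by simp
  qed
  thus ?thesis unfolding discrete_energy_def by (intro borel_measurable_pair_sum) auto
qed

text \<open>
  Choose the coordinates independently, those of block \<open>i\<close> with distribution \<open>\<mu> i / r i\<close>.  The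
  expected number of pairs in a window is at most the interaction form of the expected counts, which are
  bounded by \<open>s\<close> times the masses of \<open>\<mu>\<close>.  Some configuration does not exceed the average.
\<close>

lemma low_energy_configuration:
  assumes \<mu>: "admissible \<mu>" and fin: "energy \<mu> < \<infinity>"
    and s: "\<And>i. i < p \<Longrightarrow> real (n i) \<le> s * r i"
  shows "\<exists>X\<in>configurations n. discrete_energy n X \<le> ennreal (s\<^sup>2) * energy \<mu>"
proof -
  define N where "N = multi_size p n"
  define \<rho> where "\<rho> = (\<lambda>k. if k < N then scale_measure (ennreal (1 / r (block_of n k))) (\<mu> (block_of n k))
     else return borel 0)"
  have blk: "block_of n k < p" if "k < N" for k using that less_sum_block_of(2) by (simp add: N_def)
  have sets_\<rho>: "sets (\<rho> k) = sets borel" for k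
    using admissibleD(3)[OF \<mu> blk] by (simp add: \<rho>_def)
  have em: "emeasure (\<rho> k) B = ennreal (measure (\<mu> (block_of n k)) B / r (block_of n k))"
    if k: "k < N" and B: "B \<in> sets borel" for k B
  proof -
    interpret finite_measure "\<mu> (block_of n k)" by (rule admissibleD(2)[OF \<mu> blk[OF k]])
    show ?thesis using k B admissibleD(3)[OF \<mu> blk[OF k]] r_pos[OF blk[OF k]]
      by (simp add: \<rho>_def emeasure_eq_measure flip: ennreal_mult)
  qed
  have prob: "prob_space (\<rho> k)" for k
  proof (cases "k < N")
    case True
    show ?thesis
      by (rule prob_spaceI)
         (use em[OF True, of UNIV] admissibleD(5)[OF \<mu> blk[OF True]] r_pos[OF blk[OF True]]
          in \<open>simp add: sets_eq_imp_space_eq[OF sets_\<rho>]\<close>)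
  qed (simp add: \<rho>_def prob_space_return)
  interpret product_prob_space \<rho> "{..<N}" by (intro product_prob_spaceI prob)
  define Q where "Q = Pi\<^sub>M {..<N} \<rho>"
  interpret Q: prob_space Q unfolding Q_def by (rule prob_space_PiM) (rule prob)
  interpret W: sigma_finite_measure "window_measure T" by (rule sigma_finite_window_measure)
  interpret QW: pair_sigma_finite Q "window_measure T" ..
  have comp [measurable]: "(\<lambda>X. X k) \<in> borel_measurable Q" if "k < N" for k
  proof -
    have "(\<lambda>X. X k) \<in> Q \<rightarrow>\<^sub>M \<rho> k"
      unfolding Q_def by (rule measurable_component_singleton) (use that in simp)
    thus ?thesis by (simp only: measurable_cong_sets[OF refl sets_\<rho>])
  qed
  define e where "e = (\<lambda>k w. measure (\<mu> (block_of n k)) (window w) / r (block_of n k))"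
  have e_nonneg: "e k w \<ge> 0" if "k < N" for k w
    using r_pos[OF blk[OF that]] by (simp add: e_def)
  have kernel_avg: "(\<integral>\<^sup>+X. window_kernel T (X k) (X l) \<partial>Q) = (\<integral>\<^sup>+w. ennreal (e k w * e l w) \<partial>window_measure T)"
    if kl: "k < N" "l < N" "k \<noteq> l" for k l
  proof -
    have "(\<integral>\<^sup>+X. window_kernel T (X k) (X l) \<partial>Q) =
      (\<integral>\<^sup>+w. \<integral>\<^sup>+X. indicator (window w) (X k) * indicator (window w) (X l) \<partial>Q \<partial>window_measure T)"
      unfolding window_kernel_def using kl by (intro QW.Fubini'[symmetric]) measurable
    also have "\<dots> = (\<integral>\<^sup>+w. ennreal (e k w * e l w) \<partial>window_measure T)"
    proof (rule nn_integral_cong)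
      fix w :: "real \<times> real"
      have "(\<integral>\<^sup>+X. indicator (window w) (X k) * indicator (window w) (X l) \<partial>Q) =
        (\<integral>\<^sup>+X. indicator {X \<in> space Q. \<forall>i\<in>{k, l}. X i \<in> window w} X \<partial>Q)"
        by (intro nn_integral_cong) (auto simp: indicator_def)
      also have "\<dots> = emeasure Q {X \<in> space Q. \<forall>i\<in>{k, l}. X i \<in> window w}"
        using kl by (intro nn_integral_indicator) auto
      also have "\<dots> = (\<Prod>i\<in>{k, l}. emeasure (\<rho> i) (window w))"
        unfolding Q_def using kl by (intro emeasure_PiM_Collect) (auto simp: sets_\<rho>)
      also have "\<dots> = ennreal (e k w * e l w)"
        using kl e_nonneg[OF kl(1)] e_nonneg[OF kl(2)]
        by (subst ennreal_mult) (auto simp: em e_def)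
      finally show "(\<integral>\<^sup>+X. indicator (window w) (X k) * indicator (window w) (X l) \<partial>Q) = ennreal (e k w * e l w)" .
    qed
    finally show ?thesis .
  qed
  have e_meas [measurable]: "e k \<in> borel_measurable (window_measure T)" if "k < N" for k
    unfolding e_def using admissibleD(2,3)[OF \<mu> blk[OF that]]
    by (intro borel_measurable_divide window_measure_measurable measure_window_measurable) auto
  have kernel_meas [measurable]: "(\<lambda>X. window_kernel T (X k) (X l)) \<in> borel_measurable Q" if "k < N" "l < N" for k l
  proof -
    have "(\<lambda>X. (X k, X l)) \<in> Q \<rightarrow>\<^sub>M borel \<Otimes>\<^sub>M borel" using that by measurable
    from measurable_compose[OF this window_kernel_measurable[of T]] show ?thesis by simp
  qed
  have "(\<integral>\<^sup>+X. discrete_energy n X \<partial>Q) = pair_sum n N (\<lambda>k l. \<integral>\<^sup>+X. window_kernel T (X k) (X l) \<partial>Q)"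
    unfolding discrete_energy_def N_def[symmetric] by (rule nn_integral_pair_sum) simp
  also have "\<dots> = pair_sum n N (\<lambda>k l. \<integral>\<^sup>+w. ennreal (e k w * e l w) \<partial>window_measure T)"
    by (rule pair_sum_cong) (simp add: kernel_avg)
  also have "\<dots> = (\<integral>\<^sup>+w. pair_sum n N (\<lambda>k l. ennreal (e k w * e l w)) \<partial>window_measure T)"
    by (rule nn_integral_pair_sum[symmetric]) simp
  also have "\<dots> \<le> (\<integral>\<^sup>+w. ennreal (s\<^sup>2) * ennreal (form (\<lambda>i. measure (\<mu> i) (window w))) \<partial>window_measure T)"
  proof (rule nn_integral_mono)
    fix w
    have "pair_sum n N (\<lambda>k l. ennreal (e k w * e l w)) = ennreal (pair_sum n N (\<lambda>k l. e k w * e l w))"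
      using e_nonneg by (intro ennreal_pair_sum mult_nonneg_nonneg) auto
    also have "\<dots> \<le> ennreal (s\<^sup>2 * form (\<lambda>i. measure (\<mu> i) (window w)))"
    proof (rule ennreal_leI)
      have "pair_sum n N (\<lambda>k l. e k w * e l w) \<le>
        form (\<lambda>i. \<Sum>k<N. if block_of n k = i then e k w else 0)"
        unfolding N_def interaction_form_block_sums by (simp add: sum_nonneg)
      also have "\<dots> \<le> form (\<lambda>i. s * measure (\<mu> i) (window w))"
      proof (rule interaction_form_mono)
        fix i assume i: "i < p"
        show "0 \<le> (\<Sum>k<N. if block_of n k = i then e k w else 0)"
          using e_nonneg by (intro sum_nonneg) auto
        have "(\<Sum>k<N. if block_of n k = i then e k w else 0) =
          (\<Sum>k<N. if block_of n k = i then measure (\<mu> i) (window w) / r i else 0)"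
          by (intro sum.cong) (auto simp: e_def)
        also have "\<dots> = real (n i) * (measure (\<mu> i) (window w) / r i)"
          unfolding N_def by (rule sum_block_of[OF i])
        also have "\<dots> \<le> (s * r i) * (measure (\<mu> i) (window w) / r i)"
          using s[OF i] r_pos[OF i] by (intro mult_right_mono) auto
        also have "\<dots> = s * measure (\<mu> i) (window w)" using r_pos[OF i] by simp
        finally show "(\<Sum>k<N. if block_of n k = i then e k w else 0) \<le> s * measure (\<mu> i) (window w)" .
      qed
      finally show "pair_sum n N (\<lambda>k l. e k w * e l w) \<le>
        s\<^sup>2 * form (\<lambda>i. measure (\<mu> i) (window w))" by (simp add: interaction_form_scale)
    qed
    finally show "pair_sum n N (\<lambda>k l. ennreal (e k w * e l w)) \<le>
      ennreal (s\<^sup>2) * ennreal (form (\<lambda>i. measure (\<mu> i) (window w)))"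
      by (simp add: ennreal_mult')
  qed
  also have "\<dots> = ennreal (s\<^sup>2) * energy \<mu>"
    unfolding window_energy_def
    using energy_integrand_measurable[of \<mu>] admissibleD[OF \<mu>]
    by (intro nn_integral_cmult measurable_compose[OF window_measure_measurable measurable_ennreal]) auto
  finally have avg: "(\<integral>\<^sup>+X. discrete_energy n X \<partial>Q) \<le> ennreal (s\<^sup>2) * energy \<mu>" .
  define B where "B = ennreal (s\<^sup>2) * energy \<mu>"
  have B: "B < \<infinity>" using fin by (simp add: B_def ennreal_mult_less_top)
  have [measurable]: "discrete_energy n \<in> borel_measurable Q"
    unfolding Q_def N_def by (rule discrete_energy_measurable) (simp add: sets_\<rho>)
  have supp: "AE X in Q. X \<in> configurations n"
  proof -
    have "AE X in Q. \<forall>k\<in>{..<N}. X k \<in> \<Gamma> (block_of n k)"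
      unfolding Q_def
    proof (intro AE_finite_allI AE_PiM_component prob)
      fix k assume k: "k \<in> {..<N}"
      hence "emeasure (\<rho> k) (- \<Gamma> (block_of n k)) = 0"
        using admissibleD(1)[OF \<mu> blk[of k]] by (simp add: \<rho>_def finite_borel_measure_on_def)
      thus "AE x in \<rho> k. x \<in> \<Gamma> (block_of n k)"
        by (intro AE_I'[of "- \<Gamma> (block_of n k)"]) (auto simp: null_sets_def sets_\<rho>)
    qed auto
    moreover have "AE X in Q. X \<in> space Q" by (rule AE_space)
    ultimately show ?thesis
      by eventually_elim (auto simp: configurations_def Q_def space_PiM PiE_iff N_def)
  qed
  have "\<exists>X\<in>configurations n. discrete_energy n X \<le> B"
  proof (rule ccontr)
    assume "\<not> (\<exists>X\<in>configurations n. discrete_energy n X \<le> B)"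
    with supp have less: "AE X in Q. B < discrete_energy n X"
      by (auto elim!: eventually_mono simp: not_le)
    have "(\<integral>\<^sup>+X. B \<partial>Q) < (\<integral>\<^sup>+X. discrete_energy n X \<partial>Q)"
    proof (rule nn_integral_less)
      show "(\<integral>\<^sup>+X. B \<partial>Q) \<noteq> \<infinity>" using B by (simp add: Q.emeasure_space_1)
      show "AE X in Q. B \<le> discrete_energy n X" using less by (auto elim!: eventually_mono)
      show "\<not> (AE X in Q. discrete_energy n X \<le> B)"
      proof
        assume "AE X in Q. discrete_energy n X \<le> B"
        with less have "AE X in Q. False" by eventually_elim simp
        thus False by (simp add: Q.AE_const Q.not_empty)
      qed
    qed auto
    thus False using avg by (simp add: Q.emeasure_space_1 B_def[symmetric])
  qed
  thus ?thesis by (simp add: B_def)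
qed

end

section \<open>The Bernstein--Markov inequality in several variables\<close>

text \<open>
  The Bernstein--Markov inequality speaks about complex polynomials, so real functions are represented by
  complex polynomials that extend them.
\<close>

definition real_poly_map :: "nat \<Rightarrow> (real \<Rightarrow> real) \<Rightarrow> bool" where
  "real_poly_map D f \<longleftrightarrow> (\<exists>q :: complex poly. degree q \<le> D \<and> (\<forall>t. poly q (of_real t) = of_real (f t)))"

lemma real_poly_map_const: "real_poly_map 0 (\<lambda>_. c)"
  unfolding real_poly_map_def by (rule exI[of _ "[:of_real c:]"]) simp

lemma real_poly_map_affine:
  assumes "f = (\<lambda>t. c + t * d)"
  shows "real_poly_map 1 f"
  unfolding real_poly_map_def assms
  by (rule exI[of _ "[:of_real c, of_real d:]"]) (simp add: degree_pCons_le[THEN order_trans])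

lemma real_poly_map_mult:
  assumes "real_poly_map D f" "real_poly_map E g"
  shows "real_poly_map (D + E) (\<lambda>t. f t * g t)"
proof -
  from assms obtain q q' :: "complex poly" where "degree q \<le> D" "\<And>t. poly q (of_real t) = of_real (f t)"
    "degree q' \<le> E" "\<And>t. poly q' (of_real t) = of_real (g t)" unfolding real_poly_map_def by blast
  thus ?thesis unfolding real_poly_map_def
    by (intro exI[of _ "q * q'"]) (auto intro: order.trans[OF degree_mult_le] add_mono)
qed

lemma real_poly_map_prod:
  assumes "finite A" "\<And>k. k \<in> A \<Longrightarrow> real_poly_map (D k) (f k)"
  shows "real_poly_map (sum D A) (\<lambda>t. \<Prod>k\<in>A. f k t)"
  using assms by (induction A) (auto intro: real_poly_map_const real_poly_map_mult)

lemma real_poly_map_power: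
  assumes "real_poly_map D f"
  shows "real_poly_map (m * D) (\<lambda>t. f t ^ m)"
  by (induction m) (use assms in \<open>auto intro: real_poly_map_const real_poly_map_mult\<close>)

lemma BM_inequality_real:
  assumes BM: "BM_inequality {a..b} \<tau>" and \<tau>: "finite_borel_measure_on {a..b} \<tau>" and \<epsilon>: "\<epsilon> > 0"
  obtains C where "C > 0" "\<And>D f x. real_poly_map D f \<Longrightarrow> x \<in> {a..b} \<Longrightarrow>
    ennreal \<bar>f x\<bar> \<le> ennreal (C * (1 + \<epsilon>) ^ D) * (\<integral>\<^sup>+t. ennreal \<bar>f t\<bar> \<partial>\<tau>)"
proof -
  obtain C where C: "C > 0" and le: "\<And>q :: complex poly. (SUP x\<in>{a..b}. cmod (poly q (of_real x)))
          \<le> C * (1 + \<epsilon>) ^ degree q * (LINT x:{a..b}|\<tau>. cmod (poly q (of_real x)))"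
    using BM \<epsilon> unfolding BM_inequality_def by blast
  interpret finite_measure \<tau> using \<tau> by (simp add: finite_borel_measure_on_def)
  have sets: "sets \<tau> = sets borel" using \<tau> by (simp add: finite_borel_measure_on_def)
  note [measurable_cong] = sets
  have AE: "AE x in \<tau>. x \<in> {a..b}" by (rule AE_finite_borel_measure_on[OF \<tau>]) simp
  have "ennreal \<bar>f x\<bar> \<le> ennreal (C * (1 + \<epsilon>) ^ D) * (\<integral>\<^sup>+t. ennreal \<bar>f t\<bar> \<partial>\<tau>)"
    if f: "real_poly_map D f" and x: "x \<in> {a..b}" for D f x
  proof -
    obtain q :: "complex poly" where q: "degree q \<le> D" "\<And>t. poly q (of_real t) = of_real (f t)"
      using f unfolding real_poly_map_def by blast
    have f_eq: "f = (\<lambda>t. Re (poly q (of_real t)))" by (simp add: q fun_eq_iff)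
    have cont: "continuous_on UNIV f" unfolding f_eq by (intro continuous_intros)
    hence [measurable]: "f \<in> borel_measurable borel" by (rule borel_measurable_continuous_onI)
    have "compact ((\<lambda>t. \<bar>f t\<bar>) ` {a..b})"
      by (intro compact_continuous_image continuous_intros continuous_on_subset[OF cont]) auto
    hence bdd: "bdd_above ((\<lambda>t. \<bar>f t\<bar>) ` {a..b})" by (intro bounded_imp_bdd_above compact_imp_bounded)
    then obtain K where "\<forall>y\<in>(\<lambda>t. \<bar>f t\<bar>) ` {a..b}. y \<le> K" unfolding bdd_above_def by blast
    hence K: "\<And>t. t \<in> {a..b} \<Longrightarrow> \<bar>f t\<bar> \<le> K" by blast
    have int: "integrable \<tau> (\<lambda>t. indicator {a..b} t * \<bar>f t\<bar>)"
    proof (rule integrable_const_bound[where B = "max K 0"])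
      show "AE t in \<tau>. norm (indicator {a..b} t * \<bar>f t\<bar>) \<le> max K 0"
        using K by (intro always_eventually) (auto simp: indicator_def max.coboundedI1)
    qed measurable
    have "\<bar>f x\<bar> \<le> (SUP t\<in>{a..b}. \<bar>f t\<bar>)" by (rule cSUP_upper[OF x bdd])
    also have "\<dots> \<le> C * (1 + \<epsilon>) ^ degree q * (LINT t:{a..b}|\<tau>. \<bar>f t\<bar>)"
      using le[of q] by (simp add: q)
    also have "\<dots> \<le> C * (1 + \<epsilon>) ^ D * (LINT t:{a..b}|\<tau>. \<bar>f t\<bar>)"
      using C \<epsilon> q(1) unfolding set_lebesgue_integral_def
      by (intro mult_right_mono mult_left_mono power_increasing integral_nonneg_AE) auto
    finally have "ennreal \<bar>f x\<bar> \<le> ennreal (C * (1 + \<epsilon>) ^ D) * ennreal (LINT t:{a..b}|\<tau>. \<bar>f t\<bar>)"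
      using C \<epsilon> by (subst ennreal_mult''[symmetric])
        (auto intro!: ennreal_leI integral_nonneg_AE simp: set_lebesgue_integral_def)
    also have "ennreal (LINT t:{a..b}|\<tau>. \<bar>f t\<bar>) = (\<integral>\<^sup>+t. ennreal (indicator {a..b} t * \<bar>f t\<bar>) \<partial>\<tau>)"
      unfolding set_lebesgue_integral_def
      by (subst nn_integral_eq_integral[OF int]) auto
    also have "\<dots> = (\<integral>\<^sup>+t. ennreal \<bar>f t\<bar> \<partial>\<tau>)"
      by (intro nn_integral_cong_AE eventually_mono[OF AE]) auto
    finally show ?thesis .
  qed
  thus ?thesis using C that by blast
qed

text \<open>
  A one-dimensional inequality between supremum and integral is iterated: freeze the coordinate \<open>i\<close>, bound
  the resulting function of the other coordinates by its integral, and bound the integrand in \<open>i\<close>.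
\<close>

lemma (in product_sigma_finite) coordinatewise_sup_bound:
  fixes f :: "('i \<Rightarrow> 'a) \<Rightarrow> ennreal"
  assumes "finite J" "f \<in> borel_measurable (Pi\<^sub>M J M)" "X \<in> Pi\<^sub>E J K"
    and K: "\<And>i. i \<in> J \<Longrightarrow> K i \<subseteq> space (M i)"
    and step: "\<And>i Y x. i \<in> J \<Longrightarrow> x \<in> K i \<Longrightarrow> f (Y(i := x)) \<le> c * (\<integral>\<^sup>+t. f (Y(i := t)) \<partial>M i)"
  shows "f X \<le> c ^ card J * (\<integral>\<^sup>+Y. f Y \<partial>Pi\<^sub>M J M)"
  using assms
proof (induction J arbitrary: f X rule: finite_induct)
  case empty
  thus ?case by (simp add: nn_integral_empty)
next
  case (insert i J f X)
  note [measurable] = insert.prems(1)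
  have Xi: "X i \<in> K i" "X i \<in> space (M i)" using insert.prems(2) insert.prems(3)[of i] by (auto simp: PiE_iff)
  have upd: "(\<lambda>Y. Y(i := x)) \<in> Pi\<^sub>M J M \<rightarrow>\<^sub>M Pi\<^sub>M (insert i J) M" if "x \<in> space (M i)" for x
    using that by (intro measurable_fun_upd[where J = J]) auto
  have meas: "(\<lambda>Y. f (Y(i := x))) \<in> borel_measurable (Pi\<^sub>M J M)" if "x \<in> space (M i)" for x
    by (rule measurable_compose[OF upd[OF that] insert.prems(1)])
  have "f X = f ((restrict X J)(i := X i))"
  proof -
    have "X = (restrict X J)(i := X i)"
      using insert.prems(2) by (auto simp: fun_eq_iff PiE_iff extensional_def)
    thus ?thesis by simp
  qed
  also have "\<dots> \<le> c ^ card J * (\<integral>\<^sup>+Y. f (Y(i := X i)) \<partial>Pi\<^sub>M J M)"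
  proof (rule insert.IH)
    show "(\<lambda>Y. f (Y(i := X i))) \<in> borel_measurable (Pi\<^sub>M J M)" by (rule meas[OF Xi(2)])
    show "restrict X J \<in> Pi\<^sub>E J K" using insert.prems(2) by (auto simp: PiE_iff)
    show "\<And>j. j \<in> J \<Longrightarrow> K j \<subseteq> space (M j)" using insert.prems(3) by auto
    fix j Y x assume j: "j \<in> J" and x: "x \<in> K j"
    hence "j \<noteq> i" using insert.hyps by auto
    hence twist: "Y(j := t, i := X i) = Y(i := X i, j := t)" for t by (rule fun_upd_twist)
    show "f (Y(j := x, i := X i)) \<le> c * (\<integral>\<^sup>+t. f (Y(j := t, i := X i)) \<partial>M j)"
      unfolding twist by (rule insert.prems(4)) (use j x in auto)
  qed
  also have "\<dots> \<le> c ^ card J * (\<integral>\<^sup>+Y. c * (\<integral>\<^sup>+t. f (Y(i := t)) \<partial>M i) \<partial>Pi\<^sub>M J M)"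
    using Xi by (intro mult_left_mono nn_integral_mono insert.prems(4)) auto
  also have "\<dots> = c ^ card (insert i J) * (\<integral>\<^sup>+Y. \<integral>\<^sup>+t. f (Y(i := t)) \<partial>M i \<partial>Pi\<^sub>M J M)"
  proof -
    have "(\<lambda>z. (fst z)(i := snd z)) \<in> Pi\<^sub>M J M \<Otimes>\<^sub>M M i \<rightarrow>\<^sub>M Pi\<^sub>M (insert i J) M"
      using measurable_add_dim by (simp add: case_prod_unfold)
    from measurable_compose[OF this insert.prems(1)]
    have [measurable]: "(\<lambda>z. f ((fst z)(i := snd z))) \<in> borel_measurable (Pi\<^sub>M J M \<Otimes>\<^sub>M M i)" .
    have "(\<lambda>Y. \<integral>\<^sup>+t. f (Y(i := t)) \<partial>M i) \<in> borel_measurable (Pi\<^sub>M J M)"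
      using sigma_finite_measure.borel_measurable_nn_integral_fst[OF sigma_finite_measures[of i]
          \<open>(\<lambda>z. f ((fst z)(i := snd z))) \<in> _\<close>] by simp
    thus ?thesis using insert.hyps by (simp add: nn_integral_cmult mult_ac)
  qed
  also have "(\<integral>\<^sup>+Y. \<integral>\<^sup>+t. f (Y(i := t)) \<partial>M i \<partial>Pi\<^sub>M J M) = (\<integral>\<^sup>+Y. f Y \<partial>Pi\<^sub>M (insert i J) M)"
    using insert.hyps insert.prems(1) by (intro product_nn_integral_insert[symmetric])
  finally show ?case .
qed

text \<open>
  A coordinate occurs in fewer than \<open>multi_size p n\<close> pairs, each of which contributes degree at most 2.
\<close>

lemma angelesco_weight_poly_map:
  assumes "i < multi_size p n"
  shows "real_poly_map (2 * multi_size p n) (\<lambda>t. angelesco_weight p n (Y(i := t)))"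
proof -
  define N where "N = multi_size p n"
  define D :: "nat \<Rightarrow> nat \<Rightarrow> nat" where "D = (\<lambda>k l. if k = i \<or> l = i then 2 else 0)"
  have D: "real_poly_map (D k l) (\<lambda>t. ((Y(i := t)) k - (Y(i := t)) l) ^ pair_exponent n k l)" if "l < k" for k l
  proof (cases "k = i \<or> l = i")
    case True
    have "real_poly_map 1 (\<lambda>t. (Y(i := t)) k - (Y(i := t)) l)"
    proof (cases "k = i")
      case True
      thus ?thesis using that by (intro real_poly_map_affine[of _ "- Y l" 1]) auto
    next
      case False
      thus ?thesis using that True by (intro real_poly_map_affine[of _ "Y k" "- 1"]) auto
    qed
    hence *: "real_poly_map (pair_exponent n k l * 1) (\<lambda>t. ((Y(i := t)) k - (Y(i := t)) l) ^ pair_exponent n k l)"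
      by (rule real_poly_map_power)
    have "pair_exponent n k l * 1 \<le> D k l" using True by (simp add: D_def pair_exponent_def)
    thus ?thesis using * unfolding real_poly_map_def by (meson order.trans)
  qed (use real_poly_map_const in \<open>auto simp: D_def\<close>)
  have "real_poly_map (\<Sum>k<N. \<Sum>l<k. D k l) (\<lambda>t. angelesco_weight p n (Y(i := t)))"
    unfolding angelesco_weight_pairs N_def[symmetric] by (intro real_poly_map_prod D) auto
  moreover have "(\<Sum>k<M. \<Sum>l<k. D k l) \<le> 2 * M \<and> (M \<le> i \<longrightarrow> (\<Sum>k<M. \<Sum>l<k. D k l) = 0)" for M
  proof (induction M)
    case (Suc M)
    consider "M < i" | "M = i" | "M > i" by linarith
    thus ?case
    proof cases
      case 1
      hence "(\<Sum>l<M. D M l) = 0" by (auto simp: D_def)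
      thus ?thesis using Suc by simp
    next
      case 2
      hence "(\<Sum>l<M. D M l) = 2 * M" by (simp add: D_def)
      thus ?thesis using Suc 2 by simp
    next
      case 3
      have "(\<Sum>l<M. D M l) = (\<Sum>l<M. if l = i then 2 else 0)" using 3 by (intro sum.cong) (auto simp: D_def)
      also have "\<dots> = 2" using 3 by simp
      finally show ?thesis using Suc 3 by simp
    qed
  qed simp
  ultimately show ?thesis unfolding N_def[symmetric] real_poly_map_def by (meson order.trans)
qed

context angelesco_system
begin

text \<open>
  Coordinates beyond the last one carry a Dirac mass, which makes every factor a finite measure.
\<close>

definition coord_measure :: "(nat \<Rightarrow> real measure) \<Rightarrow> (nat \<Rightarrow> nat) \<Rightarrow> nat \<Rightarrow> real measure" where
  "coord_measure \<tau> n k = (if k < multi_size p n then \<tau> (block_of n k) else return borel 0)"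

lemma tau_product_eq: "tau_product p \<tau> n = Pi\<^sub>M {..<multi_size p n} (coord_measure \<tau> n)"
  unfolding tau_product_def by (intro PiM_cong) (auto simp: coord_measure_def)

lemma coord_measure:
  assumes \<tau>: "\<And>i. i < p \<Longrightarrow> finite_borel_measure_on (\<Gamma> i) (\<tau> i)"
  shows "sets (coord_measure \<tau> n k) = sets borel" "finite_measure (coord_measure \<tau> n k)"
    "space (coord_measure \<tau> n k) = UNIV" "product_sigma_finite (coord_measure \<tau> n)"
proof -
  have s: "sets (coord_measure \<tau> n k) = sets borel" for k
    using \<tau>[OF less_sum_block_of(2)[of k p n]] by (auto simp: coord_measure_def finite_borel_measure_on_def)
  have f: "finite_measure (coord_measure \<tau> n k)" for k
    using \<tau>[OF less_sum_block_of(2)[of k p n]]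
    by (auto simp: coord_measure_def finite_borel_measure_on_def prob_space.finite_measure prob_space_return)
  show "sets (coord_measure \<tau> n k) = sets borel" by (rule s)
  show "finite_measure (coord_measure \<tau> n k)" by (rule f)
  show "space (coord_measure \<tau> n k) = UNIV" using sets_eq_imp_space_eq[OF s] by simp
  show "product_sigma_finite (coord_measure \<tau> n)"
    using f by (simp add: product_sigma_finite_def finite_measure.axioms(1))
qed

lemma sets_tau_product:
  assumes \<tau>: "\<And>i. i < p \<Longrightarrow> finite_borel_measure_on (\<Gamma> i) (\<tau> i)"
  shows "sets (tau_product p \<tau> n) = sets (real_vectors (multi_size p n))"
  unfolding tau_product_eq real_vectors_def
  by (intro sets_PiM_cong refl coord_measure(1)[OF \<tau>])

lemma angelesco_weight_measurable:
  "angelesco_weight p n \<in> borel_measurable (real_vectors (multi_size p n))"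
proof -
  have [measurable]: "(\<lambda>X. X k) \<in> borel_measurable (real_vectors (multi_size p n))"
    if "k < multi_size p n" for k
    unfolding real_vectors_def by (rule measurable_component_singleton) (use that in simp)
  have "(\<lambda>X. \<Prod>k<multi_size p n. \<Prod>l<k. (X k - X l) ^ pair_exponent n k l)
     \<in> borel_measurable (real_vectors (multi_size p n))"
    by (intro borel_measurable_prod borel_measurable_power borel_measurable_diff) auto
  thus ?thesis by (subst (asm) angelesco_weight_pairs[symmetric])
qed

lemma AE_tau_product:
  assumes \<tau>: "\<And>i. i < p \<Longrightarrow> finite_borel_measure_on (\<Gamma> i) (\<tau> i)"
  shows "AE X in tau_product p \<tau> n. X \<in> configurations n"
proof -
  define N where "N = multi_size p n"
  interpret product_sigma_finite "coord_measure \<tau> n" by (rule coord_measure(4)[OF \<tau>])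
  have "AE X in tau_product p \<tau> n. \<forall>k\<in>{..<N}. X k \<in> \<Gamma> (block_of n k)"
  proof (intro AE_finite_allI)
    fix k assume k: "k \<in> {..<N}"
      \<comment> \<open>The vectors whose \<open>k\<close>-th coordinate leaves its interval form a box with a factor of measure zero.\<close>
  define A where "A = (\<lambda>l. if l = k then - \<Gamma> (block_of n k) else UNIV)"
    have A: "A l \<in> sets (coord_measure \<tau> n l)" for l
      by (auto simp: A_def coord_measure(1)[OF \<tau>])
    have blk: "block_of n k < p" using k less_sum_block_of(2) by (simp add: N_def)
    have "emeasure (tau_product p \<tau> n) (Pi\<^sub>E {..<N} A) = (\<Prod>l<N. emeasure (coord_measure \<tau> n l) (A l))"
      unfolding tau_product_eq N_def[symmetric] using A by (intro emeasure_PiM) auto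
    also have "\<dots> = 0"
      using k \<tau>[OF blk] by (intro prod_zero bexI[of _ k])
        (auto simp: A_def coord_measure_def N_def finite_borel_measure_on_def)
    finally have "emeasure (tau_product p \<tau> n) (Pi\<^sub>E {..<N} A) = 0" .
    hence "Pi\<^sub>E {..<N} A \<in> null_sets (tau_product p \<tau> n)"
      using A by (auto simp: null_sets_def tau_product_eq N_def intro!: sets_PiM_I_finite)
    moreover have "{X \<in> space (tau_product p \<tau> n). X k \<notin> \<Gamma> (block_of n k)} \<subseteq> Pi\<^sub>E {..<N} A"
      by (auto simp: A_def tau_product_eq space_PiM N_def PiE_iff extensional_def)
    ultimately show "AE X in tau_product p \<tau> n. X k \<in> \<Gamma> (block_of n k)" by (rule AE_I')
  qed simp
  with AE_space[of "tau_product p \<tau> n"] show ?thesis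
    by eventually_elim (auto simp: configurations_def tau_product_eq space_PiM PiE_iff N_def)
qed

text \<open>
  The constant is uniform over the blocks because it exceeds the Bernstein--Markov constant of each.
\<close>

lemma angelesco_weight_sup_bound:
  assumes \<tau>: "\<And>i. i < p \<Longrightarrow> finite_borel_measure_on (\<Gamma> i) (\<tau> i)"
    and BM: "\<And>i. i < p \<Longrightarrow> BM_inequality (\<Gamma> i) (\<tau> i)" and \<epsilon>: "\<epsilon> > 0"
  obtains C where "C \<ge> 1" "\<And>n X. X \<in> configurations n \<Longrightarrow>
    ennreal \<bar>angelesco_weight p n X\<bar> \<le>
      ennreal ((C * (1 + \<epsilon>) ^ (2 * multi_size p n)) ^ multi_size p n) *
      (\<integral>\<^sup>+Y. ennreal \<bar>angelesco_weight p n Y\<bar> \<partial>tau_product p \<tau> n)"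
proof -
  have "\<exists>C. i < p \<longrightarrow> C > 0 \<and> (\<forall>D f x. real_poly_map D f \<longrightarrow> x \<in> \<Gamma> i \<longrightarrow>
    ennreal \<bar>f x\<bar> \<le> ennreal (C * (1 + \<epsilon>) ^ D) * (\<integral>\<^sup>+t. ennreal \<bar>f t\<bar> \<partial>\<tau> i))" for i
    using BM_inequality_real[OF BM \<tau> \<epsilon>, of i] by metis
  then obtain C0 where C0: "\<And>i. i < p \<Longrightarrow> C0 i > 0"
    "\<And>i D f x. i < p \<Longrightarrow> real_poly_map D f \<Longrightarrow> x \<in> \<Gamma> i \<Longrightarrow>
    ennreal \<bar>f x\<bar> \<le> ennreal (C0 i * (1 + \<epsilon>) ^ D) * (\<integral>\<^sup>+t. ennreal \<bar>f t\<bar> \<partial>\<tau> i)" by metis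
  define C where "C = 1 + (\<Sum>i<p. C0 i)"
  have C1: "C \<ge> 1" unfolding C_def using sum_nonneg[of "{..<p}" C0] C0(1) by (simp add: less_imp_le)
  have C0_le: "C0 i \<le> C" if "i < p" for i
  proof -
    have "C0 i \<le> (\<Sum>i<p. C0 i)" by (rule member_le_sum) (use that C0(1) in \<open>auto intro: less_imp_le\<close>)
    thus ?thesis by (simp add: C_def)
  qed
  have "ennreal \<bar>angelesco_weight p n X\<bar> \<le>
      ennreal ((C * (1 + \<epsilon>) ^ (2 * multi_size p n)) ^ multi_size p n) *
      (\<integral>\<^sup>+Y. ennreal \<bar>angelesco_weight p n Y\<bar> \<partial>tau_product p \<tau> n)" if X: "X \<in> configurations n" for n X
  proof -
    define N where "N = multi_size p n"
    define c where "c = C * (1 + \<epsilon>) ^ (2 * N)"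
    interpret product_sigma_finite "coord_measure \<tau> n" by (rule coord_measure(4)[OF \<tau>])
    have "ennreal \<bar>angelesco_weight p n X\<bar> \<le> ennreal c ^ card {..<N} *
      (\<integral>\<^sup>+Y. ennreal \<bar>angelesco_weight p n Y\<bar> \<partial>Pi\<^sub>M {..<N} (coord_measure \<tau> n))"
    proof (rule coordinatewise_sup_bound)
      show "(\<lambda>Y. ennreal \<bar>angelesco_weight p n Y\<bar>) \<in> borel_measurable (Pi\<^sub>M {..<N} (coord_measure \<tau> n))"
        using angelesco_weight_measurable[of n] sets_tau_product[OF \<tau>, of n]
        unfolding tau_product_eq N_def by (simp cong: measurable_cong_sets)
      show "X \<in> (\<Pi>\<^sub>E k\<in>{..<N}. \<Gamma> (block_of n k))" using X by (simp add: configurations_def N_def)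
      fix i Y x assume i: "i \<in> {..<N}" and x: "x \<in> \<Gamma> (block_of n i)"
      have blk: "block_of n i < p" using i less_sum_block_of(2) by (simp add: N_def)
      have "ennreal \<bar>angelesco_weight p n (Y(i := x))\<bar> \<le> ennreal (C0 (block_of n i) * (1 + \<epsilon>) ^ (2 * N))
         * (\<integral>\<^sup>+t. ennreal \<bar>angelesco_weight p n (Y(i := t))\<bar> \<partial>\<tau> (block_of n i))"
        using angelesco_weight_poly_map[of i p n Y] i x by (intro C0(2)[OF blk]) (auto simp: N_def)
      also have "\<dots> \<le> ennreal c * (\<integral>\<^sup>+t. ennreal \<bar>angelesco_weight p n (Y(i := t))\<bar> \<partial>\<tau> (block_of n i))"
        using C0_le[OF blk] \<epsilon> by (auto intro!: mult_right_mono ennreal_leI simp: c_def)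
      finally show "ennreal \<bar>angelesco_weight p n (Y(i := x))\<bar> \<le>
        ennreal c * (\<integral>\<^sup>+t. ennreal \<bar>angelesco_weight p n (Y(i := t))\<bar> \<partial>coord_measure \<tau> n i)"
        using i by (simp add: coord_measure_def N_def)
    qed (auto simp: coord_measure(3)[OF \<tau>])
    thus ?thesis using C1 \<epsilon> unfolding tau_product_eq N_def[symmetric] c_def[symmetric]
      by (simp add: c_def ennreal_power)
  qed
  thus ?thesis using C1 that by blast
qed

end

section \<open>Sorting and the partition function\<close>

lemma sorted_vectors_iff:
  "x \<in> sorted_vectors N \<longleftrightarrow> x \<in> extensional {..<N} \<and> (\<forall>i<N. \<forall>j<N. i \<le> j \<longrightarrow> x i \<le> x j)"
  by (auto simp: sorted_vectors_def real_vectors_def space_PiM mono_on_def PiE_iff)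

lemma real_vectors_component [measurable]:
  "k < N \<Longrightarrow> (\<lambda>X. X k) \<in> borel_measurable (real_vectors N)"
  unfolding real_vectors_def by (rule measurable_component_singleton) simp

lemma space_real_vectors: "space (real_vectors N) = extensional {..<N}"
  by (simp add: real_vectors_def space_PiM PiE_def)

lemma sorted_vectors_sets: "sorted_vectors N \<in> sets (real_vectors N)"
proof -
  have "{x \<in> space (real_vectors N). \<forall>i\<in>{..<N}. \<forall>j\<in>{..<N}. i \<le> j \<longrightarrow> x i \<le> x j} \<in> sets (real_vectors N)"
  proof (intro sets.sets_Collect_finite_All sets.sets_Collect_imp sets.sets_Collect_const)
    fix i j assume "i \<in> {..<N}" "j \<in> {..<N}"
    thus "{x \<in> space (real_vectors N). x i \<le> x j} \<in> sets (real_vectors N)"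
      by (intro borel_measurable_le real_vectors_component) auto
  qed auto
  also have "{x \<in> space (real_vectors N). \<forall>i\<in>{..<N}. \<forall>j\<in>{..<N}. i \<le> j \<longrightarrow> x i \<le> x j} = sorted_vectors N"
    by (auto simp: sorted_vectors_iff space_real_vectors)
  finally show ?thesis .
qed

lemma measurable_permute:
  assumes \<pi>: "\<pi> permutes {..<N}"
  shows "(\<lambda>X. X \<circ> \<pi>) \<in> real_vectors N \<rightarrow>\<^sub>M real_vectors N"
proof -
  have "(\<lambda>X. \<lambda>k\<in>{..<N}. X (\<pi> k)) \<in> real_vectors N \<rightarrow>\<^sub>M real_vectors N"
    unfolding real_vectors_def
    by (intro measurable_restrict measurable_component_singleton)
       (use permutes_in_image[OF \<pi>] in auto)
  moreover have "(\<lambda>k\<in>{..<N}. X (\<pi> k)) = X \<circ> \<pi>" if "X \<in> space (real_vectors N)" for X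
    using that permutes_not_in[OF \<pi>]
    by (auto simp: fun_eq_iff space_real_vectors restrict_def extensional_def)
  ultimately show ?thesis by (subst (asm) measurable_cong) auto
qed

lemma mset_map_permutes:
  assumes "\<pi> permutes {..<N}"
  shows "mset (map (x \<circ> \<pi>) [0..<N]) = mset (map x [0..<N])"
proof -
  have "map (x \<circ> \<pi>) [0..<N] = permute_list \<pi> (map x [0..<N])"
    using permutes_in_image[OF assms] by (auto simp: permute_list_def)
  thus ?thesis using assms by simp
qed

lemma sort_coordinates_permute:
  assumes \<pi>: "\<pi> permutes {..<N}" and x: "x \<circ> \<pi> \<in> sorted_vectors N"
  shows "sort_coordinates N x = x \<circ> \<pi>"
proof -
  have "sort (map x [0..<N]) = map (x \<circ> \<pi>) [0..<N]"
  proof (rule properties_for_sort)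
    show "mset (map (x \<circ> \<pi>) [0..<N]) = mset (map x [0..<N])" by (rule mset_map_permutes[OF \<pi>])
    show "sorted (map (x \<circ> \<pi>) [0..<N])"
      using x by (auto simp: sorted_iff_nth_mono sorted_vectors_iff)
  qed
  thus ?thesis using x
    by (auto simp: sort_coordinates_def fun_eq_iff restrict_def sorted_vectors_iff extensional_def)
qed

lemma sorting_permutation:
  assumes "x \<in> extensional {..<N}"
  obtains \<pi> where "\<pi> permutes {..<N}" "x \<circ> \<pi> \<in> sorted_vectors N"
proof -
  define xs where "xs = map x [0..<N]"
  obtain \<pi> where \<pi>: "\<pi> permutes {..<length xs}" "permute_list \<pi> xs = sort xs"
    using mset_eq_permutation[of "sort xs" xs] by auto
  have len: "length xs = N" by (simp add: xs_def)
  have \<pi>': "\<pi> permutes {..<N}" using \<pi>(1) len by simp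
  have nth: "(x \<circ> \<pi>) i = sort xs ! i" if "i < N" for i
  proof -
    have "\<pi> i < N" using permutes_in_image[OF \<pi>', of i] that by simp
    thus ?thesis using that \<pi>(2)[symmetric] by (simp add: permute_list_def xs_def)
  qed
  have "x \<circ> \<pi> \<in> sorted_vectors N"
    unfolding sorted_vectors_iff
  proof (intro conjI allI impI)
    show "x \<circ> \<pi> \<in> extensional {..<N}"
      using assms permutes_not_in[OF \<pi>'] by (auto simp: extensional_def)
    fix i j assume "i < N" "j < N" "i \<le> j"
    thus "(x \<circ> \<pi>) i \<le> (x \<circ> \<pi>) j"
      unfolding nth[OF \<open>i < N\<close>] nth[OF \<open>j < N\<close>] using len by (intro sorted_nth_mono) auto
  qed
  with \<pi>' that show ?thesis by blast
qed

text \<open>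
  On each of the finitely many sets where a given permutation sorts, sorting is a coordinate
  permutation; this makes it measurable.
\<close>

lemma measurable_sort_coordinates: "sort_coordinates N \<in> real_vectors N \<rightarrow>\<^sub>M real_vectors N"
proof (rule measurableI)
  fix x assume "x \<in> space (real_vectors N)"
  show "sort_coordinates N x \<in> space (real_vectors N)"
    by (auto simp: sort_coordinates_def space_real_vectors)
next
  fix A assume A: "A \<in> sets (real_vectors N)"
  have fin: "finite {\<pi>. \<pi> permutes {..<N}}" by (simp add: finite_permutations)
  have "sort_coordinates N -` A \<inter> space (real_vectors N) =
    (\<Union>\<pi>\<in>{\<pi>. \<pi> permutes {..<N}}. (\<lambda>x. x \<circ> \<pi>) -` (A \<inter> sorted_vectors N) \<inter> space (real_vectors N))"
  proof (intro equalityI subsetI)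
    fix x assume x: "x \<in> sort_coordinates N -` A \<inter> space (real_vectors N)"
    then obtain \<pi> where "\<pi> permutes {..<N}" "x \<circ> \<pi> \<in> sorted_vectors N"
      using sorting_permutation[of x N] by (auto simp: space_real_vectors)
    thus "x \<in> (\<Union>\<pi>\<in>{\<pi>. \<pi> permutes {..<N}}. (\<lambda>x. x \<circ> \<pi>) -` (A \<inter> sorted_vectors N) \<inter> space (real_vectors N))"
      using x sort_coordinates_permute[of \<pi> N x] by auto
  qed (use sort_coordinates_permute in auto)
  also have "\<dots> \<in> sets (real_vectors N)"
    using fin A sorted_vectors_sets
    by (intro sets.finite_UN measurable_sets[OF measurable_permute]) auto
  finally show "sort_coordinates N -` A \<inter> space (real_vectors N) \<in> sets (real_vectors N)" .
qed

lemma sort_coordinates_obtain: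
  assumes "x \<in> extensional {..<N}"
  obtains \<pi> where "\<pi> permutes {..<N}" "sort_coordinates N x = x \<circ> \<pi>"
  using sorting_permutation[OF assms] sort_coordinates_permute by metis

lemma sum_sort_coordinates:
  assumes "x \<in> extensional {..<N}"
  shows "(\<Sum>k<N. g (sort_coordinates N x k)) = (\<Sum>k<N. g (x k))"
proof -
  obtain \<pi> where \<pi>: "\<pi> permutes {..<N}" "sort_coordinates N x = x \<circ> \<pi>"
    by (rule sort_coordinates_obtain[OF assms])
  have "(\<Sum>k<N. g (x (\<pi> k))) = (\<Sum>k<N. g (x k))"
    by (rule sum.reindex_bij_betw[OF permutes_imp_bij[OF \<pi>(1)]])
  thus ?thesis by (simp add: \<pi>(2))
qed

text \<open>
  Squaring replaces a product over the lower triangle, which permutations do not preserve, by one over all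
  off-diagonal pairs.
\<close>

lemma prod_lower_triangle_squared:
  fixes g :: "nat \<Rightarrow> nat \<Rightarrow> 'a :: comm_monoid_mult"
  assumes "\<And>k l. g k l = g l k"
  shows "(\<Prod>k<N. \<Prod>l<k. g k l)\<^sup>2 = (\<Prod>k<N. \<Prod>l<N. if l = k then 1 else g k l)"
proof (induction N)
  case (Suc N)
  have 1: "(\<Prod>l<Suc N. if l = k then 1 else g k l) = (\<Prod>l<N. if l = k then 1 else g k l) * g k N" if "k < N" for k
    using that by simp
  have "(\<Prod>k<Suc N. \<Prod>l<Suc N. if l = k then 1 else g k l) =
    (\<Prod>k<N. \<Prod>l<Suc N. if l = k then 1 else g k l) * (\<Prod>l<Suc N. if l = N then 1 else g N l)"
    by (rule prod.lessThan_Suc)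
  also have "(\<Prod>k<N. \<Prod>l<Suc N. if l = k then 1 else g k l) =
    (\<Prod>k<N. (\<Prod>l<N. if l = k then 1 else g k l) * g k N)"
    by (rule prod.cong[OF refl 1]) (simp only: lessThan_iff)
  also have "\<dots> = (\<Prod>k<N. \<Prod>l<k. g k l)\<^sup>2 * (\<Prod>k<N. g k N)"
    by (simp only: prod.distrib Suc.IH)
  also have "(\<Prod>k<N. g k N) = (\<Prod>l<N. g N l)"
    by (rule prod.cong[OF refl assms])
  also have "(\<Prod>l<Suc N. if l = N then 1 else g N l) = (\<Prod>l<N. g N l)" by simp
  also have "(\<Prod>k<N. \<Prod>l<k. g k l)\<^sup>2 * (\<Prod>l<N. g N l) * (\<Prod>l<N. g N l)
      = (\<Prod>k<N. \<Prod>l<k. g k l)\<^sup>2 * (\<Prod>l<N. g N l)\<^sup>2"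
    by (simp add: power2_eq_square mult_ac)
  finally show ?case by (simp add: power_mult_distrib)
qed simp

context angelesco_system
begin

definition block_permutations :: "(nat \<Rightarrow> nat) \<Rightarrow> (nat \<Rightarrow> nat) set" where
  "block_permutations n = {\<pi>. \<pi> permutes {..<multi_size p n} \<and> (\<forall>k<multi_size p n. block_of n (\<pi> k) = block_of n k)}"

lemma configurations_permute:
  assumes X: "X \<in> configurations n" and \<pi>: "\<pi> \<in> block_permutations n"
  shows "X \<circ> \<pi> \<in> configurations n"
proof -
  have p: "\<pi> permutes {..<multi_size p n}" using \<pi> by (simp add: block_permutations_def)
  show ?thesis unfolding configurations_def
  proof (rule PiE_I)
    fix k assume k: "k \<in> {..<multi_size p n}"
    hence "\<pi> k < multi_size p n" using permutes_in_image[OF p, of k] by simp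
    moreover have "block_of n (\<pi> k) = block_of n k" using \<pi> k by (simp add: block_permutations_def)
    ultimately show "(X \<circ> \<pi>) k \<in> \<Gamma> (block_of n k)" using configurationsD(2)[OF X, of "\<pi> k"] by simp
  next
    fix k assume k: "k \<notin> {..<multi_size p n}"
    hence "(X \<circ> \<pi>) k = X k" using permutes_not_in[OF p, of k] by simp
    also have "X k = undefined" using X k unfolding configurations_def by (rule PiE_arb)
    finally show "(X \<circ> \<pi>) k = undefined" .
  qed
qed

lemma angelesco_weight_permute:
  assumes X: "X \<in> configurations n" and \<pi>: "\<pi> \<in> block_permutations n"
  shows "angelesco_weight p n (X \<circ> \<pi>) = angelesco_weight p n X"
proof -
  define N where "N = multi_size p n"
  have p: "\<pi> permutes {..<N}" using \<pi> by (simp add: block_permutations_def N_def)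
  define g where "g = (\<lambda>X k l. \<bar>X k - X l\<bar> ^ pair_exponent n k l :: real)"
  have sym: "g X k l = g X l k" for X k l
    by (simp add: g_def pair_exponent_def abs_minus_commute)
  have w: "angelesco_weight p n X = (\<Prod>k<N. \<Prod>l<k. g X k l)" if "X \<in> configurations n" for X
    using angelesco_weight_abs_pairs[OF that] by (simp add: g_def N_def)
  have "(angelesco_weight p n (X \<circ> \<pi>))\<^sup>2 = (\<Prod>k<N. \<Prod>l<N. if l = k then 1 else g (X \<circ> \<pi>) k l)"
    using w[OF configurations_permute[OF X \<pi>]] prod_lower_triangle_squared[OF sym] by simp
  also have "\<dots> = (\<Prod>k<N. \<Prod>l<N. if \<pi> l = \<pi> k then 1 else g X (\<pi> k) (\<pi> l))"
  proof (intro prod.cong refl)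
    fix k l assume "k \<in> {..<N}" "l \<in> {..<N}"
    hence "block_of n (\<pi> k) = block_of n k" "block_of n (\<pi> l) = block_of n l"
      using \<pi> by (auto simp: block_permutations_def N_def)
    moreover have "\<pi> l = \<pi> k \<longleftrightarrow> l = k" using permutes_inj[OF p] by (auto dest: injD)
    ultimately show "(if l = k then 1 else g (X \<circ> \<pi>) k l) = (if \<pi> l = \<pi> k then 1 else g X (\<pi> k) (\<pi> l))"
      by (simp add: g_def pair_exponent_def)
  qed
  also have "\<dots> = (\<Prod>k<N. \<Prod>l<N. if \<pi> l = k then 1 else g X k (\<pi> l))"
    by (rule prod.reindex_bij_betw[OF permutes_imp_bij[OF p],
          of "\<lambda>k. \<Prod>l<N. if \<pi> l = k then 1 else g X k (\<pi> l)"])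
  also have "\<dots> = (\<Prod>k<N. \<Prod>l<N. if l = k then 1 else g X k l)"
    by (intro prod.cong refl prod.reindex_bij_betw[OF permutes_imp_bij[OF p],
          of "\<lambda>l. if l = k then 1 else g X k l" for k])
  also have "\<dots> = (angelesco_weight p n X)\<^sup>2"
    using w[OF X] prod_lower_triangle_squared[OF sym] by simp
  finally show ?thesis
    using angelesco_weight_nonneg[OF X] angelesco_weight_nonneg[OF configurations_permute[OF X \<pi>]]
    by (simp add: power2_eq_iff_nonneg)
qed

text \<open>
  Take any permutation that sorts the coordinates.  Since the blocks are ordered, the block of the
  \<open>k\<close>-th sorted coordinate is nondecreasing in \<open>k\<close>, as is the block of \<open>k\<close> itself, and
  each block occurs equally often in both sequences.  So they coincide, and the permutation respects the blocks.
\<close>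

lemma block_sorting_permutation:
  assumes X: "X \<in> configurations n"
  obtains \<pi> where "\<pi> \<in> block_permutations n" "X \<circ> \<pi> \<in> sorted_vectors (multi_size p n)"
proof -
  define N where "N = multi_size p n"
  have "X \<in> extensional {..<N}" using X by (auto simp: configurations_def PiE_iff N_def)
  then obtain \<pi> where \<pi>: "\<pi> permutes {..<N}" "X \<circ> \<pi> \<in> sorted_vectors N" by (rule sorting_permutation)
  have in_N: "\<pi> k < N" if "k < N" for k using permutes_in_image[OF \<pi>(1), of k] that by simp
  have mono: "block_of n (\<pi> k) \<le> block_of n (\<pi> l)" if "k \<le> l" "l < N" for k l
  proof (rule ccontr)
    assume "\<not> block_of n (\<pi> k) \<le> block_of n (\<pi> l)"
    hence "b (block_of n (\<pi> l)) < a (block_of n (\<pi> k))"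
      using configurationsD[OF X, of "\<pi> k"] in_N[of k] that by (intro blocks_ordered) (auto simp: N_def)
    hence "X (\<pi> l) < X (\<pi> k)"
      using configurationsD(2)[OF X, of "\<pi> k"] configurationsD(2)[OF X, of "\<pi> l"] in_N[of k] in_N[of l] that
      by (auto simp: N_def)
    moreover have "X (\<pi> k) \<le> X (\<pi> l)" using \<pi>(2) that by (auto simp: sorted_vectors_iff)
    ultimately show False by simp
  qed
  have "map (block_of n \<circ> \<pi>) [0..<N] = sort (map (block_of n) [0..<N])"
    using mono by (intro properties_for_sort[symmetric] mset_map_permutes[OF \<pi>(1)])
      (auto simp: sorted_iff_nth_mono)
  also have "\<dots> = map (block_of n) [0..<N]"
  proof (rule sort_key_id_if_sorted)
    show "sorted (map (\<lambda>x. x) (map (block_of n) [0..<N]))"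
      using block_of_mono[of _ _ p n] by (auto simp: sorted_iff_nth_mono N_def)
  qed
  finally have "\<forall>k<N. block_of n (\<pi> k) = block_of n k" by auto
  thus ?thesis using that \<pi> by (auto simp: block_permutations_def N_def)
qed

lemma distr_tau_product_permute:
  assumes \<tau>: "\<And>i. i < p \<Longrightarrow> finite_borel_measure_on (\<Gamma> i) (\<tau> i)" and \<pi>: "\<pi> \<in> block_permutations n"
  shows "distr (tau_product p \<tau> n) (real_vectors (multi_size p n)) (\<lambda>X. X \<circ> \<pi>) = tau_product p \<tau> n"
proof -
  define N where "N = multi_size p n"
  let ?M = "coord_measure \<tau> n"
  have p: "\<pi> permutes {..<N}" using \<pi> by (simp add: block_permutations_def N_def)
  interpret product_sigma_finite ?M by (rule coord_measure(4)[OF \<tau>])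
  have tau: "tau_product p \<tau> n = Pi\<^sub>M {..<N} ?M" by (simp add: tau_product_eq N_def)
  have sets_tau: "sets (Pi\<^sub>M {..<N} ?M) = sets (real_vectors N)"
    using sets_tau_product[OF \<tau>, of n] by (simp add: tau_product_eq N_def)
  have meas: "(\<lambda>X. X \<circ> \<pi>) \<in> Pi\<^sub>M {..<N} ?M \<rightarrow>\<^sub>M real_vectors N"
    using measurable_permute[OF p] by (simp add: measurable_cong_sets[OF sets_tau refl])
  have inv: "inv \<pi> permutes {..<N}" by (rule permutes_inv[OF p])
  show ?thesis unfolding tau N_def[symmetric]
  proof (rule PiM_eqI)
    show "sets (distr (Pi\<^sub>M {..<N} ?M) (real_vectors N) (\<lambda>X. X \<circ> \<pi>)) = sets (Pi\<^sub>M {..<N} ?M)"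
      by (simp add: sets_tau)
    fix A assume A: "\<And>i. i \<in> {..<N} \<Longrightarrow> A i \<in> sets (?M i)"
    have AE: "Pi\<^sub>E {..<N} A \<in> sets (real_vectors N)"
      using A sets_tau by (metis finite_lessThan sets_PiM_I_finite)
    have "(\<lambda>X. X \<circ> \<pi>) -` Pi\<^sub>E {..<N} A \<inter> space (Pi\<^sub>M {..<N} ?M) = Pi\<^sub>E {..<N} (A \<circ> inv \<pi>)"
    proof (intro equalityI subsetI)
      fix X assume X: "X \<in> (\<lambda>X. X \<circ> \<pi>) -` Pi\<^sub>E {..<N} A \<inter> space (Pi\<^sub>M {..<N} ?M)"
      hence "X (\<pi> (inv \<pi> k)) \<in> A (inv \<pi> k)" if "k < N" for k
        using permutes_in_image[OF inv, of k] that by (auto simp: PiE_iff)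
      thus "X \<in> Pi\<^sub>E {..<N} (A \<circ> inv \<pi>)"
        using X by (auto simp: PiE_iff space_PiM permutes_inverses[OF p])
    next
      fix X assume X: "X \<in> Pi\<^sub>E {..<N} (A \<circ> inv \<pi>)"
      hence "X (\<pi> k) \<in> A k" if "k < N" for k
        using permutes_in_image[OF p, of k] that by (force simp: PiE_iff permutes_inverses[OF p])
      thus "X \<in> (\<lambda>X. X \<circ> \<pi>) -` Pi\<^sub>E {..<N} A \<inter> space (Pi\<^sub>M {..<N} ?M)"
        using X permutes_not_in[OF p]
        by (auto simp: PiE_iff space_PiM coord_measure(3)[OF \<tau>] extensional_def)
    qed
    hence "emeasure (distr (Pi\<^sub>M {..<N} ?M) (real_vectors N) (\<lambda>X. X \<circ> \<pi>)) (Pi\<^sub>E {..<N} A) =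
      emeasure (Pi\<^sub>M {..<N} ?M) (Pi\<^sub>E {..<N} (A \<circ> inv \<pi>))"
      by (simp add: emeasure_distr[OF meas AE])
    also have "\<dots> = (\<Prod>k<N. emeasure (?M k) ((A \<circ> inv \<pi>) k))"
      using A permutes_in_image[OF inv] by (intro emeasure_PiM) (auto simp: coord_measure(1)[OF \<tau>])
    also have "\<dots> = (\<Prod>k<N. emeasure (?M (\<pi> k)) ((A \<circ> inv \<pi>) (\<pi> k)))"
      by (rule prod.reindex_bij_betw[OF permutes_imp_bij[OF p], symmetric])
    also have "\<dots> = (\<Prod>k<N. emeasure (?M k) (A k))"
    proof (intro prod.cong refl)
      fix k assume k: "k \<in> {..<N}"
      hence "block_of n (\<pi> k) = block_of n k" using \<pi> by (auto simp: block_permutations_def N_def)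
      moreover have "\<pi> k < N" using permutes_in_image[OF p, of k] k by simp
      ultimately show "emeasure (?M (\<pi> k)) ((A \<circ> inv \<pi>) (\<pi> k)) = emeasure (?M k) (A k)"
        using k by (simp add: coord_measure_def N_def permutes_inverses[OF p])
    qed
    finally show "emeasure (distr (Pi\<^sub>M {..<N} ?M) (real_vectors N) (\<lambda>X. X \<circ> \<pi>)) (Pi\<^sub>E {..<N} A) =
      (\<Prod>k<N. emeasure (?M k) (A k))" .
  qed simp
qed

text \<open>
  Almost every vector is sorted by one of the at most \<open>N!\<close> block permutations, and these preserve both the
  weight and the measure.
\<close>

lemma integral_weight_le_sorted:
  fixes n :: "nat \<Rightarrow> nat"
  assumes \<tau>: "\<And>i. i < p \<Longrightarrow> finite_borel_measure_on (\<Gamma> i) (\<tau> i)"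
  defines "N \<equiv> multi_size p n"
  shows "(\<integral>\<^sup>+X. ennreal \<bar>angelesco_weight p n X\<bar> \<partial>tau_product p \<tau> n) \<le>
    of_nat (fact N) * (\<integral>\<^sup>+X. ennreal \<bar>angelesco_weight p n X\<bar> * indicator (sorted_vectors N) X \<partial>tau_product p \<tau> n)"
proof -
  define f where "f = (\<lambda>X. ennreal \<bar>angelesco_weight p n X\<bar> * indicator (sorted_vectors N) X)"
  let ?\<tau> = "tau_product p \<tau> n"
  have sets_tau [measurable_cong]: "sets ?\<tau> = sets (real_vectors N)"
    unfolding N_def by (rule sets_tau_product[OF \<tau>])
  have AE: "AE X in ?\<tau>. X \<in> configurations n" by (rule AE_tau_product[OF \<tau>])
  note [measurable] = angelesco_weight_measurable[of n, folded N_def] sorted_vectors_sets[of N]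
  have f [measurable]: "f \<in> borel_measurable (real_vectors N)" unfolding f_def by measurable
  have fin: "finite (block_permutations n)"
    by (rule finite_subset[OF _ finite_permutations[of "{..<N}"]]) (auto simp: block_permutations_def N_def)
  have [measurable]: "(\<lambda>X. X \<circ> \<pi>) \<in> real_vectors N \<rightarrow>\<^sub>M real_vectors N" if "\<pi> \<in> block_permutations n" for \<pi>
    using that by (intro measurable_permute) (auto simp: block_permutations_def N_def)
  have "(\<integral>\<^sup>+X. ennreal \<bar>angelesco_weight p n X\<bar> \<partial>?\<tau>) \<le> (\<integral>\<^sup>+X. (\<Sum>\<pi>\<in>block_permutations n. f (X \<circ> \<pi>)) \<partial>?\<tau>)"
  proof (rule nn_integral_mono_AE, use AE in eventually_elim)
    case (elim X)
    obtain \<pi> where \<pi>: "\<pi> \<in> block_permutations n" "X \<circ> \<pi> \<in> sorted_vectors N"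
      using block_sorting_permutation[OF elim] unfolding N_def by blast
    have "ennreal \<bar>angelesco_weight p n X\<bar> = f (X \<circ> \<pi>)"
      using \<pi> angelesco_weight_permute[OF elim \<pi>(1)] by (simp add: f_def)
    also have "\<dots> \<le> (\<Sum>\<pi>\<in>block_permutations n. f (X \<circ> \<pi>))"
      by (rule member_le_sum[of \<pi>]) (use \<pi> fin in auto)
    finally show ?case .
  qed
  also have "\<dots> = (\<Sum>\<pi>\<in>block_permutations n. \<integral>\<^sup>+X. f (X \<circ> \<pi>) \<partial>?\<tau>)"
    by (rule nn_integral_sum) measurable
  also have "\<dots> = (\<Sum>\<pi>\<in>block_permutations n. \<integral>\<^sup>+X. f X \<partial>?\<tau>)"
  proof (intro sum.cong refl)
    fix \<pi> assume \<pi>: "\<pi> \<in> block_permutations n"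
    hence [measurable]: "(\<lambda>X. X \<circ> \<pi>) \<in> real_vectors N \<rightarrow>\<^sub>M real_vectors N"
      by (intro measurable_permute) (auto simp: block_permutations_def N_def)
    have "(\<integral>\<^sup>+X. f X \<partial>?\<tau>) = (\<integral>\<^sup>+X. f X \<partial>distr ?\<tau> (real_vectors N) (\<lambda>X. X \<circ> \<pi>))"
      using distr_tau_product_permute[OF \<tau> \<pi>] by (simp add: N_def)
    also have "\<dots> = (\<integral>\<^sup>+X. f (X \<circ> \<pi>) \<partial>?\<tau>)" by (rule nn_integral_distr) measurable
    finally show "(\<integral>\<^sup>+X. f (X \<circ> \<pi>) \<partial>?\<tau>) = (\<integral>\<^sup>+X. f X \<partial>?\<tau>)" by simp
  qed
  also have "\<dots> = of_nat (card (block_permutations n)) * (\<integral>\<^sup>+X. f X \<partial>?\<tau>)" by simp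
  also have "\<dots> \<le> of_nat (fact N) * (\<integral>\<^sup>+X. f X \<partial>?\<tau>)"
  proof (intro mult_right_mono)
    have "card (block_permutations n) \<le> card {\<pi>. \<pi> permutes {..<N}}"
      by (intro card_mono finite_permutations) (auto simp: block_permutations_def N_def)
    also have "\<dots> = fact N" by (rule card_permutations) auto
    finally show "(of_nat (card (block_permutations n)) :: ennreal) \<le> of_nat (fact N)"
      by (rule of_nat_mono)
  qed simp
  finally show ?thesis by (simp add: f_def)
qed

lemma tau_product_mass:
  assumes \<tau>: "\<And>i. i < p \<Longrightarrow> finite_borel_measure_on (\<Gamma> i) (\<tau> i)"
  obtains m where "m \<ge> 1" "\<And>n. emeasure (tau_product p \<tau> n) (space (tau_product p \<tau> n)) \<le> ennreal (m ^ multi_size p n)"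
proof -
  define m where "m = 1 + (\<Sum>i<p. measure (\<tau> i) UNIV)"
  have m: "m \<ge> 1" by (simp add: m_def sum_nonneg)
  have le: "measure (\<tau> i) UNIV \<le> m" if "i < p" for i
  proof -
    have "measure (\<tau> i) UNIV \<le> (\<Sum>i<p. measure (\<tau> i) UNIV)" by (rule member_le_sum) (use that in auto)
    thus ?thesis by (simp add: m_def)
  qed
  have "emeasure (tau_product p \<tau> n) (space (tau_product p \<tau> n)) \<le> ennreal (m ^ multi_size p n)" for n
  proof -
    define N where "N = multi_size p n"
    interpret product_sigma_finite "coord_measure \<tau> n" by (rule coord_measure(4)[OF \<tau>])
    have space: "space (Pi\<^sub>M {..<N} (coord_measure \<tau> n)) = (\<Pi>\<^sub>E k\<in>{..<N}. UNIV)"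
      by (simp add: space_PiM coord_measure(3)[OF \<tau>])
    have "emeasure (tau_product p \<tau> n) (space (tau_product p \<tau> n)) = (\<Prod>k<N. emeasure (coord_measure \<tau> n k) UNIV)"
      unfolding tau_product_eq N_def[symmetric] space
      by (intro emeasure_PiM) (auto simp: coord_measure(1)[OF \<tau>])
    also have "\<dots> = (\<Prod>k<N. ennreal (measure (coord_measure \<tau> n k) UNIV))"
      by (intro prod.cong refl finite_measure.emeasure_eq_measure coord_measure(2)[OF \<tau>])
    also have "\<dots> = ennreal (\<Prod>k<N. measure (coord_measure \<tau> n k) UNIV)"
      by (rule prod_ennreal) simp
    also have "\<dots> \<le> ennreal (\<Prod>k<N. m)"
    proof (intro ennreal_leI prod_mono conjI)
      fix k assume k: "k \<in> {..<N}"
      hence blk: "block_of n k < p" using less_sum_block_of(2) by (simp add: N_def)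
      show "measure (coord_measure \<tau> n k) UNIV \<le> m"
        using le[OF blk] k by (simp add: coord_measure_def N_def)
    qed simp
    also have "(\<Prod>k<N. m) = m ^ N" by simp
    finally show ?thesis by (simp add: N_def)
  qed
  thus ?thesis using m that by blast
qed

lemma partition_function_eq:
  fixes n :: "nat \<Rightarrow> nat"
  assumes \<tau>: "\<And>i. i < p \<Longrightarrow> finite_borel_measure_on (\<Gamma> i) (\<tau> i)"
  defines "N \<equiv> multi_size p n"
  shows "partition_function p \<tau> n \<ge> 0" "ennreal (partition_function p \<tau> n) =
    (\<integral>\<^sup>+X. ennreal \<bar>angelesco_weight p n X\<bar> * indicator (sorted_vectors N) X \<partial>tau_product p \<tau> n)"
proof -
  let ?\<tau> = "tau_product p \<tau> n"
  have sets_tau [measurable_cong]: "sets ?\<tau> = sets (real_vectors N)"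
    unfolding N_def by (rule sets_tau_product[OF \<tau>])
  have AE: "AE X in ?\<tau>. X \<in> configurations n" by (rule AE_tau_product[OF \<tau>])
  note [measurable] = angelesco_weight_measurable[of n, folded N_def] sorted_vectors_sets[of N]
  obtain m where m: "emeasure ?\<tau> (space ?\<tau>) \<le> ennreal (m ^ N)"
    using tau_product_mass[OF \<tau>] unfolding N_def by blast
  interpret finite_measure ?\<tau>
    by (rule finite_measureI) (use m in \<open>auto simp: top_unique\<close>)
  have int: "integrable ?\<tau> (\<lambda>X. indicator (sorted_vectors N) X * angelesco_weight p n X)"
  proof (rule integrable_const_bound[where B = "exp (weight_bound n - 0)"])
    show "AE X in ?\<tau>. norm (indicator (sorted_vectors N) X * angelesco_weight p n X) \<le> exp (weight_bound n - 0)"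
      using AE
    proof eventually_elim
      case (elim X)
      thus ?case using angelesco_weight_le[OF elim, of 0] angelesco_weight_nonneg[OF elim]
        by (auto simp: indicator_def)
    qed
  qed measurable
  have nn: "AE X in ?\<tau>. 0 \<le> indicator (sorted_vectors N) X * angelesco_weight p n X"
    using AE by eventually_elim (simp add: angelesco_weight_nonneg)
  show "partition_function p \<tau> n \<ge> 0"
    unfolding partition_function_def set_lebesgue_integral_def N_def[symmetric]
    using nn by (intro integral_nonneg_AE) auto
  have "ennreal (partition_function p \<tau> n) = (\<integral>\<^sup>+X. ennreal (indicator (sorted_vectors N) X * angelesco_weight p n X) \<partial>?\<tau>)"
    unfolding partition_function_def set_lebesgue_integral_def N_def[symmetric]
    using nn_integral_eq_integral[OF int nn] by simp
  also have "\<dots> = (\<integral>\<^sup>+X. ennreal \<bar>angelesco_weight p n X\<bar> * indicator (sorted_vectors N) X \<partial>?\<tau>)"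
  proof (rule nn_integral_cong_AE, use AE in eventually_elim)
    case (elim X)
    thus ?case using angelesco_weight_nonneg[OF elim] by (auto simp: indicator_def)
  qed
  finally show "ennreal (partition_function p \<tau> n) =
    (\<integral>\<^sup>+X. ennreal \<bar>angelesco_weight p n X\<bar> * indicator (sorted_vectors N) X \<partial>?\<tau>)" .
qed

text \<open>
  The supremum of the weight is bounded below by its value at a configuration of low energy and above,
  through the Bernstein--Markov inequality, by its integral.
\<close>

lemma partition_function_lower_bound:
  assumes \<tau>: "\<And>i. i < p \<Longrightarrow> finite_borel_measure_on (\<Gamma> i) (\<tau> i)"
    and BM: "\<And>i. i < p \<Longrightarrow> BM_inequality (\<Gamma> i) (\<tau> i)" and \<epsilon>: "\<epsilon> > 0"
    and \<mu>: "admissible \<mu>" and e: "energy \<mu> = ennreal e" "e \<ge> 0"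
  obtains C where "C \<ge> 1" "\<And>n s. (\<And>i. i < p \<Longrightarrow> real (n i) \<le> s * r i) \<Longrightarrow>
    exp (weight_bound n - s\<^sup>2 * e) \<le>
      (C * (1 + \<epsilon>) ^ (2 * multi_size p n)) ^ multi_size p n * fact (multi_size p n) * partition_function p \<tau> n"
proof -
  obtain C where C: "C \<ge> 1" "\<And>n X. X \<in> configurations n \<Longrightarrow>
    ennreal \<bar>angelesco_weight p n X\<bar> \<le>
      ennreal ((C * (1 + \<epsilon>) ^ (2 * multi_size p n)) ^ multi_size p n) *
      (\<integral>\<^sup>+Y. ennreal \<bar>angelesco_weight p n Y\<bar> \<partial>tau_product p \<tau> n)"
    using angelesco_weight_sup_bound[OF \<tau> BM \<epsilon>] by blast
  have "exp (weight_bound n - s\<^sup>2 * e) \<le>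
      (C * (1 + \<epsilon>) ^ (2 * multi_size p n)) ^ multi_size p n * fact (multi_size p n) * partition_function p \<tau> n"
    if s: "\<And>i. i < p \<Longrightarrow> real (n i) \<le> s * r i" for n s
  proof -
    define N where "N = multi_size p n"
    define K where "K = (C * (1 + \<epsilon>) ^ (2 * N)) ^ N"
    have K: "K \<ge> 0" using C \<epsilon> by (simp add: K_def)
    have Z: "partition_function p \<tau> n \<ge> 0" by (rule partition_function_eq[OF \<tau>])
    obtain X where X: "X \<in> configurations n" "discrete_energy n X \<le> ennreal (s\<^sup>2) * energy \<mu>"
      using low_energy_configuration[OF \<mu> _ s] e by auto
    hence "discrete_energy n X \<le> ennreal (s\<^sup>2 * e)" using e by (simp add: ennreal_mult)
    hence "exp (weight_bound n - s\<^sup>2 * e) \<le> angelesco_weight p n X"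
      using angelesco_weight_ge[OF X(1)] e by simp
    hence "ennreal (exp (weight_bound n - s\<^sup>2 * e)) \<le> ennreal \<bar>angelesco_weight p n X\<bar>"
      by (intro ennreal_leI) simp
    also have "\<dots> \<le> ennreal K * (\<integral>\<^sup>+Y. ennreal \<bar>angelesco_weight p n Y\<bar> \<partial>tau_product p \<tau> n)"
      using C(2)[OF X(1)] by (simp add: K_def N_def)
    also have "\<dots> \<le> ennreal K * (of_nat (fact N) * ennreal (partition_function p \<tau> n))"
    proof (rule mult_left_mono)
      have "ennreal (partition_function p \<tau> n) =
          (\<integral>\<^sup>+X. ennreal \<bar>angelesco_weight p n X\<bar> * indicator (sorted_vectors N) X \<partial>tau_product p \<tau> n)"
        unfolding N_def by (rule partition_function_eq[OF \<tau>])
      thus "(\<integral>\<^sup>+Y. ennreal \<bar>angelesco_weight p n Y\<bar> \<partial>tau_product p \<tau> n)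
          \<le> of_nat (fact N) * ennreal (partition_function p \<tau> n)"
        unfolding N_def by (simp only:) (rule integral_weight_le_sorted[OF \<tau>])
    qed simp
    also have "\<dots> = ennreal (K * fact N * partition_function p \<tau> n)"
    proof -
      have "(of_nat (fact N) :: ennreal) = ennreal (fact N)"
        by (simp only: ennreal_of_nat_eq_real_of_nat of_nat_fact)
      thus ?thesis using K Z by (simp add: ennreal_mult mult.assoc)
    qed
    finally show ?thesis using K Z by (simp add: ennreal_le_iff K_def N_def)
  qed
  thus ?thesis using C(1) that by blast
qed

text \<open>
  The ensemble is only described through the law of its sorted points, so the estimate concerns events
  that are stable under sorting.
\<close>

lemma ensemble_measure_le:
  assumes \<tau>: "\<And>i. i < p \<Longrightarrow> finite_borel_measure_on (\<Gamma> i) (\<tau> i)"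
    and P: "is_angelesco_ensemble p \<tau> n P"
    and B: "B \<in> sets (real_vectors (multi_size p n))"
    and sym: "\<And>X. X \<in> space (real_vectors (multi_size p n)) \<Longrightarrow> X \<in> B \<Longrightarrow> sort_coordinates (multi_size p n) X \<in> B"
    and le: "\<And>X. X \<in> configurations n \<Longrightarrow> X \<in> B \<Longrightarrow> angelesco_weight p n X \<le> w" and w: "w \<ge> 0"
  shows "emeasure P B \<le> ennreal (w / partition_function p \<tau> n) * emeasure (tau_product p \<tau> n) (space (tau_product p \<tau> n))"
proof -
  define N where "N = multi_size p n"
  let ?\<tau> = "tau_product p \<tau> n"
  define Z where "Z = partition_function p \<tau> n"
  have Z: "Z \<ge> 0" unfolding Z_def by (rule partition_function_eq[OF \<tau>])
  have sets_P: "sets P = sets (real_vectors N)" and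
    distr: "distr P (real_vectors N) (sort_coordinates N) =
      density ?\<tau> (\<lambda>X. ennreal (angelesco_weight p n X / Z) * indicator (sorted_vectors N) X)"
    using P by (auto simp: is_angelesco_ensemble_def Let_def N_def Z_def)
  have sets_tau [measurable_cong]: "sets ?\<tau> = sets (real_vectors N)"
    unfolding N_def by (rule sets_tau_product[OF \<tau>])
  have AE: "AE X in ?\<tau>. X \<in> configurations n" by (rule AE_tau_product[OF \<tau>])
  note [measurable] = angelesco_weight_measurable[of n, folded N_def] sorted_vectors_sets[of N] B[folded N_def]
  have sort: "sort_coordinates N \<in> P \<rightarrow>\<^sub>M real_vectors N"
    using measurable_sort_coordinates by (simp add: measurable_cong_sets[OF sets_P refl])
  have "emeasure P B \<le> emeasure P (sort_coordinates N -` B \<inter> space P)"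
    using sym B sets.sets_into_space[OF B] measurable_sets[OF sort, of B] sets_eq_imp_space_eq[OF sets_P]
    by (intro emeasure_mono) (auto simp: N_def)
  also have "\<dots> = emeasure (distr P (real_vectors N) (sort_coordinates N)) B"
    using B by (intro emeasure_distr[symmetric] sort) (simp add: N_def)
  also have "\<dots> = (\<integral>\<^sup>+X. ennreal (angelesco_weight p n X / Z) * indicator (sorted_vectors N) X * indicator B X \<partial>?\<tau>)"
  proof -
    have "(\<lambda>X. ennreal (angelesco_weight p n X / Z) * indicator (sorted_vectors N) X) \<in> borel_measurable ?\<tau>"
      by measurable
    moreover have "B \<in> sets ?\<tau>" using B sets_tau by (simp add: N_def)
    ultimately show ?thesis unfolding distr by (rule emeasure_density)
  qed
  also have "\<dots> \<le> (\<integral>\<^sup>+X. ennreal (w / Z) \<partial>?\<tau>)"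
  proof (rule nn_integral_mono_AE, use AE in eventually_elim)
    case (elim X)
    thus ?case using le[OF elim] Z by (auto simp: indicator_def intro!: ennreal_leI divide_right_mono)
  qed
  finally show ?thesis by (simp add: Z_def)
qed

end

section \<open>Empirical measures and lower semicontinuity of the energy\<close>

lemma borel_measurable_isCont:
  fixes f :: "real \<Rightarrow> real"
  assumes "\<And>x. isCont f x"
  shows "f \<in> borel_measurable borel"
  using assms by (intro borel_measurable_continuous_onI continuous_at_imp_continuous_on) auto

lemma nn_integral_sum_measure:
  assumes "\<And>i. i < m \<Longrightarrow> sets (M i) = sets borel" and "f \<in> borel_measurable borel"
  shows "(\<integral>\<^sup>+x. f x \<partial>sum_measure m M) = (\<Sum>i<m. \<integral>\<^sup>+x. f x \<partial>M i)"
  using assms(2)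
proof (induction rule: borel_measurable_induct)
  case (cong f g)
  have "(\<integral>\<^sup>+x. f x \<partial>N) = (\<integral>\<^sup>+x. g x \<partial>N)" if "sets N = sets borel" for N :: "real measure"
    using cong(3) sets_eq_imp_space_eq[OF that] by (intro nn_integral_cong) auto
  thus ?case using cong(4) assms(1) by simp
next
  case (set A)
  thus ?case using assms(1) by (simp add: emeasure_sum_measure nn_integral_indicator)
next
  case (mult u c)
  have "u \<in> borel_measurable (M i)" if "i < m" for i
    using mult(2) by (simp add: measurable_cong_sets[OF assms(1)[OF that] refl])
  moreover have "u \<in> borel_measurable (sum_measure m M)"
    using mult(2) by (simp add: measurable_cong_sets[OF sets_sum_measure refl])
  ultimately show ?case using mult by (simp add: nn_integral_cmult sum_distrib_left)
next
  case (add u v)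
  have "u \<in> borel_measurable (M i)" "v \<in> borel_measurable (M i)" if "i < m" for i
    using add by (simp_all add: measurable_cong_sets[OF assms(1)[OF that] refl])
  moreover have "u \<in> borel_measurable (sum_measure m M)" "v \<in> borel_measurable (sum_measure m M)"
    using add by (simp_all add: measurable_cong_sets[OF sets_sum_measure refl])
  ultimately show ?case using add by (simp add: nn_integral_add sum.distrib)
next
  case (seq U)
  have meas: "U k \<in> borel_measurable (M i)" if "i < m" for i k
    using seq by (simp add: measurable_cong_sets[OF assms(1)[OF that] refl])
  have meas': "U k \<in> borel_measurable (sum_measure m M)" for k
    using seq by (simp add: measurable_cong_sets[OF sets_sum_measure refl])
  have inc: "incseq (\<lambda>k. \<integral>\<^sup>+x. U k x \<partial>M i)" for i
    using seq(3) by (auto simp: incseq_def le_fun_def intro!: nn_integral_mono)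
  have "(\<integral>\<^sup>+x. (SUP k. U k) x \<partial>sum_measure m M) = (SUP k. \<integral>\<^sup>+x. U k x \<partial>sum_measure m M)"
    using nn_integral_monotone_convergence_SUP[OF seq(3) meas'] by (simp add: image_comp)
  also have "\<dots> = (SUP k. \<Sum>i<m. \<integral>\<^sup>+x. U k x \<partial>M i)" using seq.IH by simp
  also have "\<dots> = (\<Sum>i<m. SUP k. \<integral>\<^sup>+x. U k x \<partial>M i)"
    using inc by (intro ennreal_SUP_sum) auto
  also have "\<dots> = (\<Sum>i<m. \<integral>\<^sup>+x. (SUP k. U k) x \<partial>M i)"
    using nn_integral_monotone_convergence_SUP[OF seq(3) meas] by (intro sum.cong) (auto simp: image_comp)
  finally show ?case .
qed

lemma integral_sum_measure:
  fixes f :: "real \<Rightarrow> real"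
  assumes sets: "\<And>i. i < m \<Longrightarrow> sets (M i) = sets borel" and f: "f \<in> borel_measurable borel"
    and int: "\<And>i. i < m \<Longrightarrow> integrable (M i) f"
  shows "integrable (sum_measure m M) f" "(\<integral>x. f x \<partial>sum_measure m M) = (\<Sum>i<m. \<integral>x. f x \<partial>M i)"
proof -
  have fin: "(\<integral>\<^sup>+x. ennreal (norm (f x)) \<partial>M i) < \<infinity>" if "i < m" for i
    using int[OF that] by (simp add: integrable_iff_bounded)
  show I: "integrable (sum_measure m M) f"
  proof (rule integrableI_bounded)
    show "f \<in> borel_measurable (sum_measure m M)"
      using f by (simp add: measurable_cong_sets[OF sets_sum_measure refl])
    show "(\<integral>\<^sup>+x. ennreal (norm (f x)) \<partial>sum_measure m M) < \<infinity>"
      using fin f by (subst nn_integral_sum_measure[OF sets]) auto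
  qed
  have pm: "(\<integral>\<^sup>+x. ennreal (f x) \<partial>M i) < top" "(\<integral>\<^sup>+x. ennreal (- f x) \<partial>M i) < top" if "i < m" for i
  proof -
    have "(\<integral>\<^sup>+x. ennreal (f x) \<partial>M i) \<le> (\<integral>\<^sup>+x. ennreal (norm (f x)) \<partial>M i)"
      "(\<integral>\<^sup>+x. ennreal (- f x) \<partial>M i) \<le> (\<integral>\<^sup>+x. ennreal (norm (f x)) \<partial>M i)"
      by (auto intro!: nn_integral_mono ennreal_leI)
    thus "(\<integral>\<^sup>+x. ennreal (f x) \<partial>M i) < top" "(\<integral>\<^sup>+x. ennreal (- f x) \<partial>M i) < top"
      using fin[OF that] by (auto intro: le_less_trans)
  qed
  have "(\<integral>x. f x \<partial>sum_measure m M) =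
     enn2real (\<Sum>i<m. \<integral>\<^sup>+x. ennreal (f x) \<partial>M i) - enn2real (\<Sum>i<m. \<integral>\<^sup>+x. ennreal (- f x) \<partial>M i)"
    unfolding real_lebesgue_integral_def[OF I] using f
    by (subst nn_integral_sum_measure[OF sets], simp, simp, subst nn_integral_sum_measure[OF sets]) auto
  also have "\<dots> = (\<Sum>i<m. enn2real (\<integral>\<^sup>+x. ennreal (f x) \<partial>M i)) - (\<Sum>i<m. enn2real (\<integral>\<^sup>+x. ennreal (- f x) \<partial>M i))"
    using pm enn2real_sum[of "{..<m}" "\<lambda>i. \<integral>\<^sup>+x. ennreal (f x) \<partial>M i"]
      enn2real_sum[of "{..<m}" "\<lambda>i. \<integral>\<^sup>+x. ennreal (- f x) \<partial>M i"] by (simp add: comp_def)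
  also have "\<dots> = (\<Sum>i<m. \<integral>x. f x \<partial>M i)"
    by (simp add: sum_subtractf[symmetric] real_lebesgue_integral_def[OF int])
  finally show "(\<integral>x. f x \<partial>sum_measure m M) = (\<Sum>i<m. \<integral>x. f x \<partial>M i)" .
qed

lemma scale_measure_eq_density: "scale_measure c M = density M (\<lambda>_. c)"
  by (rule measure_eqI) (auto simp: emeasure_density_const)

lemma integral_scale_measure:
  fixes f :: "'a \<Rightarrow> real"
  assumes "c \<ge> 0" "f \<in> borel_measurable M"
  shows "(\<integral>x. f x \<partial>scale_measure (ennreal c) M) = c * (\<integral>x. f x \<partial>M)"
  unfolding scale_measure_eq_density using assms by (subst integral_density) auto

lemma sets_normalized_counting_measure [simp, measurable_cong]:
  "sets (normalized_counting_measure N X) = sets borel"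
  by (simp add: normalized_counting_measure_def)

lemma emeasure_normalized_counting_measure:
  assumes "N > 0" "B \<in> sets borel"
  shows "emeasure (normalized_counting_measure N X) B = ennreal ((\<Sum>k<N. indicator B (X k)) / real N)"
proof -
  have "emeasure (normalized_counting_measure N X) B = ennreal (1 / real N) * (\<Sum>k<N. ennreal (indicator B (X k)))"
    using assms by (simp add: normalized_counting_measure_def emeasure_sum_measure ennreal_indicator)
  also have "(\<Sum>k<N. ennreal (indicator B (X k))) = ennreal (\<Sum>k<N. indicator B (X k))"
    by (rule sum_ennreal) simp
  also have "ennreal (1 / real N) * \<dots> = ennreal (1 / real N * (\<Sum>k<N. indicator B (X k)))"
    by (rule ennreal_mult[symmetric]) (auto intro: sum_nonneg)
  finally show ?thesis by simp
qed

lemma measure_normalized_counting_measure: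
  assumes "N > 0" "B \<in> sets borel"
  shows "measure (normalized_counting_measure N X) B = (\<Sum>k<N. indicator B (X k)) / real N"
  unfolding measure_def emeasure_normalized_counting_measure[OF assms]
  by (simp add: sum_nonneg)

lemma real_distribution_normalized_counting_measure:
  assumes "N > 0"
  shows "real_distribution (normalized_counting_measure N X)"
proof -
  have "space (normalized_counting_measure N X) = UNIV"
    using sets_eq_imp_space_eq[OF sets_normalized_counting_measure] by simp
  moreover have "emeasure (normalized_counting_measure N X) UNIV = 1"
    using assms by (subst emeasure_normalized_counting_measure) auto
  ultimately have "prob_space (normalized_counting_measure N X)" by (intro prob_spaceI) simp
  thus ?thesis by (simp add: real_distribution_def real_distribution_axioms_def)
qed

lemma integral_normalized_counting_measure:
  fixes f :: "real \<Rightarrow> real"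
  assumes f: "f \<in> borel_measurable borel"
  shows "(\<integral>x. f x \<partial>normalized_counting_measure N X) = (\<Sum>k<N. f (X k)) / real N"
proof -
  have int: "integrable (return borel (X k)) f" for k
    using f by (auto simp: integrable_iff_bounded nn_integral_return)
  have "(\<integral>x. f x \<partial>normalized_counting_measure N X) = 1 / real N * (\<integral>x. f x \<partial>sum_measure N (\<lambda>k. return borel (X k)))"
    unfolding normalized_counting_measure_def using f
    by (intro integral_scale_measure) (auto simp: measurable_cong_sets[OF sets_sum_measure refl])
  also have "(\<integral>x. f x \<partial>sum_measure N (\<lambda>k. return borel (X k))) = (\<Sum>k<N. f (X k))"
    using f int by (subst integral_sum_measure) (auto simp: integral_return)
  finally show ?thesis by simp
qed

lemma tight_on_interval:
  assumes "\<And>j. real_distribution (M j)" "\<And>j. measure (M j) {a..b} = 1"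
  shows "tight M"
  unfolding tight_def
proof (intro conjI allI impI assms(1))
  fix \<epsilon> :: real assume \<epsilon>: "\<epsilon> > 0"
  have "measure (M j) {a - 1<..max a b + 1} > 1 - \<epsilon>" for j
  proof -
    interpret real_distribution "M j" by (rule assms(1))
    have "measure (M j) {a..b} \<le> measure (M j) {a - 1<..max a b + 1}"
      by (rule finite_measure_mono) auto
    thus ?thesis using assms(2)[of j] \<epsilon> by simp
  qed
  thus "\<exists>a b. a < b \<and> (\<forall>j. measure (M j) {a<..b} > 1 - \<epsilon>)"
    by (intro exI[of _ "a - 1"] exI[of _ "max a b + 1"]) auto
qed

lemma weak_conv_m_subseq:
  assumes "weak_conv_m M L" "strict_mono (s :: nat \<Rightarrow> nat)"
  shows "weak_conv_m (M \<circ> s) L"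
  unfolding weak_conv_m_def weak_conv_def
proof (intro allI impI)
  fix x assume "isCont (cdf L) x"
  hence "(\<lambda>j. cdf (M j) x) \<longlonglongrightarrow> cdf L x" using assms(1) by (auto simp: weak_conv_m_def weak_conv_def)
  from LIMSEQ_subseq_LIMSEQ[OF this assms(2)]
  show "(\<lambda>j. cdf ((M \<circ> s) j) x) \<longlonglongrightarrow> cdf L x" by (simp add: comp_def)
qed

text \<open>
  Subsequences are extracted for one index after the other.
\<close>

lemma simultaneous_weak_limit:
  fixes p :: nat
  assumes "\<And>i. i < p \<Longrightarrow> tight (M i)"
  shows "\<exists>s L. strict_mono (s :: nat \<Rightarrow> nat) \<and>
    (\<forall>i<p. real_distribution (L i) \<and> weak_conv_m (M i \<circ> s) (L i))"
  using assms
proof (induction p)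
  case 0
  show ?case by (intro exI[of _ id]) (auto simp: strict_mono_def)
next
  case (Suc p)
  have "\<exists>s L. strict_mono (s :: nat \<Rightarrow> nat) \<and>
    (\<forall>i<p. real_distribution (L i) \<and> weak_conv_m (M i \<circ> s) (L i))"
    by (rule Suc.IH) (rule Suc.prems, simp)
  then obtain s L where s: "strict_mono (s :: nat \<Rightarrow> nat)"
    "\<And>i. i < p \<Longrightarrow> real_distribution (L i) \<and> weak_conv_m (M i \<circ> s) (L i)" by blast
  obtain r K where r: "strict_mono r" "real_distribution K" "weak_conv_m (M p \<circ> s \<circ> r) K"
    using tight_imp_convergent_subsubsequence[OF Suc.prems[of p] s(1)] by auto
  have "weak_conv_m (M i \<circ> (s \<circ> r)) (L i)" if "i < p" for i
    using weak_conv_m_subseq[of "M i \<circ> s" "L i" r] s(2)[OF that] r(1) by (simp add: comp_assoc)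
  moreover have "weak_conv_m (M p \<circ> (s \<circ> r)) K" using r(3) by (simp only: comp_assoc)
  ultimately have "\<forall>i<Suc p. real_distribution ((L(p := K)) i) \<and> weak_conv_m (M i \<circ> (s \<circ> r)) ((L(p := K)) i)"
    using s(2) r(2) unfolding less_Suc_eq by (simp del: comp_apply add: fun_upd_apply)
  moreover have "strict_mono (s \<circ> r)" using s(1) r(1) by (rule strict_mono_o)
  ultimately show ?case by blast
qed

text \<open>
  The test function \<open>f\<close> vanishes exactly on the interval.
\<close>

lemma weak_limit_support:
  assumes M: "\<And>j. real_distribution (M j)" and L: "real_distribution L" and conv: "weak_conv_m M L"
    and supp: "\<And>j. measure (M j) {a..b} = 1"
  shows "AE x in L. x \<in> {a..b}"
proof -
  interpret L: real_distribution L by (rule L)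
  define f where "f = (\<lambda>x. min 1 (max 0 (a - x) + max 0 (x - b)))"
  have f0: "f x = 0 \<longleftrightarrow> x \<in> {a..b}" for x by (auto simp: f_def min_def max_def split: if_splits)
  have fb: "0 \<le> f x" "f x \<le> 1" for x by (auto simp: f_def)
  have cont: "isCont f x" for x unfolding f_def by (intro continuous_intros)
  have [measurable]: "f \<in> borel_measurable borel"
    by (rule borel_measurable_isCont[OF cont])
  have "(\<lambda>j. integral\<^sup>L (M j) f) \<longlonglongrightarrow> integral\<^sup>L L f"
    by (rule weak_conv_imp_integral_bdd_continuous_conv[OF M L conv cont, where B = 1]) (use fb in auto)
  moreover have "integral\<^sup>L (M j) f = 0" for j
  proof -
    interpret real_distribution "M j" by (rule M)
    have "AE x in M j. x \<in> {a..b}" using supp[of j] by (subst AE_in_set_eq_1) auto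
    hence "AE x in M j. f x = 0" by eventually_elim (simp add: f0)
    thus ?thesis by (simp add: integral_eq_zero_AE)
  qed
  ultimately have "integral\<^sup>L L f = 0" by (simp add: LIMSEQ_const_iff)
  moreover have "integrable L f"
    by (rule L.integrable_const_bound[where B = 1]) (use fb in auto)
  ultimately have "AE x in L. f x = 0"
    using fb by (subst (asm) integral_nonneg_eq_0_iff_AE) auto
  thus ?thesis by eventually_elim (simp add: f0)
qed

lemma AE_window_measure_not_atoms:
  assumes D: "countable D"
  shows "AE w in window_measure T. fst w \<notin> D \<and> fst w + snd w \<notin> D \<and> snd w > 0"
proof -
  have D_borel [measurable]: "D \<in> sets borel" by (rule sets.countable) (use D in auto)
  have "AE w in lborel \<Otimes>\<^sub>M lborel. fst w \<notin> D \<and> fst w + snd w \<notin> D"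
  proof (rule lborel_pair.AE_pair_measure)
    show "{w \<in> space (lborel \<Otimes>\<^sub>M lborel). fst w \<notin> D \<and> fst w + snd w \<notin> D} \<in> sets (lborel \<Otimes>\<^sub>M lborel)"
      by measurable
    have 1: "AE u in lborel. u \<notin> D"
      using countable_imp_null_set_lborel[OF D] by (rule AE_not_in)
    have 2: "AE t in lborel. u + t \<notin> D" for u :: real
    proof -
      have "AE t in lborel. t \<notin> (\<lambda>d. d - u) ` D"
        using D by (intro AE_not_in countable_imp_null_set_lborel countable_image)
      thus ?thesis by eventually_elim force
    qed
    show "AE u in lborel. AE t in lborel. fst (u, t) \<notin> D \<and> fst (u, t) + snd (u, t) \<notin> D"
      using 1 by eventually_elim (use 2 in auto)
  qed
  hence "AE w in lborel \<Otimes>\<^sub>M lborel. 0 < ennreal (interval_rate T (snd w)) \<longrightarrow>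
     fst w \<notin> D \<and> fst w + snd w \<notin> D \<and> snd w > 0"
    by eventually_elim (auto simp: interval_rate_def split: if_splits)
  thus ?thesis unfolding window_measure_def by (subst AE_density) auto
qed

text \<open>
  The boundary of a window consists of its two end points, and almost no window has an end point
  in the countable set of atoms of the limits.
\<close>

lemma windows_weak_conv:
  fixes p :: nat
  assumes M: "\<And>i j. i < p \<Longrightarrow> real_distribution (M i j)" and L: "\<And>i. i < p \<Longrightarrow> real_distribution (L i)"
    and conv: "\<And>i. i < p \<Longrightarrow> weak_conv_m (M i) (L i)"
  shows "AE w in window_measure T. snd w > 0 \<and> (\<forall>i<p. (\<lambda>j. measure (M i j) (window w)) \<longlonglongrightarrow> measure (L i) (window w))"
proof -
  define D where "D = (\<Union>i<p. {x. measure (L i) {x} \<noteq> 0})"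
  have "countable {x. measure (L i) {x} \<noteq> 0}" if "i < p" for i
  proof -
    interpret real_distribution "L i" by (rule L[OF that])
    show ?thesis by (rule countable_support)
  qed
  hence "countable D" unfolding D_def by (intro countable_UN) auto
  from AE_window_measure_not_atoms[OF this] show ?thesis
  proof eventually_elim
    case (elim w)
    have "(\<lambda>j. measure (M i j) (window w)) \<longlonglongrightarrow> measure (L i) (window w)" if i: "i < p" for i
    proof (rule weak_conv_imp_continuity_set_conv[OF M[OF i] L[OF i] conv[OF i]])
      interpret real_distribution "L i" by (rule L[OF i])
      have "{fst w, fst w + snd w} = {fst w} \<union> {fst w + snd w}" by auto
      hence "measure (L i) {fst w, fst w + snd w} \<le> measure (L i) {fst w} + measure (L i) {fst w + snd w}"
        using measure_Un_le[of "{fst w}" "L i" "{fst w + snd w}"] by simp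
      moreover have "measure (L i) {fst w} = 0" "measure (L i) {fst w + snd w} = 0"
        using elim i by (auto simp: D_def)
      ultimately have "measure (L i) {fst w, fst w + snd w} = 0" by (simp add: measure_le_0_iff)
      moreover have "frontier (window w) = {fst w, fst w + snd w}"
        using elim by (simp add: window_def frontier_def)
      ultimately show "emeasure (L i) (frontier (window w)) = 0"
        by (simp add: emeasure_eq_measure)
    qed simp
    thus ?case using elim by simp
  qed
qed

context angelesco_system
begin

lemma scaled_energy_integrand_measurable:
  assumes "\<And>i. i < p \<Longrightarrow> real_distribution (M i)"
  shows "(\<lambda>w. ennreal (form (\<lambda>i. c i * measure (M i) (window w))) * indicator {s..} (snd w))
    \<in> borel_measurable (window_measure T)"
proof -
  have "(\<lambda>w. form (\<lambda>i. c i * measure (M i) (window w))) \<in> borel_measurable (borel \<Otimes>\<^sub>M borel)"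
  proof (intro interaction_form_measurable borel_measurable_times borel_measurable_const)
    fix i assume "i < p"
    then interpret real_distribution "M i" by (rule assms)
    show "(\<lambda>w. measure (M i) (window w)) \<in> borel_measurable (borel \<Otimes>\<^sub>M borel)"
      by (rule measure_window_measurable) (simp_all add: finite_measure_axioms)
  qed
  moreover have "(\<lambda>w. indicator {s..} (snd w) :: ennreal) \<in> borel_measurable (borel \<Otimes>\<^sub>M borel)"
    by (rule measurable_compose[OF measurable_snd]) measurable
  ultimately show ?thesis
    by (intro window_measure_measurable borel_measurable_times_ennreal measurable_compose[OF _ measurable_ennreal])
qed

text \<open>
  Fatou's lemma, in a form that allows the short windows to be left out along the sequence as long as every
  window is eventually taken into account.
\<close>

lemma energy_lower_semicontinuous:
  assumes M: "\<And>i j. i < p \<Longrightarrow> real_distribution (M i j)" and L: "\<And>i. i < p \<Longrightarrow> real_distribution (L i)"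
    and conv: "\<And>i. i < p \<Longrightarrow> weak_conv_m (M i) (L i)"
    and c: "\<And>i. i < p \<Longrightarrow> (\<lambda>j. c i j) \<longlonglongrightarrow> r i" and t: "t \<longlonglongrightarrow> (0::real)"
  shows "(\<integral>\<^sup>+w. ennreal (form (\<lambda>i. r i * measure (L i) (window w))) \<partial>window_measure T) \<le>
    liminf (\<lambda>j. \<integral>\<^sup>+w. ennreal (form (\<lambda>i. c i j * measure (M i j) (window w))) * indicator {t j..} (snd w) \<partial>window_measure T)"
proof -
  have AE: "AE w in window_measure T. snd w > 0 \<and>
      (\<forall>i<p. (\<lambda>j. measure (M i j) (window w)) \<longlonglongrightarrow> measure (L i) (window w))"
    by (rule windows_weak_conv[OF M L conv])
  define u where "u = (\<lambda>j w. ennreal (form (\<lambda>i. c i j * measure (M i j) (window w))) * indicator {t j..} (snd w))"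
  have u: "u j \<in> borel_measurable (window_measure T)" for j
    unfolding u_def by (rule scaled_energy_integrand_measurable) (rule M)
  have "(\<integral>\<^sup>+w. ennreal (form (\<lambda>i. r i * measure (L i) (window w))) \<partial>window_measure T) \<le>
    (\<integral>\<^sup>+w. liminf (\<lambda>j. u j w) \<partial>window_measure T)"
  proof (rule nn_integral_mono_AE, use AE in eventually_elim)
    case (elim w)
    have "(\<lambda>j. ennreal (form (\<lambda>i. c i j * measure (M i j) (window w)))) \<longlonglongrightarrow>
      ennreal (form (\<lambda>i. r i * measure (L i) (window w)))"
      unfolding interaction_form_def using elim c
      by (intro tendsto_ennrealI tendsto_add tendsto_sum tendsto_power tendsto_mult) auto
    moreover have "eventually (\<lambda>j. t j < snd w) sequentially"
      using t elim by (intro order_tendstoD) auto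
    hence "eventually (\<lambda>j. ennreal (form (\<lambda>i. c i j * measure (M i j) (window w))) = u j w) sequentially"
      by eventually_elim (simp add: u_def)
    ultimately have "(\<lambda>j. u j w) \<longlonglongrightarrow> ennreal (form (\<lambda>i. r i * measure (L i) (window w)))"
      by (rule Lim_transform_eventually)
    thus ?case by (simp add: lim_imp_Liminf)
  qed
  also have "\<dots> \<le> liminf (\<lambda>j. integral\<^sup>N (window_measure T) (u j))"
    by (rule nn_integral_liminf) (rule u)
  finally show ?thesis by (simp add: u_def)
qed

definition block_empirical :: "(nat \<Rightarrow> nat) \<Rightarrow> (nat \<Rightarrow> real) \<Rightarrow> nat \<Rightarrow> real measure" where
  "block_empirical n X i = normalized_counting_measure (n i) (block_vec n X i)"

lemma block_sum_eq:
  fixes g :: "real \<Rightarrow> real"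
  assumes "i < p"
  shows "(\<Sum>k<multi_size p n. if block_of n k = i then g (X k) else 0) = (\<Sum>k<n i. g (block_vec n X i k))"
proof -
  have "(\<Sum>k<multi_size p n. if block_of n k = i then g (X k) else 0) =
    (\<Sum>j<p. \<Sum>k<n j. if j = i then g (block_vec n X i k) else 0)"
    unfolding sum.blocks by (intro sum.cong refl) (simp add: block_of_offset block_vec_def)
  also have "\<dots> = (\<Sum>j<p. if j = i then (\<Sum>k<n i. g (block_vec n X i k)) else 0)"
    by (intro sum.cong) auto
  finally show ?thesis using assms by simp
qed

lemma block_vec_in:
  assumes "X \<in> configurations n" "i < p" "k < n i"
  shows "block_vec n X i k \<in> \<Gamma> i"
proof -
  have "(\<Sum>j<i. n j) + k < (\<Sum>j<Suc i. n j)" using assms(3) by simp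
  also have "\<dots> \<le> multi_size p n" unfolding multi_size_def using assms(2) by (intro sum_mono2) auto
  finally show ?thesis
    using configurationsD(2)[OF assms(1), of "(\<Sum>j<i. n j) + k"] block_of_offset[of k n i, OF assms(3)]
    by (simp add: block_vec_def)
qed

text \<open>
  The interaction form of the counts in a window counts the pairs and the single points in it.  The pairs
  yield the discrete energy, the points their self-energy, which windows of length at least \<open>s\<close> keep finite.
\<close>

lemma truncated_energy_le:
  assumes X: "X \<in> configurations n" and n: "\<And>i. i < p \<Longrightarrow> n i > 0" and s: "0 < s" "s \<le> T"
  shows "(\<integral>\<^sup>+w. ennreal (form (\<lambda>i. real (n i) * measure (block_empirical n X i) (window w))) * indicator {s..} (snd w) \<partial>window_measure T)
    \<le> discrete_energy n X + ennreal (real (multi_size p n) * (2 * (ln (2 * T / s) + 1)))"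
proof -
  define N where "N = multi_size p n"
  define y where "y = (\<lambda>w k. indicator (window w) (X k) :: real)"
  define g where "g = (\<lambda>k l w. indicator (window w) (X k) * indicator (window w) (X l) :: ennreal)"
  define h where "h = (\<lambda>k w. indicator (window w) (X k) * indicator {s..} (snd w) :: ennreal)"
  have cnt: "form (\<lambda>i. real (n i) * measure (block_empirical n X i) (window w)) =
    pair_sum n N (\<lambda>k l. y w k * y w l) + (\<Sum>k<N. (y w k)\<^sup>2)" for w
  proof -
    have "real (n i) * measure (block_empirical n X i) (window w) =
       (\<Sum>k<multi_size p n. if block_of n k = i then y w k else 0)" if "i < p" for i
      unfolding y_def block_sum_eq[OF that] block_empirical_def using n[OF that]
      by (simp add: measure_normalized_counting_measure)
    hence "form (\<lambda>i. real (n i) * measure (block_empirical n X i) (window w)) =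
      form (\<lambda>i. \<Sum>k<multi_size p n. if block_of n k = i then y w k else 0)"
      by (intro interaction_form_cong)
    thus ?thesis unfolding interaction_form_block_sums N_def .
  qed
  have [measurable]: "(\<lambda>w. indicator (window w) x :: ennreal) \<in> borel_measurable (window_measure T)" for x
    by (intro window_measure_measurable) measurable
  have [measurable]: "(\<lambda>w. indicator {s..} (snd w) :: ennreal) \<in> borel_measurable (window_measure T)"
    by (intro window_measure_measurable measurable_compose[OF measurable_snd]) measurable
  have g_meas: "g k l \<in> borel_measurable (window_measure T)" for k l unfolding g_def by measurable
  have h_meas: "h k \<in> borel_measurable (window_measure T)" for k unfolding h_def by measurable
  have "(\<integral>\<^sup>+w. ennreal (form (\<lambda>i. real (n i) * measure (block_empirical n X i) (window w))) * indicator {s..} (snd w) \<partial>window_measure T)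
    \<le> (\<integral>\<^sup>+w. pair_sum n N (\<lambda>k l. g k l w) + (\<Sum>k<N. h k w) \<partial>window_measure T)"
  proof (rule nn_integral_mono)
    fix w
    have "pair_sum n N (\<lambda>k l. g k l w) = pair_sum n N (\<lambda>k l. ennreal (y w k * y w l))"
      by (rule pair_sum_cong) (auto simp: g_def y_def indicator_def)
    also have "\<dots> = ennreal (pair_sum n N (\<lambda>k l. y w k * y w l))"
      by (rule ennreal_pair_sum) (simp add: y_def)
    finally have 1: "ennreal (pair_sum n N (\<lambda>k l. y w k * y w l)) = pair_sum n N (\<lambda>k l. g k l w)" ..
    have "ennreal (\<Sum>k<N. (y w k)\<^sup>2) = (\<Sum>k<N. ennreal ((y w k)\<^sup>2))" by (rule sum_ennreal[symmetric]) simp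
    also have "\<dots> = (\<Sum>k<N. indicator (window w) (X k))"
      by (intro sum.cong) (auto simp: y_def indicator_def)
    finally have 2: "ennreal (\<Sum>k<N. (y w k)\<^sup>2) = (\<Sum>k<N. indicator (window w) (X k))" .
    have "ennreal (form (\<lambda>i. real (n i) * measure (block_empirical n X i) (window w))) =
      pair_sum n N (\<lambda>k l. g k l w) + (\<Sum>k<N. indicator (window w) (X k))"
      unfolding cnt 1[symmetric] 2[symmetric]
      by (rule ennreal_plus) (auto intro!: sum_nonneg pair_sum_nonneg simp: y_def)
    thus "ennreal (form (\<lambda>i. real (n i) * measure (block_empirical n X i) (window w))) * indicator {s..} (snd w) \<le>
      pair_sum n N (\<lambda>k l. g k l w) + (\<Sum>k<N. h k w)"
      by (cases "s \<le> snd w") (auto simp: h_def)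
  qed
  also have "\<dots> = (\<integral>\<^sup>+w. pair_sum n N (\<lambda>k l. g k l w) \<partial>window_measure T) + (\<integral>\<^sup>+w. (\<Sum>k<N. h k w) \<partial>window_measure T)"
    by (intro nn_integral_add borel_measurable_pair_sum borel_measurable_sum g_meas h_meas)
  also have "(\<integral>\<^sup>+w. pair_sum n N (\<lambda>k l. g k l w) \<partial>window_measure T) = discrete_energy n X"
    unfolding nn_integral_pair_sum[OF g_meas] by (simp add: discrete_energy_def window_kernel_def N_def g_def)
  also have "(\<integral>\<^sup>+w. (\<Sum>k<N. h k w) \<partial>window_measure T) = (\<Sum>k<N. \<integral>\<^sup>+w. h k w \<partial>window_measure T)"
    by (intro nn_integral_sum h_meas)
  also have "\<dots> \<le> (\<Sum>k<N. ennreal (2 * (ln (2 * T / s) + 1)))"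
    unfolding h_def by (intro sum_mono window_kernel_truncated_diag s)
  also have "\<dots> = ennreal (real N * (2 * (ln (2 * T / s) + 1)))"
    by (simp add: ennreal_mult' ennreal_of_nat_eq_real_of_nat)
  finally show ?thesis by (simp add: N_def add_left_mono)
qed

text \<open>
  With the cut-off \<open>1 / N\<close> the \<open>N\<close> self-energies are of order \<open>N ln N\<close>, negligible against
  \<open>N\<^sup>2\<close>.
\<close>

lemma normalized_truncated_energy_le:
  assumes X: "X \<in> configurations n" and n: "\<And>i. i < p \<Longrightarrow> n i > 0" and u: "u \<ge> 0"
    and le: "discrete_energy n X \<le> ennreal ((real (multi_size p n))\<^sup>2 * u)"
  defines "x \<equiv> real (multi_size p n)"
  shows "(\<integral>\<^sup>+w. ennreal (form (\<lambda>i. real (n i) / x * measure (block_empirical n X i) (window w)))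
      * indicator {1 / x..} (snd w) \<partial>window_measure T) \<le> ennreal (u + 2 * (ln (2 * T * x) + 1) / x)"
proof -
  have x: "x \<ge> 1" using multi_size_pos[of n, OF n] by (simp add: x_def)
  have s: "0 < 1 / x" "1 / x \<le> T"
  proof -
    have "1 / x \<le> 1" using x by simp
    thus "1 / x \<le> T" using T_ge(1) by linarith
  qed (use x in simp)
  have "2 * T * x \<ge> 1 * 1" using T_ge x by (intro mult_mono) auto
  hence ln_nonneg: "ln (2 * T * x) + 1 \<ge> 0" by simp
  let ?F = "\<lambda>w. ennreal (form (\<lambda>i. real (n i) * measure (block_empirical n X i) (window w))) * indicator {1 / x..} (snd w)"
  have "(\<integral>\<^sup>+w. ennreal (form (\<lambda>i. real (n i) / x * measure (block_empirical n X i) (window w)))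
      * indicator {1 / x..} (snd w) \<partial>window_measure T) = (\<integral>\<^sup>+w. ennreal ((1 / x)\<^sup>2) * ?F w \<partial>window_measure T)"
  proof (rule nn_integral_cong)
    fix w
    have "form (\<lambda>i. real (n i) / x * measure (block_empirical n X i) (window w)) =
      (1 / x)\<^sup>2 * form (\<lambda>i. real (n i) * measure (block_empirical n X i) (window w))"
      unfolding interaction_form_scale[symmetric] by (intro interaction_form_cong) simp
    thus "ennreal (form (\<lambda>i. real (n i) / x * measure (block_empirical n X i) (window w)))
      * indicator {1 / x..} (snd w) = ennreal ((1 / x)\<^sup>2) * ?F w"
      by (simp only: mult.assoc[symmetric]) (subst ennreal_mult, simp_all add: interaction_form_nonneg)
  qed
  also have "\<dots> = ennreal ((1 / x)\<^sup>2) * (\<integral>\<^sup>+w. ?F w \<partial>window_measure T)"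
    using n by (intro nn_integral_cmult scaled_energy_integrand_measurable)
      (simp add: block_empirical_def real_distribution_normalized_counting_measure)
  also have "\<dots> \<le> ennreal ((1 / x)\<^sup>2) * (discrete_energy n X + ennreal (x * (2 * (ln (2 * T / (1 / x)) + 1))))"
    using truncated_energy_le[OF X n s] unfolding x_def by (intro mult_left_mono) auto
  also have "\<dots> \<le> ennreal ((1 / x)\<^sup>2) * (ennreal (x\<^sup>2 * u) + ennreal (x * (2 * (ln (2 * T * x) + 1))))"
    using le by (intro mult_left_mono add_mono) (auto simp: x_def)
  also have "\<dots> = ennreal ((1 / x)\<^sup>2 * (x\<^sup>2 * u + x * (2 * (ln (2 * T * x) + 1))))"
  proof -
    have "0 \<le> x\<^sup>2 * u" "0 \<le> x * (2 * (ln (2 * T * x) + 1))" using u x ln_nonneg by auto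
    thus ?thesis by (simp only: ennreal_plus[symmetric]) (rule ennreal_mult[symmetric], auto)
  qed
  also have "(1 / x)\<^sup>2 * (x\<^sup>2 * u + x * (2 * (ln (2 * T * x) + 1))) = u + 2 * (ln (2 * T * x) + 1) / x"
  proof -
    have "(1 / x)\<^sup>2 * (x\<^sup>2 * u + x * v) = u + v / x" for v
      using x by (simp add: field_simps power2_eq_square)
    thus ?thesis by simp
  qed
  finally show ?thesis .
qed

lemma average_block_empirical:
  fixes f :: "real \<Rightarrow> real"
  assumes n: "\<And>i. i < p \<Longrightarrow> n i > 0" and f: "f \<in> borel_measurable borel"
  shows "(\<Sum>k<multi_size p n. f (X k)) / real (multi_size p n) =
    (\<Sum>i<p. real (n i) / real (multi_size p n) * (\<integral>x. f x \<partial>block_empirical n X i))"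
proof -
  have "(\<Sum>k<multi_size p n. f (X k)) = (\<Sum>i<p. \<Sum>k<n i. f (block_vec n X i k))"
    unfolding sum.blocks by (simp add: block_vec_def)
  also have "\<dots> = (\<Sum>i<p. real (n i) * (\<integral>x. f x \<partial>block_empirical n X i))"
    unfolding block_empirical_def using n by (intro sum.cong) (auto simp: integral_normalized_counting_measure[OF f])
  finally show ?thesis by (simp add: sum_divide_distrib)
qed

end

section \<open>The energy gap\<close>

context angelesco_system
begin

text \<open>
  Along a subsequence the empirical measures of all blocks converge, by Helly's theorem.  The block
  \<open>i\<close> contains a fraction of the points that tends to \<open>r i\<close>, so the limits weighted by \<open>r i\<close>
  form an admissible tuple, whose energy is controlled by lower semicontinuity.
\<close>

lemma limit_of_low_energy_configurations:
  fixes n :: "nat \<Rightarrow> nat \<Rightarrow> nat" and X :: "nat \<Rightarrow> nat \<Rightarrow> real" and u :: "nat \<Rightarrow> real"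
  assumes n_pos: "\<And>j i. i < p \<Longrightarrow> n j i > 0"
    and size: "filterlim (\<lambda>j. multi_size p (n j)) at_top sequentially"
    and ratio: "\<And>i. i < p \<Longrightarrow> (\<lambda>j. real (n j i) / real (multi_size p (n j))) \<longlonglongrightarrow> r i"
    and X: "\<And>j. X j \<in> configurations (n j)"
    and u: "\<And>j. u j \<ge> 0" "u \<longlonglongrightarrow> e"
    and low: "\<And>j. discrete_energy (n j) (X j) \<le> ennreal ((real (multi_size p (n j)))\<^sup>2 * u j)"
  shows "\<exists>s \<nu>. strict_mono s \<and> admissible \<nu> \<and> energy \<nu> \<le> ennreal e \<and>
    (\<forall>f :: real \<Rightarrow> real. \<forall>B. (\<forall>x. isCont f x) \<and> (\<forall>x. \<bar>f x\<bar> \<le> B) \<longrightarrow>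
      (\<lambda>j. (\<Sum>k<multi_size p (n (s j)). f (X (s j) k)) / real (multi_size p (n (s j))))
        \<longlonglongrightarrow> (\<Sum>i<p. \<integral>x. f x \<partial>\<nu> i))"
proof -
  define M where "M = (\<lambda>i j. block_empirical (n j) (X j) i)"
  have M_dist: "real_distribution (M i j)" if "i < p" for i j
    unfolding M_def block_empirical_def
    by (rule real_distribution_normalized_counting_measure[OF n_pos[OF that]])
  have M_supp: "measure (M i j) (\<Gamma> i) = 1" if i: "i < p" for i j
  proof -
    have "(\<Sum>k<n j i. indicator (\<Gamma> i) (block_vec (n j) (X j) i k) :: real) = (\<Sum>k<n j i. 1)"
      using block_vec_in[OF X i] by (intro sum.cong) (auto simp: indicator_def)
    thus ?thesis unfolding M_def block_empirical_def using n_pos[OF i, of j]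
      by (simp add: measure_normalized_counting_measure)
  qed
  have "\<exists>s L. strict_mono (s :: nat \<Rightarrow> nat) \<and>
    (\<forall>i<p. real_distribution (L i) \<and> weak_conv_m (M i \<circ> s) (L i))"
    by (intro simultaneous_weak_limit tight_on_interval[OF M_dist M_supp])
  then obtain s L where s: "strict_mono (s :: nat \<Rightarrow> nat)"
    and L: "\<And>i. i < p \<Longrightarrow> real_distribution (L i)" and conv: "\<And>i. i < p \<Longrightarrow> weak_conv_m (M i \<circ> s) (L i)"
    by blast
  have M'_dist: "real_distribution ((M i \<circ> s) j)" if "i < p" for i j using M_dist[OF that] by simp
  have L_supp: "AE x in L i. x \<in> \<Gamma> i" if i: "i < p" for i
    by (rule weak_limit_support[OF M'_dist[OF i] L[OF i] conv[OF i]]) (simp add: M_supp[OF i])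
  define \<nu> where "\<nu> = (\<lambda>i. scale_measure (ennreal (r i)) (L i))"
  have \<nu>_measure: "measure (\<nu> i) A = r i * measure (L i) A" if "i < p" for i A
    unfolding \<nu>_def measure_def using r_pos[OF that] by (simp add: enn2real_mult)
  have adm: "admissible \<nu>"
    unfolding admissible_def finite_borel_measure_on_def
  proof (intro allI impI conjI)
    fix i assume i: "i < p"
    interpret Li: real_distribution "L i" by (rule L[OF i])
    show "sets (\<nu> i) = sets borel" by (simp add: \<nu>_def)
    show "finite_measure (\<nu> i)"
      by (rule finite_measureI) (simp add: \<nu>_def space_scale_measure ennreal_mult_eq_top_iff)
    show "measure (\<nu> i) UNIV = r i" using Li.prob_space by (simp add: \<nu>_measure[OF i])
    have "emeasure (L i) (- \<Gamma> i) = 0"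
      using L_supp[OF i] AE_iff_null_sets[of "- \<Gamma> i" "L i"] by (auto simp: null_sets_def)
    thus "emeasure (\<nu> i) (- \<Gamma> i) = 0" by (simp add: \<nu>_def)
  qed
  define x where "x = (\<lambda>j. real (multi_size p (n (s j))))"
  define c where "c = (\<lambda>i j. real (n (s j) i) / x j)"
  have c: "(\<lambda>j. c i j) \<longlonglongrightarrow> r i" if "i < p" for i
    using LIMSEQ_subseq_LIMSEQ[OF ratio[OF that] s] by (simp add: c_def x_def comp_def)
  have x_top: "filterlim x at_top sequentially"
    unfolding x_def
    by (rule filterlim_compose[OF filterlim_real_sequentially filterlim_compose[OF size filterlim_subseq[OF s]]])
  define \<delta> where "\<delta> = (\<lambda>j. 2 * (ln (2 * T * x j) + 1) / x j)"
  have "energy \<nu> = (\<integral>\<^sup>+w. ennreal (form (\<lambda>i. r i * measure (L i) (window w))) \<partial>window_measure T)"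
    unfolding window_energy_def
    by (intro nn_integral_cong arg_cong[where f = ennreal] interaction_form_cong) (simp add: \<nu>_measure)
  also have "\<dots> \<le> liminf (\<lambda>j. \<integral>\<^sup>+w. ennreal (form (\<lambda>i. c i j * measure ((M i \<circ> s) j) (window w)))
     * indicator {1 / x j..} (snd w) \<partial>window_measure T)"
    by (rule energy_lower_semicontinuous[OF M'_dist L conv c
          tendsto_divide_0[OF tendsto_const filterlim_at_top_imp_at_infinity[OF x_top]]])
  also have "\<dots> \<le> liminf (\<lambda>j. ennreal (u (s j) + \<delta> j))"
    using normalized_truncated_energy_le[OF X n_pos u(1) low, of "s j" for j]
    by (intro Liminf_mono always_eventually allI) (simp add: c_def x_def M_def \<delta>_def)
  also have "\<dots> = ennreal e"
  proof -
    have "((\<lambda>x. 2 * (ln (2 * T * x) + 1) / x) \<longlongrightarrow> 0) at_top" using T_pos by real_asymp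
    from filterlim_compose[OF this x_top] have "\<delta> \<longlonglongrightarrow> 0" by (simp add: \<delta>_def)
    moreover have "(\<lambda>j. u (s j)) \<longlonglongrightarrow> e" using LIMSEQ_subseq_LIMSEQ[OF u(2) s] by (simp add: comp_def)
    ultimately have "(\<lambda>j. ennreal (u (s j) + \<delta> j)) \<longlonglongrightarrow> ennreal (e + 0)"
      by (intro tendsto_ennrealI tendsto_add)
    thus ?thesis by (simp add: lim_imp_Liminf)
  qed
  finally have low_limit: "energy \<nu> \<le> ennreal e" .
  have "(\<lambda>j. (\<Sum>k<multi_size p (n (s j)). f (X (s j) k)) / real (multi_size p (n (s j))))
        \<longlonglongrightarrow> (\<Sum>i<p. \<integral>x. f x \<partial>\<nu> i)"
    if f: "\<And>x. isCont f x" "\<And>x. \<bar>f x\<bar> \<le> B" for f :: "real \<Rightarrow> real" and B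
  proof -
    have f_meas: "f \<in> borel_measurable borel" by (rule borel_measurable_isCont[OF f(1)])
    have "(\<lambda>j. \<Sum>i<p. c i j * (\<integral>x. f x \<partial>(M i \<circ> s) j)) \<longlonglongrightarrow> (\<Sum>i<p. r i * (\<integral>x. f x \<partial>L i))"
    proof (intro tendsto_sum tendsto_mult c)
      fix i assume "i \<in> {..<p}"
      hence i: "i < p" by simp
      show "(\<lambda>j. \<integral>x. f x \<partial>(M i \<circ> s) j) \<longlonglongrightarrow> (\<integral>x. f x \<partial>L i)"
        by (rule weak_conv_imp_integral_bdd_continuous_conv[OF M'_dist[OF i] L[OF i] conv[OF i] f(1), where B = B])
           (simp add: f(2))
    qed auto
    also have "(\<Sum>i<p. r i * (\<integral>x. f x \<partial>L i)) = (\<Sum>i<p. \<integral>x. f x \<partial>\<nu> i)"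
    proof (intro sum.cong refl)
      fix i assume "i \<in> {..<p}"
      hence i: "i < p" by simp
      interpret real_distribution "L i" by (rule L[OF i])
      show "r i * (\<integral>x. f x \<partial>L i) = (\<integral>x. f x \<partial>\<nu> i)"
        unfolding \<nu>_def using r_pos[OF i] f_meas by (intro integral_scale_measure[symmetric]) auto
    qed
    finally show ?thesis
      unfolding c_def M_def x_def comp_def by (subst average_block_empirical[OF n_pos f_meas]) auto
  qed
  thus ?thesis using s adm low_limit by (intro exI[of _ s] exI[of _ \<nu>]) auto
qed

text \<open>
  Otherwise there are bad configurations of arbitrarily large size with energies at most
  \<open>N\<^sup>2 (e + 1 / (j + 1))\<close>.  Their limit is a minimizer, hence equal to \<open>\<mu>\<close>, although the
  averages of \<open>f\<close> stay away from those of \<open>\<mu>\<close>.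
\<close>

lemma energy_gap:
  fixes n :: "nat \<Rightarrow> nat \<Rightarrow> nat" and f :: "real \<Rightarrow> real"
  assumes \<mu>: "admissible \<mu>" and min: "\<And>\<nu>. admissible \<nu> \<Longrightarrow> energy \<mu> \<le> energy \<nu>"
    and e: "energy \<mu> = ennreal e" "e \<ge> 0"
    and n_pos: "\<And>d i. i < p \<Longrightarrow> n d i > 0"
    and size: "filterlim (\<lambda>d. multi_size p (n d)) at_top sequentially"
    and ratio: "\<And>i. i < p \<Longrightarrow> (\<lambda>d. real (n d i) / real (multi_size p (n d))) \<longlonglongrightarrow> r i"
    and f: "\<And>x. isCont f x" "\<And>x. \<bar>f x\<bar> \<le> B" and \<eta>: "\<eta> > 0"
  shows "\<exists>c>0. eventually (\<lambda>d. \<forall>X\<in>configurations (n d).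
    \<bar>(\<Sum>k<multi_size p (n d). f (X k)) / real (multi_size p (n d)) - (\<Sum>i<p. \<integral>x. f x \<partial>\<mu> i)\<bar> \<ge> \<eta> \<longrightarrow>
    discrete_energy (n d) X \<ge> ennreal ((real (multi_size p (n d)))\<^sup>2 * (e + c))) sequentially"
proof (rule ccontr)
  define N where "N = (\<lambda>d. multi_size p (n d))"
  define I where "I = (\<Sum>i<p. \<integral>x. f x \<partial>\<mu> i)"
  define bad where "bad = (\<lambda>c d X. X \<in> configurations (n d) \<and>
    \<bar>(\<Sum>k<N d. f (X k)) / real (N d) - I\<bar> \<ge> \<eta> \<and> discrete_energy (n d) X < ennreal ((real (N d))\<^sup>2 * (e + c)))"
  assume "\<not> ?thesis"
  hence "\<not> eventually (\<lambda>d. \<not> (\<exists>X. bad c d X)) sequentially" if "c > 0" for c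
  proof -
    have "(\<lambda>d. \<not> (\<exists>X. bad c d X)) = (\<lambda>d. \<forall>X\<in>configurations (n d).
      \<bar>(\<Sum>k<multi_size p (n d). f (X k)) / real (multi_size p (n d)) - (\<Sum>i<p. \<integral>x. f x \<partial>\<mu> i)\<bar> \<ge> \<eta> \<longrightarrow>
      discrete_energy (n d) X \<ge> ennreal ((real (multi_size p (n d)))\<^sup>2 * (e + c)))"
      by (auto simp: bad_def N_def I_def not_less fun_eq_iff)
    thus ?thesis using \<open>\<not> (\<exists>c>0. _ c)\<close> that by auto
  qed
  hence ex: "\<exists>d\<ge>j. \<exists>X. bad c d X" if "c > 0" for c j
    using that unfolding eventually_sequentially by blast
  have "\<forall>j. \<exists>d X. d \<ge> j \<and> bad (1 / real (Suc j)) d X"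
    using ex[of "1 / real (Suc j)" j for j] by auto
  then obtain D X where D: "\<And>j. D j \<ge> j" and X: "\<And>j. bad (1 / real (Suc j)) (D j) (X j)" by metis
  have conf: "X j \<in> configurations (n (D j))" for j using X[of j] by (simp add: bad_def)
  have D_top: "filterlim D at_top sequentially"
    by (rule filterlim_at_top_mono[OF filterlim_ident]) (simp add: D)
  have "(\<lambda>j. e + 1 / real (Suc j)) \<longlonglongrightarrow> e + 0"
    using LIMSEQ_inverse_real_of_nat by (intro tendsto_add tendsto_const) (simp add: inverse_eq_divide)
  have u0: "0 \<le> e + 1 / real (Suc j)" for j using e by simp
  from \<open>_ \<longlonglongrightarrow> e + 0\<close> have u: "(\<lambda>j. e + 1 / real (Suc j)) \<longlonglongrightarrow> e" by simp
  have low: "discrete_energy (n (D j)) (X j) \<le> ennreal ((real (multi_size p (n (D j))))\<^sup>2 * (e + 1 / real (Suc j)))" for j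
    using X[of j] unfolding bad_def N_def by (intro less_imp_le) blast
  obtain s \<nu> where s: "strict_mono s" and \<nu>: "admissible \<nu>" "energy \<nu> \<le> ennreal e"
    and lim: "\<And>f :: real \<Rightarrow> real. \<And>B. (\<forall>x. isCont f x) \<and> (\<forall>x. \<bar>f x\<bar> \<le> B) \<Longrightarrow>
      (\<lambda>j. (\<Sum>k<N (D (s j)). f (X (s j) k)) / real (N (D (s j)))) \<longlonglongrightarrow> (\<Sum>i<p. \<integral>x. f x \<partial>\<nu> i)"
    using limit_of_low_energy_configurations[of "\<lambda>j. n (D j)", OF n_pos filterlim_compose[OF size D_top]
        filterlim_compose[OF ratio D_top] conf u0 u low] unfolding N_def by blast
  have "\<nu> i = \<mu> i" if "i < p" for i
    using minimizer_unique[OF \<mu> \<nu>(1) min _ _ that] \<nu>(2) e by simp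
  hence "(\<Sum>i<p. \<integral>x. f x \<partial>\<nu> i) = I" by (simp add: I_def)
  with lim[of f B] f have "(\<lambda>j. (\<Sum>k<N (D (s j)). f (X (s j) k)) / real (N (D (s j)))) \<longlonglongrightarrow> I" by simp
  hence "eventually (\<lambda>j. dist ((\<Sum>k<N (D (s j)). f (X (s j) k)) / real (N (D (s j)))) I < \<eta>) sequentially"
    using \<eta> by (rule tendstoD)
  then obtain j where "dist ((\<Sum>k<N (D (s j)). f (X (s j) k)) / real (N (D (s j)))) I < \<eta>"
    by (auto simp: eventually_sequentially)
  with X[of "s j"] show False by (simp add: bad_def dist_real_def)
qed

end

section \<open>Deviation probabilities and almost sure convergence\<close>

text \<open>
  The factor lost in the lower bound for the partition function is \<open>exp (2 \<epsilon> N\<^sup>2)\<close> up to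
  a factor \<open>exp (O (N ln N))\<close>.
\<close>

lemma normalization_le:
  fixes C \<epsilon> :: real
  assumes "C > 0" "\<epsilon> > 0" "N > 0"
  shows "(C * (1 + \<epsilon>) ^ (2 * N)) ^ N * fact N \<le>
    exp (real N * (ln C + ln (real N)) + 2 * (real N)\<^sup>2 * \<epsilon>)"
proof -
  have pow: "y ^ N = exp (real N * ln y)" if "y > 0" for y :: real
    using that by (simp add: exp_of_nat_mult)
  have "(C * (1 + \<epsilon>) ^ (2 * N)) ^ N = C ^ N * (1 + \<epsilon>) ^ (2 * N * N)"
    by (simp add: power_mult_distrib power_mult)
  also have "\<dots> \<le> exp (real N * ln C) * exp \<epsilon> ^ (2 * N * N)"
    using assms pow[of C] exp_ge_add_one_self[of \<epsilon>] by (intro mult_mono power_mono) auto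
  also have "exp \<epsilon> ^ (2 * N * N) = exp (2 * (real N)\<^sup>2 * \<epsilon>)"
    by (simp add: power2_eq_square flip: exp_of_nat_mult)
  finally have A: "(C * (1 + \<epsilon>) ^ (2 * N)) ^ N \<le> exp (real N * ln C) * exp (2 * (real N)\<^sup>2 * \<epsilon>)" .
  have "fact N \<le> real (N ^ N)" by (rule fact_le_power)
  also have "\<dots> = exp (real N * ln (real N))" using pow[of "real N"] assms by simp
  finally have "fact N \<le> exp (real N * ln (real N))" .
  with A have "(C * (1 + \<epsilon>) ^ (2 * N)) ^ N * fact N \<le>
      exp (real N * ln C) * exp (2 * (real N)\<^sup>2 * \<epsilon>) * exp (real N * ln (real N))"
    by (intro mult_mono) auto
  also have "\<dots> = exp (real N * (ln C + ln (real N)) + 2 * (real N)\<^sup>2 * \<epsilon>)"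
    by (simp add: algebra_simps flip: exp_add)
  finally show ?thesis .
qed

context angelesco_system
begin

text \<open>
  The gap \<open>c\<close> beats all losses.  Replacing the proportions \<open>n i / N\<close> by \<open>(1 + \<delta>) r i\<close> costs at
  most \<open>c / 8\<close> on the scale of \<open>N\<^sup>2\<close>, the Bernstein--Markov factor with \<open>\<epsilon> = c / 16\<close> costs
  \<open>c / 8\<close>, and the factors \<open>C^N\<close>, \<open>m^N\<close> and \<open>N!\<close> eventually cost at most \<open>c / 4\<close>.
  What remains is \<open>c / 2\<close>.
\<close>

lemma deviation_probability:
  fixes n :: "nat \<Rightarrow> nat \<Rightarrow> nat" and f :: "real \<Rightarrow> real"
  assumes \<mu>: "admissible \<mu>" and min: "\<And>\<nu>. admissible \<nu> \<Longrightarrow> energy \<mu> \<le> energy \<nu>"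
    and n_pos: "\<And>d i. i < p \<Longrightarrow> n d i > 0"
    and size: "filterlim (\<lambda>d. multi_size p (n d)) at_top sequentially"
    and ratio: "\<And>i. i < p \<Longrightarrow> (\<lambda>d. real (n d i) / real (multi_size p (n d))) \<longlonglongrightarrow> r i"
    and \<tau>: "\<And>i. i < p \<Longrightarrow> finite_borel_measure_on (\<Gamma> i) (\<tau> i)"
    and BM: "\<And>i. i < p \<Longrightarrow> BM_inequality (\<Gamma> i) (\<tau> i)"
    and P: "\<And>d. is_angelesco_ensemble p \<tau> (n d) (P d)"
    and f: "\<And>x. isCont f x" "\<And>x. \<bar>f x\<bar> \<le> B" and \<eta>: "\<eta> > 0"
  shows "\<exists>c>0. eventually (\<lambda>d. emeasure (P d) {X \<in> space (real_vectors (multi_size p (n d))).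
      \<bar>(\<Sum>k<multi_size p (n d). f (X k)) / real (multi_size p (n d)) - (\<Sum>i<p. \<integral>x. f x \<partial>\<mu> i)\<bar> \<ge> \<eta>}
    \<le> ennreal (exp (- c * (real (multi_size p (n d)))\<^sup>2))) sequentially"
proof -
  define N where "N = (\<lambda>d. multi_size p (n d))"
  obtain \<nu> where "admissible \<nu>" "energy \<nu> < \<infinity>" using finite_energy_exists by blast
  hence "energy \<mu> < \<infinity>" using min[of \<nu>] by (auto intro: le_less_trans)
  then obtain e where e: "energy \<mu> = ennreal e" "e \<ge> 0" by (cases "energy \<mu>") auto
  obtain c where c: "c > 0" and gap: "eventually (\<lambda>d. \<forall>X\<in>configurations (n d).
    \<bar>(\<Sum>k<N d. f (X k)) / real (N d) - (\<Sum>i<p. \<integral>x. f x \<partial>\<mu> i)\<bar> \<ge> \<eta> \<longrightarrow>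
    discrete_energy (n d) X \<ge> ennreal ((real (N d))\<^sup>2 * (e + c))) sequentially"
    using energy_gap[OF \<mu> min e n_pos size ratio f \<eta>] unfolding N_def by blast
  define \<epsilon> where "\<epsilon> = c / 16"
  have \<epsilon>: "\<epsilon> > 0" using c by (simp add: \<epsilon>_def)
  obtain C where C: "C \<ge> 1" and Z: "\<And>n s. (\<And>i. i < p \<Longrightarrow> real (n i) \<le> s * r i) \<Longrightarrow>
    exp (weight_bound n - s\<^sup>2 * e) \<le>
      (C * (1 + \<epsilon>) ^ (2 * multi_size p n)) ^ multi_size p n * fact (multi_size p n) * partition_function p \<tau> n"
    using partition_function_lower_bound[OF \<tau> BM \<epsilon> \<mu> e] by blast
  obtain m where m: "m \<ge> 1"
    "\<And>n. emeasure (tau_product p \<tau> n) (space (tau_product p \<tau> n)) \<le> ennreal (m ^ multi_size p n)"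
    using tau_product_mass[OF \<tau>] by blast
  \<comment> \<open>Since \<open>(1 + \<delta>)\<^sup>2 \<le> 1 + 3 \<delta>\<close> for \<open>\<delta> \<le> 1\<close>, this makes \<open>(1 + \<delta>)\<^sup>2 e \<le> e + c / 8\<close>.\<close>
  define \<delta> where "\<delta> = min 1 (c / (24 * (e + 1)))"
  have \<delta>: "\<delta> > 0" "\<delta> \<le> 1" using c e by (auto simp: \<delta>_def)
  have \<delta>e: "(1 + \<delta>)\<^sup>2 * e \<le> e + c / 8"
  proof -
    have "\<delta> * \<delta> \<le> \<delta> * 1" using \<delta> by (intro mult_left_mono) auto
    hence "(1 + \<delta>)\<^sup>2 \<le> 1 + 3 * \<delta>" by (simp add: power2_eq_square algebra_simps)
    hence "(1 + \<delta>)\<^sup>2 * e \<le> (1 + 3 * \<delta>) * e" using e by (intro mult_right_mono) auto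
    also have "3 * \<delta> * e \<le> 3 * (c / (24 * (e + 1))) * (e + 1)"
      using e c \<delta> by (intro mult_mono) (auto simp: \<delta>_def)
    hence "(1 + 3 * \<delta>) * e \<le> e + 3 * (c / (24 * (e + 1))) * (e + 1)" by (simp add: algebra_simps)
    also have "\<dots> = e + c / 8" using e by (simp add: field_simps)
    finally show ?thesis .
  qed
  have real_size: "filterlim (\<lambda>d. real (N d)) at_top sequentially"
    unfolding N_def by (rule filterlim_compose[OF filterlim_real_sequentially size])
  have N_pos: "N d > 0" for d unfolding N_def by (rule multi_size_pos) (rule n_pos)
  have "eventually (\<lambda>d. \<forall>i\<in>{..<p}. real (n d i) / real (N d) < (1 + \<delta>) * r i) sequentially"
  proof (intro eventually_ball_finite ballI)
    fix i assume i: "i \<in> {..<p}"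
    show "eventually (\<lambda>d. real (n d i) / real (N d) < (1 + \<delta>) * r i) sequentially"
      using order_tendstoD(2)[OF ratio, of i "(1 + \<delta>) * r i"] i r_pos[of i] \<delta> by (simp add: N_def)
  qed auto
  moreover have "eventually (\<lambda>d. (ln C + ln m + ln (real (N d))) / real (N d) < c / 4) sequentially"
  proof -
    have "((\<lambda>x. (ln C + ln m + ln x) / x) \<longlongrightarrow> 0) at_top" by real_asymp
    from filterlim_compose[OF this real_size] show ?thesis
      using c by (intro order_tendstoD) auto
  qed
  ultimately have "eventually (\<lambda>d. emeasure (P d) {X \<in> space (real_vectors (N d)).
      \<bar>(\<Sum>k<N d. f (X k)) / real (N d) - (\<Sum>i<p. \<integral>x. f x \<partial>\<mu> i)\<bar> \<ge> \<eta>}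
    \<le> ennreal (exp (- (c / 2) * (real (N d))\<^sup>2))) sequentially"
    using gap
  proof eventually_elim
    case (elim d)
    define B where "B = {X \<in> space (real_vectors (N d)).
      \<bar>(\<Sum>k<N d. f (X k)) / real (N d) - (\<Sum>i<p. \<integral>x. f x \<partial>\<mu> i)\<bar> \<ge> \<eta>}"
    define x where "x = real (N d)"
    have x: "x \<ge> 1" using N_pos[of d] by (simp add: x_def)
    define W where "W = weight_bound (n d)"
    define Zd where "Zd = partition_function p \<tau> (n d)"
    define K where "K = (C * (1 + \<epsilon>) ^ (2 * N d)) ^ N d * fact (N d)"
    have K: "K > 0" using C \<epsilon> by (simp add: K_def)
    define s where "s = x * (1 + \<delta>)"
    have "exp (W - s\<^sup>2 * e) \<le> K * Zd"
    proof -
      have "real (n d i) \<le> s * r i" if "i < p" for i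
        using elim(1) that x by (auto simp: s_def x_def field_simps less_imp_le)
      from Z[of "n d" s, OF this] show ?thesis by (simp add: W_def K_def Zd_def N_def)
    qed
    hence Zd: "Zd \<ge> exp (W - s\<^sup>2 * e) / K" "Zd > 0"
      using K by (auto simp: field_simps) (metis exp_gt_zero less_le_trans zero_less_mult_pos)
    have f_meas: "f \<in> borel_measurable borel"
      by (rule borel_measurable_isCont[OF f(1)])
    have B_sets: "B \<in> sets (real_vectors (N d))"
    proof -
      have "(\<lambda>X. \<Sum>k<N d. f (X k)) \<in> borel_measurable (real_vectors (N d))"
        by (intro borel_measurable_sum measurable_compose[OF _ f_meas] real_vectors_component) auto
      thus ?thesis unfolding B_def by measurable
    qed
    have "emeasure (P d) B \<le> ennreal (exp (W - x\<^sup>2 * (e + c)) / Zd) *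
        emeasure (tau_product p \<tau> (n d)) (space (tau_product p \<tau> (n d)))"
      unfolding Zd_def
    proof (rule ensemble_measure_le[OF \<tau> P[of d]])
      show "B \<in> sets (real_vectors (multi_size p (n d)))" using B_sets by (simp add: N_def)
      fix X assume X: "X \<in> space (real_vectors (multi_size p (n d)))" "X \<in> B"
      show "sort_coordinates (multi_size p (n d)) X \<in> B"
        using X sum_sort_coordinates[of X "N d" f] measurable_space[OF measurable_sort_coordinates, of X "N d"]
        by (simp add: B_def N_def space_real_vectors)
    next
      fix X assume X: "X \<in> configurations (n d)" "X \<in> B"
      hence "discrete_energy (n d) X \<ge> ennreal (x\<^sup>2 * (e + c))"
        using elim(3) by (simp add: B_def x_def)
      thus "angelesco_weight p (n d) X \<le> exp (W - x\<^sup>2 * (e + c))"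
        unfolding W_def by (rule angelesco_weight_le[OF X(1)])
    qed auto
    also have "\<dots> \<le> ennreal (exp (W - x\<^sup>2 * (e + c)) / Zd) * ennreal (m ^ N d)"
      using m(2)[of "n d"] by (intro mult_left_mono) (auto simp: N_def)
    also have "\<dots> = ennreal (exp (W - x\<^sup>2 * (e + c)) / Zd * m ^ N d)"
      by (rule ennreal_mult[symmetric]) (use Zd m in auto)
    also have "\<dots> \<le> ennreal (exp (- (c / 2) * x\<^sup>2))"
    proof (rule ennreal_leI)
      have "exp (W - x\<^sup>2 * (e + c)) / Zd \<le> exp (W - x\<^sup>2 * (e + c)) / (exp (W - s\<^sup>2 * e) / K)"
        using Zd K by (intro divide_left_mono) auto
      also have "\<dots> = K * exp (s\<^sup>2 * e - x\<^sup>2 * (e + c))"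
        by (simp add: exp_diff)
      finally have 1: "exp (W - x\<^sup>2 * (e + c)) / Zd \<le> K * exp (s\<^sup>2 * e - x\<^sup>2 * (e + c))" .
      have "s\<^sup>2 * e = x\<^sup>2 * ((1 + \<delta>)\<^sup>2 * e)" by (simp add: s_def power_mult_distrib)
      also have "\<dots> \<le> x\<^sup>2 * (e + c / 8)" using \<delta>e by (intro mult_left_mono) auto
      finally have 2: "s\<^sup>2 * e - x\<^sup>2 * (e + c) \<le> - (7 / 8) * c * x\<^sup>2" by (simp add: algebra_simps)
      have 3: "K \<le> exp (x * (ln C + ln x) + 2 * x\<^sup>2 * \<epsilon>)"
        unfolding K_def x_def using C \<epsilon> N_pos by (intro normalization_le) auto
      have "ln C + ln m + ln x \<le> c / 4 * x"
        using elim(2) x by (simp add: x_def[symmetric] field_simps)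
      hence 4: "x * (ln C + ln m + ln x) \<le> c / 4 * x\<^sup>2"
        using x mult_left_mono[of "ln C + ln m + ln x" "c / 4 * x" x] by (simp add: power2_eq_square mult_ac)
      have "exp (W - x\<^sup>2 * (e + c)) / Zd * m ^ N d \<le>
          (exp (x * (ln C + ln x) + 2 * x\<^sup>2 * \<epsilon>) * exp (- (7 / 8) * c * x\<^sup>2)) * exp (x * ln m)"
      proof (intro mult_mono)
        show "exp (W - x\<^sup>2 * (e + c)) / Zd \<le> exp (x * (ln C + ln x) + 2 * x\<^sup>2 * \<epsilon>) * exp (- (7 / 8) * c * x\<^sup>2)"
          using 1 by (rule order.trans) (use 2 3 K in \<open>intro mult_mono, auto\<close>)
        show "m ^ N d \<le> exp (x * ln m)" using m by (simp add: x_def exp_of_nat_mult)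
      qed (use m in auto)
      also have "\<dots> = exp (x * (ln C + ln m + ln x) + 2 * x\<^sup>2 * \<epsilon> - (7 / 8) * c * x\<^sup>2)"
        by (simp add: algebra_simps flip: exp_add)
      also have "\<dots> \<le> exp (- (c / 2) * x\<^sup>2)"
        using 4 by (simp add: \<epsilon>_def algebra_simps)
      finally show "exp (W - x\<^sup>2 * (e + c)) / Zd * m ^ N d \<le> exp (- (c / 2) * x\<^sup>2)" .
    qed
    finally show ?case by (simp add: B_def x_def)
  qed
  thus ?thesis using c unfolding N_def by (intro exI[of _ "c / 2"]) auto
qed

text \<open>
  The event that some coordinate lies outside the intervals contains no configuration, so that \<open>0\<close>
  bounds the weight on all configurations in it.
\<close>

lemma ensemble_support:
  assumes \<tau>: "\<And>i. i < p \<Longrightarrow> finite_borel_measure_on (\<Gamma> i) (\<tau> i)"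
    and P: "is_angelesco_ensemble p \<tau> n P"
  shows "AE X in P. \<forall>k<multi_size p n. X k \<in> (\<Union>i<p. \<Gamma> i)"
proof -
  define N where "N = multi_size p n"
  define S where "S = (\<Union>i<p. \<Gamma> i)"
  have S: "S \<in> sets borel" unfolding S_def by auto
  have sets_P: "sets P = sets (real_vectors N)" using P by (simp add: is_angelesco_ensemble_def Let_def N_def)
  define B where "B = {X \<in> space (real_vectors N). \<exists>k\<in>{..<N}. X k \<notin> S}"
  have B_sets: "B \<in> sets (real_vectors N)"
    unfolding B_def
  proof (intro sets.sets_Collect_finite_Ex)
    fix k assume "k \<in> {..<N}"
    hence "(\<lambda>X. X k) -` (- S) \<inter> space (real_vectors N) \<in> sets (real_vectors N)"
      using S by (intro measurable_sets[OF real_vectors_component]) auto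
    also have "(\<lambda>X. X k) -` (- S) \<inter> space (real_vectors N) = {X \<in> space (real_vectors N). X k \<notin> S}" by auto
    finally show "{X \<in> space (real_vectors N). X k \<notin> S} \<in> sets (real_vectors N)" .
  qed simp
  have "emeasure P B \<le> ennreal (0 / partition_function p \<tau> n) * emeasure (tau_product p \<tau> n) (space (tau_product p \<tau> n))"
  proof (rule ensemble_measure_le[OF \<tau> P])
    show "B \<in> sets (real_vectors (multi_size p n))" using B_sets by (simp add: N_def)
    fix X assume X: "X \<in> space (real_vectors (multi_size p n))" "X \<in> B"
    hence ext: "X \<in> extensional {..<N}" by (simp add: space_real_vectors N_def)
    obtain \<pi> where \<pi>: "\<pi> permutes {..<N}" "sort_coordinates N X = X \<circ> \<pi>"
      by (rule sort_coordinates_obtain[OF ext])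
    obtain k where k: "k < N" "X k \<notin> S" using X by (auto simp: B_def)
    obtain l where l: "\<pi> l = k" using permutes_surj[OF \<pi>(1)] by (metis surjD)
    hence "l < N" using permutes_in_image[OF \<pi>(1), of l] k by simp
    thus "sort_coordinates (multi_size p n) X \<in> B"
      using X l k \<pi>(2) measurable_space[OF measurable_sort_coordinates, of X N]
      by (auto simp: B_def N_def)
  next
    fix X assume X: "X \<in> configurations n" "X \<in> B"
    then obtain k where "k < N" "X k \<notin> S" by (auto simp: B_def)
    with configurationsD[OF X(1), of k] show "angelesco_weight p n X \<le> 0"
      by (auto simp: S_def N_def)
  qed simp_all
  hence "B \<in> null_sets P" using B_sets sets_P by (auto simp: null_sets_def)
  hence "AE X in P. X \<notin> B" by (rule AE_not_in)
  with AE_space[of P] show ?thesis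
    by eventually_elim (auto simp: B_def S_def N_def sets_eq_imp_space_eq[OF sets_P])
qed

text \<open>
  Clamping to the convex hull of the intervals turns the monomials into bounded continuous test functions
  and does not change them on the intervals.
\<close>

definition clamp_hull :: "real \<Rightarrow> real" where
  "clamp_hull x = max (a 0) (min (b (p - 1)) x)"

lemma clamp_hull_id: "x \<in> (\<Union>i<p. \<Gamma> i) \<Longrightarrow> clamp_hull x = x"
  using hull by (force simp: clamp_hull_def max_def min_def)

lemma clamp_hull_power:
  "isCont (\<lambda>x. clamp_hull x ^ m) x" "\<bar>clamp_hull x ^ m\<bar> \<le> max \<bar>a 0\<bar> \<bar>b (p - 1)\<bar> ^ m"
proof -
  show "isCont (\<lambda>x. clamp_hull x ^ m) x" unfolding clamp_hull_def by (intro continuous_intros)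
  have "\<bar>clamp_hull x\<bar> \<le> max \<bar>a 0\<bar> \<bar>b (p - 1)\<bar>" by (auto simp: clamp_hull_def max_def min_def)
  thus "\<bar>clamp_hull x ^ m\<bar> \<le> max \<bar>a 0\<bar> \<bar>b (p - 1)\<bar> ^ m"
    unfolding power_abs by (rule power_mono) simp
qed

text \<open>
  By the Stone--Weierstrass theorem polynomials suffice as test functions, so countably many of them do.
\<close>

lemma moments_imp_weak_star_conv:
  assumes \<mu>: "admissible \<mu>" and N: "\<And>d. N d > 0"
    and X: "\<And>d k. k < N d \<Longrightarrow> X d k \<in> (\<Union>i<p. \<Gamma> i)"
    and moments: "\<And>m. (\<lambda>d. (\<Sum>k<N d. clamp_hull (X d k) ^ m) / real (N d)) \<longlonglongrightarrow> (\<Sum>i<p. \<integral>x. clamp_hull x ^ m \<partial>\<mu> i)"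
  shows "weak_star_conv (\<Union>i<p. \<Gamma> i) (\<lambda>d. normalized_counting_measure (N d) (X d)) (sum_measure p \<mu>)"
  unfolding weak_star_conv_def
proof (intro allI impI)
  fix f :: "real \<Rightarrow> real"
  define K where "K = (\<Union>i<p. \<Gamma> i)"
  assume "continuous_on (\<Union>i<p. \<Gamma> i) f"
  hence f: "continuous_on K f" by (simp add: K_def)
  have K: "compact K" unfolding K_def by (intro compact_UN) auto
  hence K_borel: "K \<in> sets borel" by (intro borel_compact)
  define g where "g = (\<lambda>x. indicator K x *\<^sub>R f x)"
  have g: "g \<in> borel_measurable borel"
    unfolding g_def by (rule borel_measurable_continuous_on_indicator[OF K_borel f])
  obtain F where F: "\<And>x. x \<in> K \<Longrightarrow> \<bar>f x\<bar> \<le> F"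
    using compact_imp_bounded[OF compact_continuous_image[OF f K]] by (auto simp: bounded_iff)
  have g_int: "integrable (\<mu> i) g" if "i < p" for i
  proof -
    interpret finite_measure "\<mu> i" by (rule admissibleD(2)[OF \<mu> that])
    show ?thesis
      using g F by (intro integrable_const_bound[where B = "max F 0"] always_eventually)
        (auto simp: g_def indicator_def max.coboundedI1 measurable_cong_sets[OF admissibleD(3)[OF \<mu> that] refl])
  qed
  have lhs: "(LINT x:K|normalized_counting_measure (N d) (X d). f x) = (\<Sum>k<N d. f (X d k)) / real (N d)" for d
  proof -
    have "(LINT x:K|normalized_counting_measure (N d) (X d). f x) = (\<Sum>k<N d. g (X d k)) / real (N d)"
      unfolding set_lebesgue_integral_def g_def[symmetric] by (rule integral_normalized_counting_measure[OF g])
    also have "(\<Sum>k<N d. g (X d k)) = (\<Sum>k<N d. f (X d k))"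
      using X by (intro sum.cong) (auto simp: g_def K_def)
    finally show ?thesis .
  qed
  have rhs: "(LINT x:K|sum_measure p \<mu>. f x) = (\<Sum>i<p. \<integral>x. g x \<partial>\<mu> i)"
    unfolding set_lebesgue_integral_def g_def[symmetric]
    by (rule integral_sum_measure[OF admissibleD(3)[OF \<mu>] g g_int])
  show "(\<lambda>d. LINT x:(\<Union>i<p. \<Gamma> i)|normalized_counting_measure (N d) (X d). f x)
      \<longlonglongrightarrow> (LINT x:(\<Union>i<p. \<Gamma> i)|sum_measure p \<mu>. f x)"
    unfolding K_def[symmetric] lhs rhs
  proof (rule tendstoI)
    fix \<epsilon> :: real assume \<epsilon>: "\<epsilon> > 0"
    obtain q where q: "real_polynomial_function q" "\<And>x. x \<in> K \<Longrightarrow> \<bar>f x - q x\<bar> < \<epsilon> / 3"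
      using Stone_Weierstrass_real_polynomial_function[OF K f, of "\<epsilon> / 3"] \<epsilon> by auto
    obtain \<alpha> m where q_eq: "q = (\<lambda>x. \<Sum>j\<le>m. \<alpha> j * x ^ j)"
      using q(1) unfolding real_polynomial_function_iff_sum by (auto simp: fun_eq_iff)
    define I where "I = (\<Sum>j\<le>m. \<alpha> j * (\<Sum>i<p. \<integral>x. clamp_hull x ^ j \<partial>\<mu> i))"
    have "(\<lambda>d. \<Sum>j\<le>m. \<alpha> j * ((\<Sum>k<N d. clamp_hull (X d k) ^ j) / real (N d))) \<longlonglongrightarrow> I"
      unfolding I_def by (intro tendsto_sum tendsto_mult tendsto_const moments)
    also have "(\<lambda>d. \<Sum>j\<le>m. \<alpha> j * ((\<Sum>k<N d. clamp_hull (X d k) ^ j) / real (N d))) =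
      (\<lambda>d. (\<Sum>k<N d. q (X d k)) / real (N d))"
    proof
      fix d
      have "(\<Sum>k<N d. q (X d k)) = (\<Sum>k<N d. \<Sum>j\<le>m. \<alpha> j * clamp_hull (X d k) ^ j)"
        unfolding q_eq using clamp_hull_id[OF X] by (intro sum.cong) auto
      also have "\<dots> = (\<Sum>j\<le>m. \<alpha> j * (\<Sum>k<N d. clamp_hull (X d k) ^ j))"
        by (subst sum.swap) (simp add: sum_distrib_left)
      finally show "(\<Sum>j\<le>m. \<alpha> j * ((\<Sum>k<N d. clamp_hull (X d k) ^ j) / real (N d))) =
        (\<Sum>k<N d. q (X d k)) / real (N d)"
        by (simp only: times_divide_eq_right sum_divide_distrib[where A = "{..m}"])
    qed
    finally have ev: "eventually (\<lambda>d. dist ((\<Sum>k<N d. q (X d k)) / real (N d)) I < \<epsilon> / 3) sequentially"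
      using \<epsilon> by (intro tendstoD) auto
    have close: "\<bar>(\<Sum>k<N d. f (X d k)) / real (N d) - (\<Sum>k<N d. q (X d k)) / real (N d)\<bar> \<le> \<epsilon> / 3" for d
    proof -
      have "\<bar>(\<Sum>k<N d. f (X d k)) - (\<Sum>k<N d. q (X d k))\<bar> \<le> (\<Sum>k<N d. \<bar>f (X d k) - q (X d k)\<bar>)"
        by (simp add: sum_subtractf[symmetric])
      also have "\<dots> \<le> (\<Sum>k<N d. \<epsilon> / 3)"
        using q(2) X by (intro sum_mono less_imp_le) (auto simp: K_def)
      also have "\<dots> = real (N d) * (\<epsilon> / 3)" by simp
      finally show ?thesis using N[of d]
        by (simp add: diff_divide_distrib[symmetric] abs_divide field_simps)
    qed
    have "\<bar>(\<Sum>i<p. \<integral>x. g x \<partial>\<mu> i) - I\<bar> \<le> \<epsilon> / 3"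
    proof -
      have q_int: "integrable (\<mu> i) (\<lambda>x. clamp_hull x ^ j)" if "i < p" for i j
      proof -
        interpret finite_measure "\<mu> i" by (rule admissibleD(2)[OF \<mu> that])
        have "(\<lambda>x. clamp_hull x ^ j) \<in> borel_measurable borel"
          by (rule borel_measurable_isCont[OF clamp_hull_power(1)])
        thus ?thesis using clamp_hull_power(2)
          by (intro integrable_const_bound always_eventually)
             (auto simp: measurable_cong_sets[OF admissibleD(3)[OF \<mu> that] refl])
      qed
      have "I = (\<Sum>i<p. \<Sum>j\<le>m. \<alpha> j * (\<integral>x. clamp_hull x ^ j \<partial>\<mu> i))"
        unfolding I_def by (subst sum.swap) (simp add: sum_distrib_left)
      also have "\<dots> = (\<Sum>i<p. \<integral>x. (\<Sum>j\<le>m. \<alpha> j * clamp_hull x ^ j) \<partial>\<mu> i)"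
        using q_int by (intro sum.cong refl) (subst Bochner_Integration.integral_sum, auto)
      finally have "(\<Sum>i<p. \<integral>x. g x \<partial>\<mu> i) - I =
        (\<Sum>i<p. (\<integral>x. g x \<partial>\<mu> i) - (\<integral>x. (\<Sum>j\<le>m. \<alpha> j * clamp_hull x ^ j) \<partial>\<mu> i))"
        by (simp add: sum_subtractf)
      also have "\<bar>\<dots>\<bar> \<le> (\<Sum>i<p. r i * (\<epsilon> / 3))"
      proof (rule order.trans[OF sum_abs], rule sum_mono)
        fix i assume "i \<in> {..<p}"
        hence i: "i < p" by simp
        interpret finite_measure "\<mu> i" by (rule admissibleD(2)[OF \<mu> i])
        have "space (\<mu> i) = UNIV" using sets_eq_imp_space_eq[OF admissibleD(3)[OF \<mu> i]] by simp
        hence mass: "measure (\<mu> i) (space (\<mu> i)) = r i" using admissibleD(5)[OF \<mu> i] by simp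
        let ?Q = "\<lambda>x. \<Sum>j\<le>m. \<alpha> j * clamp_hull x ^ j"
        have Q_int: "integrable (\<mu> i) ?Q"
          using q_int[OF i] by (intro Bochner_Integration.integrable_sum integrable_mult_right) auto
        have "\<bar>(\<integral>x. g x \<partial>\<mu> i) - (\<integral>x. ?Q x \<partial>\<mu> i)\<bar> = \<bar>\<integral>x. g x - ?Q x \<partial>\<mu> i\<bar>"
          using Bochner_Integration.integral_diff[OF g_int[OF i] Q_int] by simp
        also have "\<dots> \<le> (\<integral>x. \<bar>g x - ?Q x\<bar> \<partial>\<mu> i)" by (rule integral_abs_bound)
        also have "\<dots> \<le> (\<integral>x. \<epsilon> / 3 \<partial>\<mu> i)"
        proof (rule integral_mono_AE)
          show "integrable (\<mu> i) (\<lambda>x. \<bar>g x - ?Q x\<bar>)"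
            by (intro integrable_abs Bochner_Integration.integrable_diff g_int[OF i] Q_int)
          show "integrable (\<mu> i) (\<lambda>x. \<epsilon> / 3)" by simp
          show "AE x in \<mu> i. \<bar>g x - ?Q x\<bar> \<le> \<epsilon> / 3"
            using admissibleD(4)[OF \<mu> i]
          proof eventually_elim
            case (elim x)
            hence x: "x \<in> K" using i by (auto simp: K_def)
            hence "?Q x = q x" using clamp_hull_id[of x] by (simp add: q_eq K_def)
            thus ?case using q(2)[OF x] x by (simp add: g_def)
          qed
        qed
        also have "\<dots> = r i * (\<epsilon> / 3)" by (simp add: mass)
        finally show "\<bar>(\<integral>x. g x \<partial>\<mu> i) - (\<integral>x. ?Q x \<partial>\<mu> i)\<bar> \<le> r i * (\<epsilon> / 3)" .
      qed
      also have "\<dots> = \<epsilon> / 3" unfolding sum_distrib_right[symmetric] r_sum by simp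
      finally show ?thesis .
    qed
    note I_close = this
    show "eventually (\<lambda>d. dist ((\<Sum>k<N d. f (X d k)) / real (N d)) (\<Sum>i<p. \<integral>x. g x \<partial>\<mu> i) < \<epsilon>) sequentially"
      using ev
    proof eventually_elim
      case (elim d)
      show ?case using elim close[of d] I_close \<epsilon> unfolding dist_real_def by linarith
    qed
  qed
qed

text \<open>
  Borel--Cantelli for each of the countably many pairs of a moment and a precision \<open>1 / (j + 1)\<close>.
\<close>

lemma almost_sure_convergence:
  fixes n :: "nat \<Rightarrow> nat \<Rightarrow> nat"
  assumes \<mu>: "admissible \<mu>" and min: "\<And>\<nu>. admissible \<nu> \<Longrightarrow> energy \<mu> \<le> energy \<nu>"
    and n_pos: "\<And>d i. i < p \<Longrightarrow> n d i > 0"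
    and growth: "borel_cantelli_growth (\<lambda>d. multi_size p (n d))"
    and ratio: "\<And>i. i < p \<Longrightarrow> (\<lambda>d. real (n d i) / real (multi_size p (n d))) \<longlonglongrightarrow> r i"
    and \<tau>: "\<And>i. i < p \<Longrightarrow> finite_borel_measure_on (\<Gamma> i) (\<tau> i)"
    and BM: "\<And>i. i < p \<Longrightarrow> BM_inequality (\<Gamma> i) (\<tau> i)"
    and ens: "\<And>d. is_angelesco_ensemble p \<tau> (n d) (P d)"
  shows "AE X in Pi\<^sub>M UNIV P. weak_star_conv (\<Union>i<p. \<Gamma> i)
    (\<lambda>d. normalized_counting_measure (multi_size p (n d)) (X d)) (sum_measure p \<mu>)"
proof -
  define N where "N = (\<lambda>d. multi_size p (n d))"
  have N_pos: "N d > 0" for d unfolding N_def by (rule multi_size_pos) (rule n_pos)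
  have summ: "summable (\<lambda>d. exp (- c * (real (N d))\<^sup>2))" if "c > 0" for c
    using growth that by (auto simp: borel_cantelli_growth_def N_def)
  \<comment> \<open>The terms of a convergent series tend to zero, so the sizes tend to infinity.\<close>
  have size: "filterlim (\<lambda>d. multi_size p (n d)) at_top sequentially"
    unfolding filterlim_at_top N_def[symmetric]
  proof
    fix z :: nat
    have "(\<lambda>d. exp (- 1 * (real (N d))\<^sup>2)) \<longlonglongrightarrow> 0" by (rule summable_LIMSEQ_zero[OF summ]) simp
    hence "eventually (\<lambda>d. exp (- 1 * (real (N d))\<^sup>2) < exp (- (real z)\<^sup>2)) sequentially"
      by (rule order_tendstoD) simp
    thus "eventually (\<lambda>d. z \<le> N d) sequentially"
    proof eventually_elim
      case (elim d)
      hence "(real z)\<^sup>2 < (real (N d))\<^sup>2" by simp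
      hence "real z < real (N d)" by (rule power2_less_imp_less) simp
      thus ?case by simp
    qed
  qed
  have sets_ensemble: "sets (P d) = sets (real_vectors (N d))" and prob_ensemble: "prob_space (P d)" for d
    using ens[of d] by (auto simp: is_angelesco_ensemble_def Let_def N_def)
  interpret product_prob_space P UNIV by (intro product_prob_spaceI prob_ensemble)
  have comp: "(\<lambda>X. X d) \<in> Pi\<^sub>M UNIV P \<rightarrow>\<^sub>M P d" for d by (rule measurable_component_singleton) simp
  define J where "J = (\<lambda>m. \<Sum>i<p. \<integral>x. clamp_hull x ^ m \<partial>\<mu> i)"
  define bad where "bad = (\<lambda>m \<eta> d. {Y \<in> space (real_vectors (N d)).
    \<bar>(\<Sum>k<N d. clamp_hull (Y k) ^ m) / real (N d) - J m\<bar> \<ge> \<eta>})"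
  have clamp_meas: "(\<lambda>x. clamp_hull x ^ m) \<in> borel_measurable borel" for m
    by (rule borel_measurable_isCont[OF clamp_hull_power(1)])
  have bad_sets: "bad m \<eta> d \<in> sets (P d)" for m \<eta> d
  proof -
    have "(\<lambda>Y. \<Sum>k<N d. clamp_hull (Y k) ^ m) \<in> borel_measurable (real_vectors (N d))"
      by (intro borel_measurable_sum measurable_compose[OF _ clamp_meas] real_vectors_component) auto
    hence "bad m \<eta> d \<in> sets (real_vectors (N d))" unfolding bad_def by measurable
    thus ?thesis by (simp only: sets_ensemble)
  qed
  have bc: "AE X in Pi\<^sub>M UNIV P. eventually (\<lambda>d. X d \<notin> bad m \<eta> d) sequentially" if \<eta>: "\<eta> > 0" for m \<eta>
  proof -
    obtain c where c: "c > 0" and ev: "eventually (\<lambda>d. emeasure (P d) (bad m \<eta> d) \<le> ennreal (exp (- c * (real (N d))\<^sup>2))) sequentially"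
      using deviation_probability[OF \<mu> min n_pos size ratio \<tau> BM ens clamp_hull_power \<eta>, of m]
      unfolding bad_def J_def N_def by blast
    define E where "E = (\<lambda>d. {X \<in> space (Pi\<^sub>M UNIV P). X d \<in> bad m \<eta> d})"
    have E_sets: "E d \<in> sets (Pi\<^sub>M UNIV P)" for d
      using measurable_sets[OF comp bad_sets] by (simp add: E_def vimage_def Int_def conj_commute)
    have E_em: "emeasure (Pi\<^sub>M UNIV P) (E d) = emeasure (P d) (bad m \<eta> d)" for d
      unfolding E_def by (rule emeasure_PiM_Collect_single) (auto intro: bad_sets)
    have "AE X in Pi\<^sub>M UNIV P. eventually (\<lambda>d. X \<in> space (Pi\<^sub>M UNIV P) - E d) sequentially"
    proof (rule borel_cantelli_AE1[OF E_sets])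
      show "emeasure (Pi\<^sub>M UNIV P) (E d) < \<infinity>" for d by (simp add: P.emeasure_eq_measure)
      show "summable (\<lambda>d. measure (Pi\<^sub>M UNIV P) (E d))"
      proof (rule summable_comparison_test_ev[OF _ summ[OF c]])
        show "eventually (\<lambda>d. norm (measure (Pi\<^sub>M UNIV P) (E d)) \<le> exp (- c * (real (N d))\<^sup>2)) sequentially"
          using ev
        proof eventually_elim
          case (elim d)
          hence "emeasure (Pi\<^sub>M UNIV P) (E d) \<le> ennreal (exp (- c * (real (N d))\<^sup>2))" by (simp add: E_em)
          thus ?case by (simp add: measure_def enn2real_leI)
        qed
      qed
    qed
    thus ?thesis
    proof eventually_elim
      case (elim X)
      thus ?case by eventually_elim (auto simp: E_def)
    qed
  qed
  have "AE X in Pi\<^sub>M UNIV P. \<forall>m j. eventually (\<lambda>d. X d \<notin> bad m (1 / real (Suc j)) d) sequentially"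
    unfolding AE_all_countable by (intro allI bc) simp
  moreover have "AE X in Pi\<^sub>M UNIV P. \<forall>d. \<forall>k<N d. X d k \<in> (\<Union>i<p. \<Gamma> i)"
  proof (subst AE_all_countable, rule allI)
    fix d
    have "AE Y in P d. \<forall>k<N d. Y k \<in> (\<Union>i<p. \<Gamma> i)" unfolding N_def by (rule ensemble_support[OF \<tau> ens])
    thus "AE X in Pi\<^sub>M UNIV P. \<forall>k<N d. X d k \<in> (\<Union>i<p. \<Gamma> i)"
      by (intro AE_PiM_component[where P = "\<lambda>Y. \<forall>k<N d. Y k \<in> (\<Union>i<p. \<Gamma> i)"] prob_ensemble) auto
  qed
  moreover have "AE X in Pi\<^sub>M UNIV P. X \<in> space (Pi\<^sub>M UNIV P)" by (rule AE_space)
  ultimately show ?thesis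
  proof eventually_elim
    case (elim X)
    have X_space: "X d \<in> space (real_vectors (N d))" for d
      using elim(3) sets_eq_imp_space_eq[OF sets_ensemble[of d]] by (auto simp: space_PiM PiE_iff)
    have "weak_star_conv (\<Union>i<p. \<Gamma> i) (\<lambda>d. normalized_counting_measure (N d) (X d)) (sum_measure p \<mu>)"
    proof (rule moments_imp_weak_star_conv[OF \<mu> N_pos])
      fix m
      have "(\<lambda>d. (\<Sum>k<N d. clamp_hull (X d k) ^ m) / real (N d)) \<longlonglongrightarrow> J m"
      proof (rule tendstoI)
        fix \<epsilon> :: real assume "\<epsilon> > 0"
        then obtain j where j: "1 / real (Suc j) < \<epsilon>" using nat_approx_posE by blast
        have "eventually (\<lambda>d. X d \<notin> bad m (1 / real (Suc j)) d) sequentially" using elim(1) by blast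
        thus "eventually (\<lambda>d. dist ((\<Sum>k<N d. clamp_hull (X d k) ^ m) / real (N d)) (J m) < \<epsilon>) sequentially"
          by eventually_elim (use j X_space in \<open>force simp: bad_def dist_real_def\<close>)
      qed
      thus "(\<lambda>d. (\<Sum>k<N d. clamp_hull (X d k) ^ m) / real (N d)) \<longlonglongrightarrow> (\<Sum>i<p. \<integral>x. clamp_hull x ^ m \<partial>\<mu> i)"
        by (simp add: J_def)
    qed (use elim(2) in blast)
    thus ?case by (simp add: N_def)
  qed
qed

end

theorem theorem4p4:
  fixes p :: nat
    and a b r :: "nat \<Rightarrow> real"
    and \<Gamma> :: "nat \<Rightarrow> real set"
    and \<tau> \<mu> :: "nat \<Rightarrow> real measure"
    and n :: "nat \<Rightarrow> nat \<Rightarrow> nat"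
    and P :: "nat \<Rightarrow> (nat \<Rightarrow> real) measure"
  assumes "p \<ge> 1"
    and "\<And>i. i < p \<Longrightarrow> a i < b i"
    and "\<And>i. i < p \<Longrightarrow> \<Gamma> i = {a i..b i}"
    and "\<And>i. Suc i < p \<Longrightarrow> b i < a (Suc i)"
    and "\<And>i. i < p \<Longrightarrow> r i > 0"
    and "(\<Sum>i<p. r i) = 1"
    and "\<And>d i. i < p \<Longrightarrow> n d i > 0"
    and "\<And>i. i < p \<Longrightarrow> (\<lambda>d. real (n d i) / real (multi_size p (n d))) \<longlonglongrightarrow> r i"
    and "borel_cantelli_growth (\<lambda>d. multi_size p (n d))"
    and "\<And>i. i < p \<Longrightarrow> finite_borel_measure_on (\<Gamma> i) (\<tau> i)"
    and "\<And>i. i < p \<Longrightarrow> BM_inequality (\<Gamma> i) (\<tau> i)"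
    and "\<And>d. is_angelesco_ensemble p \<tau> (n d) (P d)"
    and "is_equilibrium p \<Gamma> r \<mu>"
  shows "AE X in Pi\<^sub>M UNIV P.
           weak_star_conv (\<Union>i<p. \<Gamma> i)
             (\<lambda>d. normalized_counting_measure (multi_size p (n d)) (X d))
             (sum_measure p \<mu>)"
proof -
  define T where "T = max 1 (b (p - 1) - a 0)"
  interpret S: angelesco_system p a b r T
    by unfold_locales (use assms in \<open>auto simp: T_def\<close>)
  have adm: "\<nu> \<in> admissible_tuples p \<Gamma> r \<longleftrightarrow> S.admissible \<nu>" for \<nu>
    by (rule S.admissible_iff) (rule assms(3))
  have E: "angelesco_energy p \<nu> + ereal ((ln T + 1) * interaction_form p r) = enn2ereal (window_energy p T \<nu>)"
    if "S.admissible \<nu>" for \<nu>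
  proof (rule angelesco_energy_window)
    show "\<nu> \<in> admissible_tuples p \<Gamma> r" using that adm by simp
    show "\<bar>x - y\<bar> \<le> T" if "i < p" "j < p" "x \<in> \<Gamma> i" "y \<in> \<Gamma> j" for i j x y
      using that assms(3) by (intro S.diameter[of i j]) auto
  qed (use assms in \<open>auto simp: T_def\<close>)
  have \<mu>: "S.admissible \<mu>" and not_less: "\<And>\<nu>. S.admissible \<nu> \<Longrightarrow> \<not> angelesco_energy p \<nu> < angelesco_energy p \<mu>"
    using assms(13) adm by (auto simp: is_equilibrium_def is_arg_min_def)
  have min: "window_energy p T \<mu> \<le> window_energy p T \<nu>" if "S.admissible \<nu>" for \<nu>
  proof -
    have "angelesco_energy p \<mu> \<le> angelesco_energy p \<nu>" using not_less[OF that] by simp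
    hence "enn2ereal (window_energy p T \<mu>) \<le> enn2ereal (window_energy p T \<nu>)"
      unfolding E[OF \<mu>, symmetric] E[OF that, symmetric] by (rule add_right_mono)
    thus ?thesis by (simp add: less_eq_ennreal.rep_eq)
  qed
  have union: "(\<Union>i<p. \<Gamma> i) = (\<Union>i<p. {a i..b i})" using assms(3) by auto
  show ?thesis unfolding union
  proof (rule S.almost_sure_convergence[OF \<mu> min])
    show "finite_borel_measure_on {a i..b i} (\<tau> i)" "BM_inequality {a i..b i} (\<tau> i)" if "i < p" for i
      using assms(10,11)[OF that] assms(3)[OF that] by auto
  qed (use assms in auto)
qed

end
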